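(* Let $X$ be a smooth projective variety over $\mathbb C$ of dimension $n$, let $H$ be a very ample divisor on $X$, and let $\iota\colon X\hookrightarrow\mathbb P^N$ be the embedding defined by $H$. Put $N_X:=N_{X/\mathbb P^N}$, and let $B=T_{\mathbb P^N}|_X$ or $B=N_X$. If $m,k$ are integers with $1\leq m\leq\operatorname{rk}(B)$ and $1\leq k+m\leq n$, then $\bigwedge^m B(kH)$ is not $H$-Ulrich.
   Context: Everything is over the complex numbers $\mathbb C$. The embedding $\iota$ satisfies $\mathcal O_X(H)\simeq\iota^*\mathcal O_{\mathbb P^N}(1)$. $T_{\mathbb P^N}|_X:=\iota^*T_{\mathbb P^N}$ is the restricted tangent bundle of $\mathbb P^N$, and $N_{X/\mathbb P^N}$ is the normal bundle of $X$ in $\mathbb P^N$. For a coherent sheaf $F$ on $X$ and an integer $t$, $F(tH):=F\otimes\mathcal O_X(tH)$; thus $\bigwedge^m B(kH)$ means $(\bigwedge^m B)\otimes\mathcal O_X(kH)$. For $H$ very ample on a smooth projective variety $X$ of dimension $n$, a vector bundle $E$ on $X$ is called $H$-Ulrich if $H^q(X,E(-iH))=0$ for every integer $i$ with $1\leq i\leq n$ and every $q$. *)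

theory Defs
  imports
    Complex_Main
    "HOL-Library.Extended_Nat"
    "HOL-Library.FuncSet"
    "HOL-Analysis.Abstract_Topology"
    "HOL-Algebra.AbelCoset"
    "Jordan_Normal_Form.VS_Connect"
begin

section \<open>Complex vector spaces\<close>

text \<open>
  Vector spaces are records of type \<^typ>\<open>(complex, 'v) module\<close> over the field \<open>CC\<close>, as in
  \<open>HOL-Algebra\<close> and in the theory of vector spaces based on it. The multiplicative fields of
  the record type play no role.
\<close>

abbreviation CC :: "complex ring" where
  "CC \<equiv> class_ring"

definition fun_vs :: "('y \<Rightarrow> complex) set \<Rightarrow> (complex, 'y \<Rightarrow> complex) module" where
  "fun_vs S = \<lparr>carrier = S, mult = (\<lambda>_ _ _. 0), one = (\<lambda>_. 0), zero = (\<lambda>_. 0),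
     add = (\<lambda>f g y. f y + g y), smult = (\<lambda>c f y. c * f y)\<rparr>"

definition quot_vs :: "(complex, 'v) module \<Rightarrow> 'v set \<Rightarrow> (complex, 'v set) module" where
  "quot_vs V W = \<lparr>carrier = a_rcosets\<^bsub>V\<^esub> W, mult = (\<lambda>_ _. W), one = W, zero = W,
     add = set_add V, smult = (\<lambda>c A. \<Union>v\<in>A. W +>\<^bsub>V\<^esub> (c \<odot>\<^bsub>V\<^esub> v))\<rparr>"

definition free_vs :: "'s set \<Rightarrow> (complex, 's \<Rightarrow> complex) module" where
  "free_vs S = fun_vs {f. finite {s. f s \<noteq> 0} \<and> {s. f s \<noteq> 0} \<subseteq> S}"

definition free_gen :: "'s \<Rightarrow> 's \<Rightarrow> complex" where
  "free_gen s = (\<lambda>t. if t = s then 1 else 0)"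

definition presented_vs :: "'s set \<Rightarrow> ('s \<Rightarrow> complex) set \<Rightarrow> (complex, ('s \<Rightarrow> complex) set) module" where
  "presented_vs S R = quot_vs (free_vs S) (LinearCombinations.module.span CC (free_vs S) R)"

definition presented_class :: "'s set \<Rightarrow> ('s \<Rightarrow> complex) set \<Rightarrow> 's \<Rightarrow> ('s \<Rightarrow> complex) set" where
  "presented_class S R s =
     LinearCombinations.module.span CC (free_vs S) R +>\<^bsub>free_vs S\<^esub> free_gen s"

definition tensor_rels ::
  "(complex, 'v) module \<Rightarrow> (complex, 'w) module \<Rightarrow> ('v \<times> 'w \<Rightarrow> complex) set" where
  "tensor_rels V W =
     {\<lambda>p. free_gen (v \<oplus>\<^bsub>V\<^esub> v', w) p - free_gen (v, w) p - free_gen (v', w) p | v v' w.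
        v \<in> carrier V \<and> v' \<in> carrier V \<and> w \<in> carrier W} \<union>
     {\<lambda>p. free_gen (v, w \<oplus>\<^bsub>W\<^esub> w') p - free_gen (v, w) p - free_gen (v, w') p | v w w'.
        v \<in> carrier V \<and> w \<in> carrier W \<and> w' \<in> carrier W} \<union>
     {\<lambda>p. free_gen (c \<odot>\<^bsub>V\<^esub> v, w) p - c * free_gen (v, w) p | c v w.
        v \<in> carrier V \<and> w \<in> carrier W} \<union>
     {\<lambda>p. free_gen (v, c \<odot>\<^bsub>W\<^esub> w) p - c * free_gen (v, w) p | c v w.
        v \<in> carrier V \<and> w \<in> carrier W}"

definition tensor_vs ::
  "(complex, 'v) module \<Rightarrow> (complex, 'w) module \<Rightarrow> (complex, ('v \<times> 'w \<Rightarrow> complex) set) module" where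
  "tensor_vs V W = presented_vs (carrier V \<times> carrier W) (tensor_rels V W)"

definition tensor_elt ::
  "(complex, 'v) module \<Rightarrow> (complex, 'w) module \<Rightarrow> 'v \<Rightarrow> 'w \<Rightarrow> ('v \<times> 'w \<Rightarrow> complex) set" where
  "tensor_elt V W v w = presented_class (carrier V \<times> carrier W) (tensor_rels V W) (v, w)"

definition tuples :: "nat \<Rightarrow> 'a set \<Rightarrow> 'a list set" where
  "tuples m S = {xs. length xs = m \<and> set xs \<subseteq> S}"

definition wedge_rels :: "nat \<Rightarrow> (complex, 'v) module \<Rightarrow> ('v list \<Rightarrow> complex) set" where
  "wedge_rels m V =
     {\<lambda>p. free_gen (vs[i := v \<oplus>\<^bsub>V\<^esub> w]) p - free_gen (vs[i := v]) p - free_gen (vs[i := w]) p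
        | vs i v w. vs \<in> tuples m (carrier V) \<and> i < m \<and> v \<in> carrier V \<and> w \<in> carrier V} \<union>
     {\<lambda>p. free_gen (vs[i := c \<odot>\<^bsub>V\<^esub> v]) p - c * free_gen (vs[i := v]) p
        | vs i c v. vs \<in> tuples m (carrier V) \<and> i < m \<and> v \<in> carrier V} \<union>
     {free_gen vs | vs i j. vs \<in> tuples m (carrier V) \<and> i < j \<and> j < m \<and> vs ! i = vs ! j}"

definition wedge_vs :: "nat \<Rightarrow> (complex, 'v) module \<Rightarrow> (complex, ('v list \<Rightarrow> complex) set) module" where
  "wedge_vs m V = presented_vs (tuples m (carrier V)) (wedge_rels m V)"

definition wedge_elt :: "nat \<Rightarrow> (complex, 'v) module \<Rightarrow> 'v list \<Rightarrow> ('v list \<Rightarrow> complex) set" where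
  "wedge_elt m V vs = presented_class (tuples m (carrier V)) (wedge_rels m V) vs"


section \<open>Varieties as spaces with functions\<close>

text \<open>
  A space with functions is a topological space together with, for every open \<open>U\<close>, the set
  \<open>reg X U\<close> of regular functions on \<open>U\<close>. A function is total on the type, but membership
  in \<open>reg X U\<close> depends only on its values on \<open>U\<close>.
\<close>

record 'x fspace =
  tsp :: "'x topology"
  reg :: "'x set \<Rightarrow> ('x \<Rightarrow> complex) set"

abbreviation pts :: "'x fspace \<Rightarrow> 'x set" where
  "pts X \<equiv> topspace (tsp X)"

definition sheaf_of_functions :: "'x fspace \<Rightarrow> bool" where
  "sheaf_of_functions X \<longleftrightarrow>
     (\<forall>U. openin (tsp X) U \<longrightarrow>
        (\<forall>c. (\<lambda>_. c) \<in> reg X U) \<and>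
        (\<forall>f\<in>reg X U. \<forall>g\<in>reg X U.
           (\<lambda>x. f x + g x) \<in> reg X U \<and> (\<lambda>x. f x * g x) \<in> reg X U) \<and>
        (\<forall>f. f \<in> reg X U \<longleftrightarrow>
           (\<forall>x\<in>U. \<exists>V. openin (tsp X) V \<and> x \<in> V \<and> V \<subseteq> U \<and> (\<exists>g\<in>reg X V. \<forall>y\<in>V. f y = g y))))"

definition fmorphism :: "'x fspace \<Rightarrow> 'y fspace \<Rightarrow> ('x \<Rightarrow> 'y) \<Rightarrow> bool" where
  "fmorphism X Y \<phi> \<longleftrightarrow>
     continuous_map (tsp X) (tsp Y) \<phi> \<and>
     (\<forall>V f. openin (tsp Y) V \<and> f \<in> reg Y V \<longrightarrow> (\<lambda>x. f (\<phi> x)) \<in> reg X {x \<in> pts X. \<phi> x \<in> V})"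

definition fisomorphism :: "'x fspace \<Rightarrow> 'y fspace \<Rightarrow> ('x \<Rightarrow> 'y) \<Rightarrow> bool" where
  "fisomorphism X Y \<phi> \<longleftrightarrow>
     fmorphism X Y \<phi> \<and>
     (\<exists>\<psi>. fmorphism Y X \<psi> \<and> (\<forall>x\<in>pts X. \<psi> (\<phi> x) = x) \<and> (\<forall>y\<in>pts Y. \<phi> (\<psi> y) = y))"

text \<open>The reduced structure on a closed subset \<open>Z\<close>: regular functions extend locally to the ambient space.\<close>

definition subvariety :: "'y fspace \<Rightarrow> 'y set \<Rightarrow> 'y fspace" where
  "subvariety Y Z = \<lparr>tsp = subtopology (tsp Y) Z,
     reg = (\<lambda>U. {f. \<forall>y\<in>U. \<exists>W. openin (tsp Y) W \<and> y \<in> W \<and> (\<exists>F\<in>reg Y W. \<forall>z\<in>W \<inter> U. f z = F z)})\<rparr>"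

definition closed_embedding :: "'x fspace \<Rightarrow> 'y fspace \<Rightarrow> ('x \<Rightarrow> 'y) \<Rightarrow> bool" where
  "closed_embedding X Y \<phi> \<longleftrightarrow>
     closedin (tsp Y) (\<phi> ` pts X) \<and> fisomorphism X (subvariety Y (\<phi> ` pts X)) \<phi>"

definition irreducible_in :: "'x topology \<Rightarrow> 'x set \<Rightarrow> bool" where
  "irreducible_in T S \<longleftrightarrow>
     S \<noteq> {} \<and> S \<subseteq> topspace T \<and>
     (\<forall>A B. closedin T A \<and> closedin T B \<and> S \<subseteq> A \<union> B \<longrightarrow> S \<subseteq> A \<or> S \<subseteq> B)"

definition dimension :: "'x fspace \<Rightarrow> enat" where
  "dimension X =
     (SUP l \<in> {l. \<exists>Z. (\<forall>i\<le>l. closedin (tsp X) (Z i) \<and> irreducible_in (tsp X) (Z i)) \<and>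
                     (\<forall>i<l. Z i \<subset> Z (Suc i))}. enat l)"


subsection \<open>Projective space\<close>

text \<open>
  Homogeneous coordinates are functions \<open>nat \<Rightarrow> complex\<close> supported on \<open>{0..N}\<close>. The point with
  homogeneous coordinates \<open>v\<close> is the set of nonzero multiples of \<open>v\<close>.
\<close>

definition hline :: "(nat \<Rightarrow> complex) \<Rightarrow> (nat \<Rightarrow> complex) set" where
  "hline v = {\<lambda>i. c * v i | c. c \<noteq> 0}"

definition proj_points :: "nat \<Rightarrow> (nat \<Rightarrow> complex) set set" where
  "proj_points N = {hline v | v. (\<exists>i. v i \<noteq> 0) \<and> (\<forall>i>N. v i = 0)}"

definition hom_poly :: "nat \<Rightarrow> nat \<Rightarrow> ((nat \<Rightarrow> complex) \<Rightarrow> complex) \<Rightarrow> bool" where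
  "hom_poly N d g \<longleftrightarrow>
     (\<exists>A c. finite A \<and> (\<forall>\<alpha>\<in>A. (\<Sum>i\<le>N. \<alpha> i) = d) \<and>
        g = (\<lambda>v. \<Sum>\<alpha>\<in>A. c \<alpha> * (\<Prod>i\<le>N. v i ^ \<alpha> i)))"

definition proj_space :: "nat \<Rightarrow> (nat \<Rightarrow> complex) set fspace" where
  "proj_space N =
     (let T = topology_generated_by {{p \<in> proj_points N. \<forall>v\<in>p. g v \<noteq> 0} | g d. hom_poly N d g}
      in \<lparr>tsp = T,
          reg = (\<lambda>U. {f. \<forall>p\<in>U. \<exists>W. openin T W \<and> p \<in> W \<and> W \<subseteq> U \<and>
                   (\<exists>d g h. hom_poly N d g \<and> hom_poly N d h \<and>
                      (\<forall>q\<in>W. \<forall>v\<in>q. h v \<noteq> 0 \<and> f q = g v / h v))})\<rparr>)"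

definition projective_variety :: "'x fspace \<Rightarrow> bool" where
  "projective_variety X \<longleftrightarrow>
     sheaf_of_functions X \<and> irreducible_in (tsp X) (pts X) \<and>
     (\<exists>M \<phi>. closed_embedding X (proj_space M) \<phi>)"


subsection \<open>Tangent spaces and smoothness\<close>

definition near_reg :: "'x fspace \<Rightarrow> 'x \<Rightarrow> ('x \<Rightarrow> complex) set" where
  "near_reg X x = {f. \<exists>U. openin (tsp X) U \<and> x \<in> U \<and> f \<in> reg X U}"

text \<open>
  A point derivation of the local ring at \<open>x\<close> is represented as a functional on the functions
  regular near \<open>x\<close> which depends only on germs; it takes the value 0 on all other functions.
\<close>

definition point_derivation :: "'x fspace \<Rightarrow> 'x \<Rightarrow> (('x \<Rightarrow> complex) \<Rightarrow> complex) \<Rightarrow> bool" where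
  "point_derivation X x \<delta> \<longleftrightarrow>
     (\<forall>f. f \<notin> near_reg X x \<longrightarrow> \<delta> f = 0) \<and>
     (\<forall>f\<in>near_reg X x. \<forall>g\<in>near_reg X x.
        (\<forall>U. openin (tsp X) U \<and> x \<in> U \<and> (\<forall>y\<in>U. f y = g y) \<longrightarrow> \<delta> f = \<delta> g) \<and>
        \<delta> (\<lambda>y. f y + g y) = \<delta> f + \<delta> g \<and>
        \<delta> (\<lambda>y. f y * g y) = f x * \<delta> g + g x * \<delta> f) \<and>
     (\<forall>c. \<forall>f\<in>near_reg X x. \<delta> (\<lambda>y. c * f y) = c * \<delta> f)"

definition tangent_space :: "'x fspace \<Rightarrow> 'x \<Rightarrow> (complex, ('x \<Rightarrow> complex) \<Rightarrow> complex) module" where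
  "tangent_space X x = fun_vs {\<delta>. point_derivation X x \<delta>}"

definition smooth :: "'x fspace \<Rightarrow> bool" where
  "smooth X \<longleftrightarrow>
     (\<forall>x\<in>pts X. vectorspace.fin_dim CC (tangent_space X x) \<and>
        enat (vectorspace.dim CC (tangent_space X x)) = dimension X)"

definition differential ::
  "'x fspace \<Rightarrow> 'y fspace \<Rightarrow> ('x \<Rightarrow> 'y) \<Rightarrow> 'x
   \<Rightarrow> (('x \<Rightarrow> complex) \<Rightarrow> complex) \<Rightarrow> (('y \<Rightarrow> complex) \<Rightarrow> complex)" where
  "differential X Y \<phi> x \<delta> = (\<lambda>f. if f \<in> near_reg Y (\<phi> x) then \<delta> (\<lambda>z. f (\<phi> z)) else 0)"


section \<open>Vector bundles\<close>

text \<open>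
  A vector bundle on \<open>X\<close> is given by its fibres and, for every open \<open>U\<close>, by the set of its
  regular sections over \<open>U\<close>, which are functions on \<open>U\<close> (undefined elsewhere) with values in the
  fibres. Local triviality is not built into the record type.
\<close>

record ('x, 'v) vbundle =
  fib :: "'x \<Rightarrow> (complex, 'v) module"
  sect :: "'x set \<Rightarrow> ('x \<Rightarrow> 'v) set"

text \<open>
  The sheaf of \<open>O\<^sub>X\<close>-modules generated by the local sections \<open>G W\<close> of a family of vector spaces:
  its sections are locally finite sums of products of regular functions with members of \<open>G W\<close>.
\<close>

definition generated_sections ::
  "'x fspace \<Rightarrow> ('x \<Rightarrow> (complex, 'v) module) \<Rightarrow> ('x set \<Rightarrow> ('x \<Rightarrow> 'v) set) \<Rightarrow> 'x set \<Rightarrow> ('x \<Rightarrow> 'v) set"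
  where
  "generated_sections X V G U =
     {s \<in> (\<Pi>\<^sub>E x\<in>U. carrier (V x)). \<forall>x\<in>U. \<exists>W. openin (tsp X) W \<and> x \<in> W \<and> W \<subseteq> U \<and>
        (\<exists>(r::nat) f g. (\<forall>j<r. f j \<in> reg X W \<and> g j \<in> G W) \<and>
           (\<forall>y\<in>W. s y = (\<Oplus>\<^bsub>V y\<^esub> j\<in>{..<r}. f j y \<odot>\<^bsub>V y\<^esub> g j y)))}"

definition tangent_bundle :: "'x fspace \<Rightarrow> ('x, ('x \<Rightarrow> complex) \<Rightarrow> complex) vbundle" where
  "tangent_bundle X = \<lparr>fib = tangent_space X,
     sect = (\<lambda>U. {s \<in> (\<Pi>\<^sub>E x\<in>U. carrier (tangent_space X x)).
        \<forall>W f. openin (tsp X) W \<and> W \<subseteq> U \<and> f \<in> reg X W \<longrightarrow> (\<lambda>x. s x f) \<in> reg X W})\<rparr>"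

definition pullback_bundle ::
  "'x fspace \<Rightarrow> 'y fspace \<Rightarrow> ('x \<Rightarrow> 'y) \<Rightarrow> ('y, 'v) vbundle \<Rightarrow> ('x, 'v) vbundle" where
  "pullback_bundle X Y \<phi> E = \<lparr>fib = (\<lambda>x. fib E (\<phi> x)),
     sect = generated_sections X (\<lambda>x. fib E (\<phi> x))
       (\<lambda>W. {\<lambda>x. s (\<phi> x) | s V. openin (tsp Y) V \<and> \<phi> ` W \<subseteq> V \<and> s \<in> sect E V})\<rparr>"

definition quotient_bundle ::
  "'x fspace \<Rightarrow> ('x, 'v) vbundle \<Rightarrow> ('x \<Rightarrow> 'v set) \<Rightarrow> ('x, 'v set) vbundle" where
  "quotient_bundle X E F = \<lparr>fib = (\<lambda>x. quot_vs (fib E x) (F x)),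
     sect = generated_sections X (\<lambda>x. quot_vs (fib E x) (F x))
       (\<lambda>W. {\<lambda>x. F x +>\<^bsub>fib E x\<^esub> s x | s. s \<in> sect E W})\<rparr>"

definition tensor_bundle ::
  "'x fspace \<Rightarrow> ('x, 'v) vbundle \<Rightarrow> ('x, 'w) vbundle \<Rightarrow> ('x, ('v \<times> 'w \<Rightarrow> complex) set) vbundle" where
  "tensor_bundle X E F = \<lparr>fib = (\<lambda>x. tensor_vs (fib E x) (fib F x)),
     sect = generated_sections X (\<lambda>x. tensor_vs (fib E x) (fib F x))
       (\<lambda>W. {\<lambda>x. tensor_elt (fib E x) (fib F x) (s x) (t x) | s t. s \<in> sect E W \<and> t \<in> sect F W})\<rparr>"

definition wedge_bundle ::
  "'x fspace \<Rightarrow> nat \<Rightarrow> ('x, 'v) vbundle \<Rightarrow> ('x, ('v list \<Rightarrow> complex) set) vbundle" where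
  "wedge_bundle X m E = \<lparr>fib = (\<lambda>x. wedge_vs m (fib E x)),
     sect = generated_sections X (\<lambda>x. wedge_vs m (fib E x))
       (\<lambda>W. {\<lambda>x. wedge_elt m (fib E x) (map (\<lambda>s. s x) ss) | ss. ss \<in> tuples m (sect E W)})\<rparr>"

definition bundle_rank :: "'x fspace \<Rightarrow> ('x, 'v) vbundle \<Rightarrow> nat" where
  "bundle_rank X E =
     (THE r. \<forall>x\<in>pts X. vectorspace.fin_dim CC (fib E x) \<and> vectorspace.dim CC (fib E x) = r)"

definition restricted_tangent_bundle ::
  "'x fspace \<Rightarrow> 'y fspace \<Rightarrow> ('x \<Rightarrow> 'y) \<Rightarrow> ('x, ('y \<Rightarrow> complex) \<Rightarrow> complex) vbundle" where
  "restricted_tangent_bundle X Y \<phi> = pullback_bundle X Y \<phi> (tangent_bundle Y)"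

text \<open>The normal bundle is the cokernel of the differential from \<open>T\<^sub>X\<close> to the pullback of \<open>T\<^sub>Y\<close>.\<close>

definition normal_bundle ::
  "'x fspace \<Rightarrow> 'y fspace \<Rightarrow> ('x \<Rightarrow> 'y) \<Rightarrow> ('x, (('y \<Rightarrow> complex) \<Rightarrow> complex) set) vbundle" where
  "normal_bundle X Y \<phi> =
     quotient_bundle X (restricted_tangent_bundle X Y \<phi>)
       (\<lambda>x. differential X Y \<phi> x ` carrier (tangent_space X x))"

definition section_space ::
  "('x, 'v) vbundle \<Rightarrow> 'x set \<Rightarrow> (complex, 'x \<Rightarrow> 'v) module" where
  "section_space E U = \<lparr>carrier = sect E U,
     mult = (\<lambda>_ _. \<lambda>x\<in>U. \<zero>\<^bsub>fib E x\<^esub>), one = (\<lambda>x\<in>U. \<zero>\<^bsub>fib E x\<^esub>), zero = (\<lambda>x\<in>U. \<zero>\<^bsub>fib E x\<^esub>),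
     add = (\<lambda>s t. \<lambda>x\<in>U. s x \<oplus>\<^bsub>fib E x\<^esub> t x), smult = (\<lambda>c s. \<lambda>x\<in>U. c \<odot>\<^bsub>fib E x\<^esub> s x)\<rparr>"


section \<open>Divisors and their line bundles\<close>

text \<open>
  Divisors are Cartier divisors (on a smooth variety these are the same as Weil divisors), given
  by a set of local equations. Here the record \<open>e\<close> stands for the nonzero rational function
  \<open>eq_num e / eq_den e\<close> on the open set \<open>eq_dom e\<close>, and \<open>transition X e e' g\<close> says that the
  quotient of the equation \<open>e\<close> by the equation \<open>e'\<close> is the nowhere vanishing regular function
  \<open>g\<close> on the intersection of their domains.
\<close>

record 'x local_eq =
  eq_dom :: "'x set"
  eq_num :: "'x \<Rightarrow> complex"
  eq_den :: "'x \<Rightarrow> complex"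

definition transition :: "'x fspace \<Rightarrow> 'x local_eq \<Rightarrow> 'x local_eq \<Rightarrow> ('x \<Rightarrow> complex) \<Rightarrow> bool" where
  "transition X e e' g \<longleftrightarrow>
     g \<in> reg X (eq_dom e \<inter> eq_dom e') \<and>
     (\<forall>x\<in>eq_dom e \<inter> eq_dom e'.
        g x \<noteq> 0 \<and> eq_num e x * eq_den e' x = g x * (eq_den e x * eq_num e' x))"

definition cartier_divisor :: "'x fspace \<Rightarrow> 'x local_eq set \<Rightarrow> bool" where
  "cartier_divisor X D \<longleftrightarrow>
     (\<forall>e\<in>D. openin (tsp X) (eq_dom e) \<and>
        eq_num e \<in> reg X (eq_dom e) \<and> eq_den e \<in> reg X (eq_dom e) \<and>
        (\<exists>x\<in>eq_dom e. eq_num e x \<noteq> 0) \<and> (\<exists>x\<in>eq_dom e. eq_den e x \<noteq> 0)) \<and>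
     (\<Union>e\<in>D. eq_dom e) = pts X \<and>
     (\<forall>e\<in>D. \<forall>e'\<in>D. \<exists>g. transition X e e' g)"

definition divisor_multiple :: "int \<Rightarrow> 'x local_eq set \<Rightarrow> 'x local_eq set" where
  "divisor_multiple t D =
     (\<lambda>e. if t \<ge> 0
        then \<lparr>eq_dom = eq_dom e, eq_num = (\<lambda>x. eq_num e x ^ nat t), eq_den = (\<lambda>x. eq_den e x ^ nat t)\<rparr>
        else \<lparr>eq_dom = eq_dom e, eq_num = (\<lambda>x. eq_den e x ^ nat (- t)), eq_den = (\<lambda>x. eq_num e x ^ nat (- t))\<rparr>) ` D"

text \<open>
  The line bundle of \<open>D\<close>. A rational section \<open>s\<close> of the subsheaf of the function field whose local
  generators are the inverses of the local equations corresponds to the family of regular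
  functions \<open>s \<cdot> eq_num e / eq_den e\<close> on \<open>eq_dom e\<close>, indexed by \<open>e\<close>; the family has the value 0
  where its index is not in \<open>D\<close> or not defined at the point.
\<close>

definition divisor_bundle :: "'x fspace \<Rightarrow> 'x local_eq set \<Rightarrow> ('x, 'x local_eq \<Rightarrow> complex) vbundle" where
  "divisor_bundle X D =
     (let V = (\<lambda>x. fun_vs {\<xi>. (\<forall>e. \<xi> e \<noteq> 0 \<longrightarrow> e \<in> D \<and> x \<in> eq_dom e) \<and>
            (\<forall>e\<in>D. \<forall>e'\<in>D. \<forall>g. x \<in> eq_dom e \<inter> eq_dom e' \<and> transition X e e' g \<longrightarrow> \<xi> e = g x * \<xi> e')})
      in \<lparr>fib = V,
          sect = (\<lambda>U. {s \<in> (\<Pi>\<^sub>E x\<in>U. carrier (V x)). \<forall>e\<in>D. (\<lambda>x. s x e) \<in> reg X (U \<inter> eq_dom e)})\<rparr>)"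

definition twist ::
  "'x fspace \<Rightarrow> 'x local_eq set \<Rightarrow> ('x, 'v) vbundle \<Rightarrow> int
   \<Rightarrow> ('x, ('v \<times> ('x local_eq \<Rightarrow> complex) \<Rightarrow> complex) set) vbundle" where
  "twist X H E t = tensor_bundle X E (divisor_bundle X (divisor_multiple t H))"

text \<open>
  \<open>\<iota>\<close> is the embedding into projective space given by a basis \<open>s\<^sub>0, \<dots>, s\<^sub>N\<close> of the global sections
  of the line bundle of \<open>H\<close>. The homogeneous coordinates of \<open>\<iota> x\<close> are read off in any one of the
  trivialisations at \<open>x\<close>.
\<close>

definition embedding_defined_by ::
  "'x fspace \<Rightarrow> 'x local_eq set \<Rightarrow> nat \<Rightarrow> ('x \<Rightarrow> (nat \<Rightarrow> complex) set) \<Rightarrow> bool" where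
  "embedding_defined_by X H N \<iota> \<longleftrightarrow>
     (\<exists>s. inj_on s {..N} \<and>
        vectorspace.basis CC (section_space (divisor_bundle X H) (pts X)) (s ` {..N}) \<and>
        (\<forall>x\<in>pts X. \<forall>e\<in>H. x \<in> eq_dom e \<longrightarrow>
           (\<exists>j\<le>N. s j x e \<noteq> 0) \<and> \<iota> x = hline (\<lambda>j. if j \<le> N then s j x e else 0))) \<and>
     closed_embedding X (proj_space N) \<iota>"

definition very_ample :: "'x fspace \<Rightarrow> 'x local_eq set \<Rightarrow> bool" where
  "very_ample X H \<longleftrightarrow> cartier_divisor X H \<and> (\<exists>N \<iota>. embedding_defined_by X H N \<iota>)"


section \<open>Sheaf cohomology\<close>

text \<open>
  Cohomology of the sheaf of sections of a bundle is the direct limit, over all open covers of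
  \<open>X\<close> ordered by refinement, of Cech cohomology (Serre's definition). Covers are sets of open
  sets indexed by themselves, and cochains are not required to be alternating.
\<close>

definition open_cover :: "'x fspace \<Rightarrow> 'x set set \<Rightarrow> bool" where
  "open_cover X \<U> \<longleftrightarrow> (\<forall>U\<in>\<U>. openin (tsp X) U) \<and> \<Union>\<U> = pts X"

definition cochains :: "('x, 'v) vbundle \<Rightarrow> 'x set set \<Rightarrow> nat \<Rightarrow> ('x set list \<Rightarrow> 'x \<Rightarrow> 'v) set" where
  "cochains E \<U> q = (\<Pi>\<^sub>E \<sigma>\<in>tuples (Suc q) \<U>. sect E (\<Inter>(set \<sigma>)))"

definition coboundary ::
  "('x, 'v) vbundle \<Rightarrow> 'x set set \<Rightarrow> nat \<Rightarrow> ('x set list \<Rightarrow> 'x \<Rightarrow> 'v) \<Rightarrow> ('x set list \<Rightarrow> 'x \<Rightarrow> 'v)" where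
  "coboundary E \<U> q c =
     (\<lambda>\<sigma>\<in>tuples (Suc (Suc q)) \<U>. \<lambda>x\<in>\<Inter>(set \<sigma>).
        \<Oplus>\<^bsub>fib E x\<^esub> j\<in>{..Suc q}. (- 1) ^ j \<odot>\<^bsub>fib E x\<^esub> c (take j \<sigma> @ drop (Suc j) \<sigma>) x)"

definition zero_cochain :: "('x, 'v) vbundle \<Rightarrow> 'x set set \<Rightarrow> nat \<Rightarrow> ('x set list \<Rightarrow> 'x \<Rightarrow> 'v)" where
  "zero_cochain E \<U> q = (\<lambda>\<sigma>\<in>tuples (Suc q) \<U>. \<lambda>x\<in>\<Inter>(set \<sigma>). \<zero>\<^bsub>fib E x\<^esub>)"

definition cocycles :: "('x, 'v) vbundle \<Rightarrow> 'x set set \<Rightarrow> nat \<Rightarrow> ('x set list \<Rightarrow> 'x \<Rightarrow> 'v) set" where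
  "cocycles E \<U> q = {c \<in> cochains E \<U> q. coboundary E \<U> q c = zero_cochain E \<U> (Suc q)}"

definition coboundaries :: "('x, 'v) vbundle \<Rightarrow> 'x set set \<Rightarrow> nat \<Rightarrow> ('x set list \<Rightarrow> 'x \<Rightarrow> 'v) set" where
  "coboundaries E \<U> q =
     (case q of 0 \<Rightarrow> {zero_cochain E \<U> 0} | Suc p \<Rightarrow> coboundary E \<U> p ` cochains E \<U> p)"

definition refinement :: "'x set set \<Rightarrow> 'x set set \<Rightarrow> ('x set \<Rightarrow> 'x set) \<Rightarrow> bool" where
  "refinement \<W> \<U> \<tau> \<longleftrightarrow> (\<forall>W\<in>\<W>. \<tau> W \<in> \<U> \<and> W \<subseteq> \<tau> W)"

definition cohomologous ::
  "'x fspace \<Rightarrow> ('x, 'v) vbundle \<Rightarrow> nat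
   \<Rightarrow> ('x set set \<times> ('x set list \<Rightarrow> 'x \<Rightarrow> 'v)) rel" where
  "cohomologous X E q =
     {((\<U>, c), (\<V>, d)) | \<U> c \<V> d.
        open_cover X \<U> \<and> c \<in> cocycles E \<U> q \<and> open_cover X \<V> \<and> d \<in> cocycles E \<V> q \<and>
        (\<exists>\<W> \<tau> \<rho>. open_cover X \<W> \<and> refinement \<W> \<U> \<tau> \<and> refinement \<W> \<V> \<rho> \<and>
           (\<lambda>\<sigma>\<in>tuples (Suc q) \<W>. \<lambda>x\<in>\<Inter>(set \<sigma>).
              c (map \<tau> \<sigma>) x \<ominus>\<^bsub>fib E x\<^esub> d (map \<rho> \<sigma>) x) \<in> coboundaries E \<W> q)}"

definition cohomology ::
  "'x fspace \<Rightarrow> ('x, 'v) vbundle \<Rightarrow> nat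
   \<Rightarrow> ('x set set \<times> ('x set list \<Rightarrow> 'x \<Rightarrow> 'v)) set set" where
  "cohomology X E q = {(\<U>, c). open_cover X \<U> \<and> c \<in> cocycles E \<U> q} // cohomologous X E q"

definition cohomology_vanishes :: "'x fspace \<Rightarrow> ('x, 'v) vbundle \<Rightarrow> nat \<Rightarrow> bool" where
  "cohomology_vanishes X E q \<longleftrightarrow> is_singleton (cohomology X E q)"

text \<open>
  The Ulrich condition is meant for vector bundles \<open>E\<close>, smooth projective \<open>X\<close> and very ample \<open>H\<close>;
  these standing assumptions are not repeated in the definition, so that its negation asserts
  that some cohomology group does not vanish.
\<close>

definition ulrich :: "'x fspace \<Rightarrow> 'x local_eq set \<Rightarrow> ('x, 'v) vbundle \<Rightarrow> bool" where
  "ulrich X H E \<longleftrightarrow>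
     (\<forall>i q. 1 \<le> i \<and> enat i \<le> dimension X \<longrightarrow> cohomology_vanishes X (twist X H E (- int i)) q)"

end

theory Submission
  imports Defs
begin

text \<open>
  By the Euler sequence \<open>T(-1)\<close> is globally generated by the vector fields \<open>\<partial>\<^sub>j\<close>, which are homogeneous
  of degree \<open>-1\<close> in the homogeneous coordinates; hence so is its quotient \<open>N\<^sub>X(-1)\<close>. If \<open>m\<close> of these
  fields are independent in a fibre of \<open>B\<close>, their exterior product is a nonzero global section of
  \<open>\<And>\<^sup>m B(-mH)\<close>. Since \<open>\<And>\<^sup>m B(kH)(-iH) = \<And>\<^sup>m B(-mH)\<close> for \<open>i = k + m\<close>, which lies between \<open>1\<close> and \<open>n\<close>,
  the group \<open>H\<^sup>0\<close> required to vanish in the Ulrich condition for this \<open>i\<close> is nonzero. Where the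
  coordinate \<open>s\<^sub>l\<close> does not vanish, the section is \<open>\<partial>\<^sub>j\<^sub>1 \<and> \<dots> \<and> \<partial>\<^sub>j\<^sub>m \<otimes> s\<^sub>l\<^sup>k \<otimes> s\<^sub>l\<^sup>-\<^sup>k\<^sup>-\<^sup>m\<close>, with the fields
  evaluated at the representative whose \<open>l\<close>-th coordinate is \<open>1\<close>; it does not depend on \<open>l\<close>.
\<close>

section \<open>Linear algebra\<close>

text \<open>Vectors in exterior powers, tensor products and quotients are cosets, so an element is
  shown to be nonzero by a linear form: a determinant on exterior powers, a product of forms on
  tensor products. The double twist stays a nested tensor product, and no isomorphism with a single
  twist is constructed; instead the scalars acquired under a change of chart, with exponents m, k
  and -(k + m), multiply to 1. The Euler sequence itself is not formalised either. The coordinate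
  fields are derivatives along coordinate lines of the cone, computed by one-variable complex
  differentiation of homogeneous fractions, and the span of their values is found by dualising
  against affine coordinates. Two features of the definitions shape the rest. The functions on X are
  only postulated to form a sheaf closed under sums and products, so restrictions, inverses and
  openness of nonvanishing loci have to be drawn from the embedding. And local equations constrain a
  transition function only away from their zeros, so irreducibility must determine the transitions
  of multiples of H. Smoothness supplies the constant rank of the normal bundle.\<close>

abbreviation linear_span :: "(complex, 'v) module \<Rightarrow> 'v set \<Rightarrow> 'v set" where
  "linear_span \<equiv> LinearCombinations.module.span CC"

lemma vectorspace_module: "vectorspace CC V \<Longrightarrow> module CC V"
  by (simp add: vectorspace_def)

lemma fun_vs_vectorspace:
  assumes "(\<lambda>_. 0) \<in> S"
    and add: "\<And>f g. f \<in> S \<Longrightarrow> g \<in> S \<Longrightarrow> (\<lambda>y. f y + g y) \<in> S"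
    and smult: "\<And>c f. f \<in> S \<Longrightarrow> (\<lambda>y. c * f y) \<in> S"
  shows "vectorspace CC (fun_vs S)"
proof (rule vs_criteria, goal_cases)
  case 4
  show ?case
  proof
    fix v assume "v \<in> carrier (fun_vs S)"
    then show "\<exists>neg_v\<in>carrier (fun_vs S). v \<oplus>\<^bsub>fun_vs S\<^esub> neg_v = \<zero>\<^bsub>fun_vs S\<^esub>"
      using smult[of v "-1"] by (intro bexI[of _ "\<lambda>y. - 1 * v y"]) (auto simp: fun_vs_def)
  qed
qed (use assms class_field in \<open>auto simp: fun_vs_def algebra_simps\<close>)

lemma fun_vs_simps:
  "carrier (fun_vs S) = S" "\<zero>\<^bsub>fun_vs S\<^esub> = (\<lambda>_. 0)"
  "f \<oplus>\<^bsub>fun_vs S\<^esub> g = (\<lambda>y. f y + g y)" "c \<odot>\<^bsub>fun_vs S\<^esub> f = (\<lambda>y. c * f y)"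
  by (simp_all add: fun_vs_def)

lemma fun_vs_finsum:
  assumes vs: "vectorspace CC (fun_vs S)" and "finite A" and "F \<in> A \<rightarrow> S"
  shows "finsum (fun_vs S) F A = (\<lambda>y. \<Sum>a\<in>A. F a y)"
proof -
  interpret vectorspace CC "fun_vs S" by fact
  from assms(2,3) show ?thesis
  proof (induction A)
    case empty
    then show ?case by (simp add: fun_vs_simps)
  next
    case (insert a A)
    then have "finsum (fun_vs S) F (insert a A) = F a \<oplus>\<^bsub>fun_vs S\<^esub> finsum (fun_vs S) F A"
      by (intro finsum_insert) (auto simp: fun_vs_simps)
    with insert show ?case by (simp add: fun_vs_simps Pi_iff)
  qed
qed

text \<open>Linear forms are constrained on the carrier alone. Cosets are hard to compare directly,
  so a form with nonzero value is the certificate that an element of a quotient is nonzero.\<close>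

definition functional :: "(complex, 'v) module \<Rightarrow> ('v \<Rightarrow> complex) \<Rightarrow> bool" where
  "functional V L \<longleftrightarrow>
     (\<forall>v\<in>carrier V. \<forall>w\<in>carrier V. L (v \<oplus>\<^bsub>V\<^esub> w) = L v + L w) \<and>
     (\<forall>c. \<forall>v\<in>carrier V. L (c \<odot>\<^bsub>V\<^esub> v) = c * L v)"

lemma functional_zero:
  assumes "vectorspace CC V" "functional V L" shows "L \<zero>\<^bsub>V\<^esub> = 0"
proof -
  interpret vectorspace CC V by fact
  have "L (\<zero>\<^bsub>V\<^esub> \<oplus>\<^bsub>V\<^esub> \<zero>\<^bsub>V\<^esub>) = L \<zero>\<^bsub>V\<^esub> + L \<zero>\<^bsub>V\<^esub>"
    using assms(2) M.zero_closed unfolding functional_def by blast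
  then show ?thesis by simp
qed

lemma mod_homI:
  assumes "vectorspace CC V" "vectorspace CC W"
    and "\<And>v. v \<in> carrier V \<Longrightarrow> T v \<in> carrier W"
    and "\<And>v w. v \<in> carrier V \<Longrightarrow> w \<in> carrier V \<Longrightarrow> T (v \<oplus>\<^bsub>V\<^esub> w) = T v \<oplus>\<^bsub>W\<^esub> T w"
    and "\<And>c v. v \<in> carrier V \<Longrightarrow> T (c \<odot>\<^bsub>V\<^esub> v) = c \<odot>\<^bsub>W\<^esub> T v"
  shows "linear_map CC V W T"
  using assms
  by (auto simp: linear_map_def mod_hom_def mod_hom_axioms_def module_hom_def vectorspace_module)

text \<open>The vectors mapped into the span of the images form a submodule containing
  \<open>S\<close>, hence exhaust \<open>V\<close>. This transports generators of a tangent space to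
  the normal space.\<close>

lemma linear_map_span_image:
  assumes T: "linear_map CC V W T" and S: "S \<subseteq> carrier V"
    and span: "linear_span V S = carrier V" and surj: "T ` carrier V = carrier W"
  shows "linear_span W (T ` S) = carrier W"
proof -
  interpret T: linear_map CC V W T by (rule T)
  have sub: "T ` S \<subseteq> carrier W" using S surj by auto
  interpret sp: submodule CC "T.W.module.span (T ` S)" W by (rule T.W.module.span_is_submodule[OF sub])
  let ?N = "{v \<in> carrier V. T v \<in> T.W.module.span (T ` S)}"
  have "submodule CC ?N V"
  proof (rule submodule.intro)
    show "module CC V" by (rule T.V.module.module_axioms)
    fix v w c assume "v \<in> ?N" "w \<in> ?N"
    then show "v \<oplus>\<^bsub>V\<^esub> w \<in> ?N" "c \<odot>\<^bsub>V\<^esub> v \<in> ?N"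
      using sp.m_closed[of "T v" "T w"] sp.smult_closed[of c "T v"] by auto
  qed auto
  moreover have "S \<subseteq> ?N" using S T.W.module.in_own_span[OF sub] by auto
  ultimately have "T.V.module.span S \<subseteq> ?N" by (intro T.V.module.span_is_subset)
  then have "carrier W \<subseteq> T.W.module.span (T ` S)"
    unfolding span surj[symmetric] by blast
  then show ?thesis using sp.subset by blast
qed

subsection \<open>Quotients\<close>

text \<open>All axioms are pushed forward along a surjection respecting the operations, with no
  prior structure on the target. A bare record of cosets such as \<open>quot_vs\<close> offers no
  more than that.\<close>

lemma vectorspace_image:
  fixes V :: "(complex, 'v) module" and Q :: "(complex, 'w) module"
  assumes V: "vectorspace CC V" and carr: "h ` carrier V = carrier Q"
    and add: "\<And>v w. v \<in> carrier V \<Longrightarrow> w \<in> carrier V \<Longrightarrow> h v \<oplus>\<^bsub>Q\<^esub> h w = h (v \<oplus>\<^bsub>V\<^esub> w)"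
    and smult: "\<And>c v. v \<in> carrier V \<Longrightarrow> c \<odot>\<^bsub>Q\<^esub> h v = h (c \<odot>\<^bsub>V\<^esub> v)"
    and zero: "h \<zero>\<^bsub>V\<^esub> = \<zero>\<^bsub>Q\<^esub>"
  shows "vectorspace CC Q"
proof -
  interpret vectorspace CC V by fact
  have rep: "\<exists>v\<in>carrier V. q = h v" if "q \<in> carrier Q" for q
    using that carr by auto
  have mem: "h v \<in> carrier Q" if "v \<in> carrier V" for v
    using that carr by auto
  show ?thesis
  proof (rule vs_criteria, goal_cases)
    case 1 show ?case by (rule class_field)
  next
    case 2 show ?case by (metis mem zero M.zero_closed)
  next
    case 3 show ?case by (metis add mem rep M.add.m_closed)
  next
    case 4 show ?case
    proof
      fix q assume "q \<in> carrier Q"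
      then obtain v where "v \<in> carrier V" "q = h v" using rep by auto
      then show "\<exists>b\<in>carrier Q. q \<oplus>\<^bsub>Q\<^esub> b = \<zero>\<^bsub>Q\<^esub>"
        by (intro bexI[of _ "h (\<ominus>\<^bsub>V\<^esub> v)"]) (auto simp: add M.r_neg zero mem)
    qed
  next
    case 5 show ?case by (metis smult mem rep smult_closed)
  next
    case 6 show ?case by (metis add rep M.add.m_comm)
  next
    case 7
    show ?case
    proof (intro allI impI, elim conjE)
      fix a b c assume "a \<in> carrier Q" "b \<in> carrier Q" "c \<in> carrier Q"
      then obtain u v w where "u \<in> carrier V" "v \<in> carrier V" "w \<in> carrier V" "a = h u" "b = h v" "c = h w"
        using rep by metis
      then show "a \<oplus>\<^bsub>Q\<^esub> b \<oplus>\<^bsub>Q\<^esub> c = a \<oplus>\<^bsub>Q\<^esub> (b \<oplus>\<^bsub>Q\<^esub> c)"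
        by (simp add: add M.add.m_assoc)
    qed
  next
    case 8 show ?case by (metis add rep zero M.r_zero M.zero_closed)
  next
    case 9 show ?case
      by (auto dest!: rep simp: smult smult_assoc1[simplified class_ring_simps])
  next
    case 10 show ?case by (auto dest!: rep simp: smult smult_one[simplified class_ring_simps])
  next
    case 11 show ?case
      by (auto dest!: rep simp: smult add smult_l_distr[simplified class_ring_simps])
  next
    case 12 show ?case
      by (auto dest!: rep simp: smult add smult_r_distr[simplified class_ring_simps])
  qed
qed

lemma quot_vs_hom:
  assumes V: "vectorspace CC V" and W: "submodule CC W V"
  shows "vectorspace CC (quot_vs V W)"
    and "linear_map CC V (quot_vs V W) (\<lambda>v. W +>\<^bsub>V\<^esub> v)"
    and "(\<lambda>v. W +>\<^bsub>V\<^esub> v) ` carrier V = carrier (quot_vs V W)"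
    and "\<And>v. v \<in> carrier V \<Longrightarrow> W +>\<^bsub>V\<^esub> v = \<zero>\<^bsub>quot_vs V W\<^esub> \<longleftrightarrow> v \<in> W"
proof -
  interpret vectorspace CC V by fact
  interpret W: submodule CC W V by fact
  have neg: "\<ominus>\<^bsub>V\<^esub> a \<in> W" if "a \<in> W" for a
  proof -
    have "\<ominus>\<^bsub>V\<^esub> a = (- 1) \<odot>\<^bsub>V\<^esub> a"
      using smult_minus_1[OF subsetD[OF W.subset that]] by (simp only: class_ring_simps)
    also have "\<dots> \<in> W" using that by (intro W.smult_closed) simp_all
    finally show ?thesis .
  qed
  have "subgroup W (add_monoid V)"
  proof (rule M.add.subgroupI)
    show "W \<subseteq> carrier V" "W \<noteq> {}" using W.subset W.zero_closed by blast+
  qed (use neg W.m_closed in simp_all)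
  then interpret sg: abelian_subgroup W V
    by (intro abelian_subgroupI3 additive_subgroupI M.abelian_group_axioms)
  let ?Q = "quot_vs V W" and ?h = "\<lambda>v. W +>\<^bsub>V\<^esub> v"
  have carr: "carrier ?Q = ?h ` carrier V"
    by (auto simp: quot_vs_def A_RCOSETS_def')
  have add: "?h (v \<oplus>\<^bsub>V\<^esub> w) = ?h v \<oplus>\<^bsub>?Q\<^esub> ?h w" if "v \<in> carrier V" "w \<in> carrier V" for v w
    using sg.a_rcos_sum[OF that] by (simp add: quot_vs_def)
  have smult: "?h (c \<odot>\<^bsub>V\<^esub> v) = c \<odot>\<^bsub>?Q\<^esub> ?h v" if v: "v \<in> carrier V" for c v
  proof -
    \<comment> \<open>The scalar action of \<open>quot_vs\<close> unites the cosets obtained from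
      all representatives; these coincide, so the union is a single coset.\<close>
    have "?h (c \<odot>\<^bsub>V\<^esub> u) = ?h (c \<odot>\<^bsub>V\<^esub> v)" if u: "u \<in> ?h v" for u
    proof -
      from u obtain w where w: "w \<in> W" "u = w \<oplus>\<^bsub>V\<^esub> v"
        unfolding a_r_coset_def' by blast
      have "c \<odot>\<^bsub>V\<^esub> u = c \<odot>\<^bsub>V\<^esub> w \<oplus>\<^bsub>V\<^esub> c \<odot>\<^bsub>V\<^esub> v"
        unfolding w(2) by (rule smult_r_distr) (use w(1) v W.subset in auto)
      moreover have "c \<odot>\<^bsub>V\<^esub> w \<in> W" using w(1) by (intro W.smult_closed) simp_all
      ultimately have "c \<odot>\<^bsub>V\<^esub> u \<in> ?h (c \<odot>\<^bsub>V\<^esub> v)"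
        unfolding a_r_coset_def' by blast
      from sg.a_repr_independence'[OF this] show ?thesis
        using v by simp
    qed
    moreover have "v \<in> ?h v" using sg.a_rcos_self[OF v] .
    ultimately have "(\<Union>u\<in>?h v. ?h (c \<odot>\<^bsub>V\<^esub> u)) = ?h (c \<odot>\<^bsub>V\<^esub> v)" by blast
    then show ?thesis by (simp add: quot_vs_def)
  qed
  have zero: "\<zero>\<^bsub>?Q\<^esub> = ?h \<zero>\<^bsub>V\<^esub>"
    using W.subset by (simp add: quot_vs_def)
  have "vectorspace CC ?Q"
    by (rule vectorspace_image[OF V carr[symmetric] add[symmetric] smult[symmetric] zero[symmetric]])
  then show vs: "vectorspace CC ?Q" .
  show "linear_map CC V ?Q ?h"
    using V vs by (intro mod_homI) (auto simp: carr add smult)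
  show "?h ` carrier V = carrier ?Q" by (simp add: carr)
  fix v assume v: "v \<in> carrier V"
  show "?h v = \<zero>\<^bsub>?Q\<^esub> \<longleftrightarrow> v \<in> W"
    using v sg.a_rcos_self[OF v] sg.a_rcos_const[of v] by (auto simp: quot_vs_def)
qed

text \<open>Rank-nullity for the projection, which is onto and has kernel \<open>W\<close>.\<close>

lemma quot_vs_dim:
  assumes V: "vectorspace CC V" and W: "submodule CC W V" and fd: "vectorspace.fin_dim CC V"
  shows "vectorspace.fin_dim CC (quot_vs V W)"
    and "vectorspace.dim CC (quot_vs V W) + vectorspace.dim CC (V\<lparr>carrier := W\<rparr>) = vectorspace.dim CC V"
proof -
  interpret linear_map CC V "quot_vs V W" "\<lambda>v. W +>\<^bsub>V\<^esub> v" by (rule quot_vs_hom[OF V W])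
  have im: "imT = carrier (quot_vs V W)"
    using quot_vs_hom(3)[OF V W] by (simp add: im_def)
  have ker: "kerT = W"
    using quot_vs_hom(4)[OF V W] submodule.subset[OF W] by (auto simp: ker_def)
  show "W.fin_dim" using surj_fin_dim[OF fd quot_vs_hom(3)[OF V W]] .
  show "W.dim + vectorspace.dim CC (V.vs W) = V.dim"
    using rank_nullity[OF fd] by (simp add: im ker)
qed

lemma linear_map_image_dim:
  assumes T: "linear_map CC V W T" and fd: "vectorspace.fin_dim CC V"
    and inj: "\<And>v. v \<in> carrier V \<Longrightarrow> T v = \<zero>\<^bsub>W\<^esub> \<Longrightarrow> v = \<zero>\<^bsub>V\<^esub>"
  shows "vectorspace.dim CC (W\<lparr>carrier := T ` carrier V\<rparr>) = vectorspace.dim CC V"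
proof -
  interpret linear_map CC V W T by (rule T)
  have "kerT = {\<zero>\<^bsub>V\<^esub>}" using inj by (auto simp: ker_def)
  then have "inj_on T (carrier V)" by (intro Ke0_imp_inj) simp
  then show ?thesis
    using rank_nullity[OF fd] inj_imp_dim_ker0 by (simp add: im_def)
qed

lemma quot_functional:
  assumes V: "vectorspace CC V" and W: "submodule CC W V" and L: "functional V L"
    and zero: "\<And>w. w \<in> W \<Longrightarrow> L w = 0"
  shows "\<exists>L'. functional (quot_vs V W) L' \<and> (\<forall>v\<in>carrier V. L' (W +>\<^bsub>V\<^esub> v) = L v)"
proof -
  interpret h: linear_map CC V "quot_vs V W" "\<lambda>v. W +>\<^bsub>V\<^esub> v" by (rule quot_vs_hom[OF V W])
  let ?h = "\<lambda>v. W +>\<^bsub>V\<^esub> v"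
  define L' where "L' A = L (SOME v. v \<in> carrier V \<and> ?h v = A)" for A
  have eq: "L' (?h v) = L v" if v: "v \<in> carrier V" for v
  proof -
    define u where "u = (SOME u. u \<in> carrier V \<and> ?h u = ?h v)"
    have u: "u \<in> carrier V" "?h u = ?h v"
      using someI[of "\<lambda>u. u \<in> carrier V \<and> ?h u = ?h v" v] v unfolding u_def by blast+
    \<comment> \<open>Two vectors with the same coset differ by a member of \<open>W\<close>, where
      \<open>L\<close> vanishes, so the chosen representative does not affect the value of
      \<open>L'\<close>.\<close>
    let ?d = "u \<oplus>\<^bsub>V\<^esub> (- 1) \<odot>\<^bsub>V\<^esub> v"
    have mv: "(- 1) \<odot>\<^bsub>V\<^esub> v \<in> carrier V" using v by (intro h.V.module.smult_closed) simp_all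
    have "?h ?d = ?h (v \<oplus>\<^bsub>V\<^esub> (- 1) \<odot>\<^bsub>V\<^esub> v)"
      using h.f_add[OF u(1) mv] h.f_add[OF v mv] u(2) by (simp only:)
    also have "v \<oplus>\<^bsub>V\<^esub> (- 1) \<odot>\<^bsub>V\<^esub> v = \<zero>\<^bsub>V\<^esub>"
      using h.V.module.smult_minus_1[OF v] h.V.module.M.r_neg[OF v] by (simp only: class_ring_simps)
    finally have "?h ?d = \<zero>\<^bsub>quot_vs V W\<^esub>" by (simp only: h.f0_is_0)
    then have "?d \<in> W"
      using quot_vs_hom(4)[OF V W, of ?d] u(1) mv by (simp only: h.V.module.M.add.m_closed)
    then have "L ?d = 0" by (rule zero)
    moreover have "L ?d = L u + (- 1) * L v"
      using L u(1) v mv unfolding functional_def by metis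
    ultimately have "L u = L v" by simp
    then show ?thesis by (simp add: L'_def u_def)
  qed
  have surj: "\<exists>v\<in>carrier V. A = ?h v" if "A \<in> carrier (quot_vs V W)" for A
    using that quot_vs_hom(3)[OF V W] by blast
  have "functional (quot_vs V W) L'"
    unfolding functional_def
  proof (intro conjI ballI allI)
    fix A B assume "A \<in> carrier (quot_vs V W)" "B \<in> carrier (quot_vs V W)"
    then obtain v w where vw: "v \<in> carrier V" "A = ?h v" "w \<in> carrier V" "B = ?h w"
      using surj by blast
    have "L' (A \<oplus>\<^bsub>quot_vs V W\<^esub> B) = L' (?h (v \<oplus>\<^bsub>V\<^esub> w))"
      using h.f_add[OF vw(1,3)] vw by (simp only:)
    also have "\<dots> = L (v \<oplus>\<^bsub>V\<^esub> w)" by (rule eq) (use vw in simp)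
    also have "\<dots> = L v + L w" using L vw unfolding functional_def by blast
    finally show "L' (A \<oplus>\<^bsub>quot_vs V W\<^esub> B) = L' A + L' B" using vw eq by (simp only:)
  next
    fix c A assume "A \<in> carrier (quot_vs V W)"
    then obtain v where v: "v \<in> carrier V" "A = ?h v" using surj by blast
    have "L' (c \<odot>\<^bsub>quot_vs V W\<^esub> A) = L' (?h (c \<odot>\<^bsub>V\<^esub> v))"
      using h.f_smult[of c v] v by simp
    also have "\<dots> = L (c \<odot>\<^bsub>V\<^esub> v)" by (rule eq) (use v in simp)
    also have "\<dots> = c * L v" using L v unfolding functional_def by blast
    finally show "L' (c \<odot>\<^bsub>quot_vs V W\<^esub> A) = c * L' A" using v eq by (simp only:)
  qed
  with eq show ?thesis by blast
qed

subsection \<open>Presented vector spaces\<close>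

lemma free_vs_vectorspace: "vectorspace CC (free_vs S)"
  unfolding free_vs_def
proof (rule fun_vs_vectorspace)
  fix f g :: "'a \<Rightarrow> complex"
  assume "f \<in> {f. finite {s. f s \<noteq> 0} \<and> {s. f s \<noteq> 0} \<subseteq> S}"
    and "g \<in> {f. finite {s. f s \<noteq> 0} \<and> {s. f s \<noteq> 0} \<subseteq> S}"
  moreover have "{s. f s + g s \<noteq> 0} \<subseteq> {s. f s \<noteq> 0} \<union> {s. g s \<noteq> 0}" by auto
  ultimately show "(\<lambda>y. f y + g y) \<in> {f. finite {s. f s \<noteq> 0} \<and> {s. f s \<noteq> 0} \<subseteq> S}"
    by (auto intro: finite_subset)
next
  fix c and f :: "'a \<Rightarrow> complex"
  assume "f \<in> {f. finite {s. f s \<noteq> 0} \<and> {s. f s \<noteq> 0} \<subseteq> S}"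
  moreover have "{s. c * f s \<noteq> 0} \<subseteq> {s. f s \<noteq> 0}" by auto
  ultimately show "(\<lambda>y. c * f y) \<in> {f. finite {s. f s \<noteq> 0} \<and> {s. f s \<noteq> 0} \<subseteq> S}"
    by (auto intro: finite_subset)
qed auto

lemma free_vs_simps:
  "f \<in> carrier (free_vs S) \<longleftrightarrow> finite {s. f s \<noteq> 0} \<and> {s. f s \<noteq> 0} \<subseteq> S"
  "\<zero>\<^bsub>free_vs S\<^esub> = (\<lambda>_. 0)"
  "f \<oplus>\<^bsub>free_vs S\<^esub> g = (\<lambda>y. f y + g y)" "c \<odot>\<^bsub>free_vs S\<^esub> f = (\<lambda>y. c * f y)"
  by (simp_all add: fun_vs_def free_vs_def)

lemma free_gen_carrier: "s \<in> S \<Longrightarrow> free_gen s \<in> carrier (free_vs S)"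
  by (auto simp: free_vs_simps free_gen_def)

text \<open>Besides bare generators, these are the only shapes of relators in
  \<open>tensor_rels\<close> and \<open>wedge_rels\<close>.\<close>

lemma free_gen_combinations:
  assumes "a \<in> S" "b \<in> S"
  shows "(\<lambda>p. free_gen a p - c * free_gen b p) \<in> carrier (free_vs S)"
    and "d \<in> S \<Longrightarrow> (\<lambda>p. free_gen a p - free_gen b p - free_gen d p) \<in> carrier (free_vs S)"
proof -
  have "{p. free_gen a p - c * free_gen b p \<noteq> 0} \<subseteq> {a, b}"
    "{p. free_gen a p - free_gen b p - free_gen d p \<noteq> 0} \<subseteq> {a, b, d}"
    by (auto simp: free_gen_def)
  from this[THEN finite_subset] this show
    "(\<lambda>p. free_gen a p - c * free_gen b p) \<in> carrier (free_vs S)"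
    "d \<in> S \<Longrightarrow> (\<lambda>p. free_gen a p - free_gen b p - free_gen d p) \<in> carrier (free_vs S)"
    using assms by (simp_all add: free_vs_simps) blast+
qed

text \<open>The universal property of the free space: values on generators extend linearly. The
  values on both shapes of relators are recorded as well, so that later proofs never return to
  supports.\<close>

lemma free_functional:
  "\<exists>L. functional (free_vs S) L \<and>
     (\<forall>a b c. L (\<lambda>p. free_gen a p - c * free_gen b p) = \<phi> a - c * \<phi> b) \<and>
     (\<forall>a b d. L (\<lambda>p. free_gen a p - free_gen b p - free_gen d p) = \<phi> a - \<phi> b - \<phi> d) \<and>
     (\<forall>a. L (free_gen a) = \<phi> a)"
proof -
  define L where "L f = (\<Sum>s\<in>{s. f s \<noteq> 0}. f s * \<phi> s)" for f :: "'a \<Rightarrow> complex"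
  \<comment> \<open>Enlarging the support to any finite superset lets sums for different functions
    run over a common index set.\<close>
  have L: "L f = (\<Sum>s\<in>A. f s * \<phi> s)" if "finite A" "{s. f s \<noteq> 0} \<subseteq> A" for f A
    unfolding L_def using that by (intro sum.mono_neutral_left) auto
  have "functional (free_vs S) L"
    unfolding functional_def
  proof (intro conjI ballI allI)
    fix f g assume f: "f \<in> carrier (free_vs S)" and g: "g \<in> carrier (free_vs S)"
    let ?A = "{s. f s \<noteq> 0} \<union> {s. g s \<noteq> 0}"
    have "finite ?A" using f g by (simp add: free_vs_simps)
    then show "L (f \<oplus>\<^bsub>free_vs S\<^esub> g) = L f + L g"
      by (subst (1 2 3) L[of ?A]) (auto simp: free_vs_simps sum.distrib algebra_simps)
  next
    fix c f assume f: "f \<in> carrier (free_vs S)"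
    let ?A = "{s. f s \<noteq> 0}"
    have "finite ?A" using f by (simp add: free_vs_simps)
    then show "L (c \<odot>\<^bsub>free_vs S\<^esub> f) = c * L f"
      by (subst (1 2) L[of ?A]) (auto simp: free_vs_simps sum_distrib_left algebra_simps)
  qed
  moreover have "L (\<lambda>p. free_gen a p - c * free_gen b p) = \<phi> a - c * \<phi> b" for a b c
  proof -
    have "L (\<lambda>p. free_gen a p - c * free_gen b p) =
        (\<Sum>s\<in>{a, b}. (if s = a then \<phi> s else 0) - c * (if s = b then \<phi> s else 0))"
      by (subst L[of "{a, b}"]) (auto simp: free_gen_def algebra_simps intro!: sum.cong)
    also have "\<dots> = \<phi> a - c * \<phi> b"
      by (simp only: sum_subtractf sum_distrib_left[symmetric]) simp
    finally show ?thesis .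
  qed
  moreover have "L (\<lambda>p. free_gen a p - free_gen b p - free_gen d p) = \<phi> a - \<phi> b - \<phi> d" for a b d
  proof -
    have "L (\<lambda>p. free_gen a p - free_gen b p - free_gen d p) =
        (\<Sum>s\<in>{a, b, d}. (if s = a then \<phi> s else 0) - (if s = b then \<phi> s else 0)
          - (if s = d then \<phi> s else 0))"
      by (subst L[of "{a, b, d}"]) (auto simp: free_gen_def algebra_simps intro!: sum.cong)
    also have "\<dots> = \<phi> a - \<phi> b - \<phi> d"
      by (simp only: sum_subtractf) simp
    finally show ?thesis .
  qed
  moreover have "L (free_gen a) = \<phi> a" for a
    by (subst L[of "{a}"]) (auto simp: free_gen_def)
  ultimately show ?thesis by blast
qed

text \<open>The last claim is the universal property: generator values compatible with the relations
  descend to the quotient. Its premise ranges over every form with the listed values, because the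
  extension built inside the proof cannot be named by the caller.\<close>

lemma presented_vs:
  assumes R: "R \<subseteq> carrier (free_vs S)"
  shows "vectorspace CC (presented_vs S R)"
    and "\<And>s. s \<in> S \<Longrightarrow> presented_class S R s \<in> carrier (presented_vs S R)"
    and "\<And>a b c. a \<in> S \<Longrightarrow> b \<in> S \<Longrightarrow> (\<lambda>p. free_gen a p - c * free_gen b p) \<in> R \<Longrightarrow>
           presented_class S R a = c \<odot>\<^bsub>presented_vs S R\<^esub> presented_class S R b"
    and "\<And>\<phi>. \<lbrakk>\<And>L. functional (free_vs S) L \<Longrightarrow>
            (\<And>a b c. L (\<lambda>p. free_gen a p - c * free_gen b p) = \<phi> a - c * \<phi> b) \<Longrightarrow>
            (\<And>a b d. L (\<lambda>p. free_gen a p - free_gen b p - free_gen d p) = \<phi> a - \<phi> b - \<phi> d) \<Longrightarrow>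
            (\<And>a. L (free_gen a) = \<phi> a) \<Longrightarrow> \<forall>r\<in>R. L r = 0\<rbrakk> \<Longrightarrow>
          \<exists>L. functional (presented_vs S R) L \<and> (\<forall>s\<in>S. L (presented_class S R s) = \<phi> s)"
proof -
  let ?F = "free_vs S"
  interpret F: vectorspace CC ?F by (rule free_vs_vectorspace)
  let ?W = "F.module.span R"
  have W: "submodule CC ?W ?F" by (rule F.module.span_is_submodule[OF R])
  note Q = quot_vs_hom[OF F.vectorspace_axioms W, folded presented_vs_def]
  interpret h: linear_map CC ?F "presented_vs S R" "\<lambda>v. ?W +>\<^bsub>?F\<^esub> v" by (rule Q)
  show "vectorspace CC (presented_vs S R)" by (rule Q)
  show "presented_class S R s \<in> carrier (presented_vs S R)" if "s \<in> S" for s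
    unfolding presented_class_def using free_gen_carrier[OF that] by (rule h.f_im)
  show "presented_class S R a = c \<odot>\<^bsub>presented_vs S R\<^esub> presented_class S R b"
    if a: "a \<in> S" and b: "b \<in> S" and r: "(\<lambda>p. free_gen a p - c * free_gen b p) \<in> R" for a b c
  proof -
    let ?r = "\<lambda>p. free_gen a p - c * free_gen b p"
    note gb = free_gen_carrier[OF b]
    have cb: "c \<odot>\<^bsub>?F\<^esub> free_gen b \<in> carrier ?F" using gb by (intro F.module.smult_closed) simp_all
    have rW: "?r \<in> ?W" using r F.module.in_own_span[OF R] by blast
    \<comment> \<open>The generator \<open>a\<close> is the relator plus a multiple of the generator
      \<open>b\<close>, and the relator becomes zero in the quotient.\<close>
    have "free_gen a = ?r \<oplus>\<^bsub>?F\<^esub> (c \<odot>\<^bsub>?F\<^esub> free_gen b)" by (simp add: free_vs_simps)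
    then have "presented_class S R a = ?W +>\<^bsub>?F\<^esub> (?r \<oplus>\<^bsub>?F\<^esub> (c \<odot>\<^bsub>?F\<^esub> free_gen b))"
      unfolding presented_class_def by (rule arg_cong)
    also have "\<dots> = (?W +>\<^bsub>?F\<^esub> ?r) \<oplus>\<^bsub>presented_vs S R\<^esub> (?W +>\<^bsub>?F\<^esub> (c \<odot>\<^bsub>?F\<^esub> free_gen b))"
      using r R by (intro h.f_add cb) blast
    also have "?W +>\<^bsub>?F\<^esub> ?r = \<zero>\<^bsub>presented_vs S R\<^esub>"
      using Q(4)[of ?r] R r rW by blast
    finally have "presented_class S R a = \<zero>\<^bsub>presented_vs S R\<^esub> \<oplus>\<^bsub>presented_vs S R\<^esub> (?W +>\<^bsub>?F\<^esub> (c \<odot>\<^bsub>?F\<^esub> free_gen b))"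
      .
    also have "\<dots> = ?W +>\<^bsub>?F\<^esub> (c \<odot>\<^bsub>?F\<^esub> free_gen b)"
      using h.f_im[OF cb] by (rule h.W.module.M.l_zero)
    also have "\<dots> = c \<odot>\<^bsub>presented_vs S R\<^esub> presented_class S R b"
      unfolding presented_class_def using gb by (intro h.f_smult) simp_all
    finally show ?thesis .
  qed
  fix \<phi>
  assume *: "\<And>L. functional (free_vs S) L \<Longrightarrow>
            (\<And>a b c. L (\<lambda>p. free_gen a p - c * free_gen b p) = \<phi> a - c * \<phi> b) \<Longrightarrow>
            (\<And>a b d. L (\<lambda>p. free_gen a p - free_gen b p - free_gen d p) = \<phi> a - \<phi> b - \<phi> d) \<Longrightarrow>
            (\<And>a. L (free_gen a) = \<phi> a) \<Longrightarrow> \<forall>r\<in>R. L r = 0"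
  obtain L where L: "functional ?F L" 
    "\<And>a b c. L (\<lambda>p. free_gen a p - c * free_gen b p) = \<phi> a - c * \<phi> b"
    "\<And>a b d. L (\<lambda>p. free_gen a p - free_gen b p - free_gen d p) = \<phi> a - \<phi> b - \<phi> d"
    "\<And>a. L (free_gen a) = \<phi> a"
    using free_functional[of S \<phi>] by blast
  have LR: "\<forall>r\<in>R. L r = 0" by (rule *) (use L in auto)
  \<comment> \<open>The kernel of \<open>L\<close> is a submodule containing the relators, hence
    contains their span, so that \<open>L\<close> descends.\<close>
  have "submodule CC {f \<in> carrier ?F. L f = 0} ?F"
  proof (rule submodule.intro)
    show "module CC ?F" by (rule F.module.module_axioms)
    fix v w c assume "v \<in> {f \<in> carrier ?F. L f = 0}" "w \<in> {f \<in> carrier ?F. L f = 0}"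
    then show "v \<oplus>\<^bsub>?F\<^esub> w \<in> {f \<in> carrier ?F. L f = 0}" "c \<odot>\<^bsub>?F\<^esub> v \<in> {f \<in> carrier ?F. L f = 0}"
      using L(1) by (simp_all add: functional_def)
  qed (use functional_zero[OF F.vectorspace_axioms L(1)] in auto)
  then have "?W \<subseteq> {f \<in> carrier ?F. L f = 0}"
    by (intro F.module.span_is_subset) (use LR R in auto)
  then obtain L' where "functional (presented_vs S R) L'"
    "\<forall>v\<in>carrier ?F. L' (?W +>\<^bsub>?F\<^esub> v) = L v"
    using quot_functional[OF F.vectorspace_axioms W L(1)] unfolding presented_vs_def by blast
  then show "\<exists>L. functional (presented_vs S R) L \<and> (\<forall>s\<in>S. L (presented_class S R s) = \<phi> s)"
    using free_gen_carrier[of _ S] L(4) by (auto simp: presented_class_def)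
qed

subsection \<open>Tensor products and exterior powers\<close>

lemma tensor_rels_carrier:
  assumes V: "vectorspace CC V" and W: "vectorspace CC W"
  shows "tensor_rels V W \<subseteq> carrier (free_vs (carrier V \<times> carrier W))"
proof -
  interpret V: vectorspace CC V by fact
  interpret W: vectorspace CC W by fact
  have "c \<odot>\<^bsub>V\<^esub> v \<in> carrier V" if "v \<in> carrier V" for c v
    using that by (intro V.smult_closed) simp_all
  moreover have "c \<odot>\<^bsub>W\<^esub> v \<in> carrier W" if "v \<in> carrier W" for c v
    using that by (intro W.smult_closed) simp_all
  ultimately show ?thesis
    unfolding tensor_rels_def
    by (intro Un_least subsetI; elim CollectE exE conjE; hypsubst; intro free_gen_combinations) simp_all
qed

lemma tensor_vs_vectorspace:
  assumes "vectorspace CC V" "vectorspace CC W"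
  shows "vectorspace CC (tensor_vs V W)"
  unfolding tensor_vs_def by (rule presented_vs(1)[OF tensor_rels_carrier[OF assms]])

lemma tensor_elt_carrier:
  assumes "vectorspace CC V" "vectorspace CC W" "v \<in> carrier V" "w \<in> carrier W"
  shows "tensor_elt V W v w \<in> carrier (tensor_vs V W)"
  unfolding tensor_vs_def tensor_elt_def
  by (rule presented_vs(2)[OF tensor_rels_carrier]) (use assms in auto)

lemma tensor_elt_smult:
  assumes V: "vectorspace CC V" and W: "vectorspace CC W" and v: "v \<in> carrier V" and w: "w \<in> carrier W"
  shows "tensor_elt V W (a \<odot>\<^bsub>V\<^esub> v) (b \<odot>\<^bsub>W\<^esub> w) = (a * b) \<odot>\<^bsub>tensor_vs V W\<^esub> tensor_elt V W v w"
proof -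
  interpret V: vectorspace CC V by fact
  interpret W: vectorspace CC W by fact
  interpret T: vectorspace CC "tensor_vs V W" by (rule tensor_vs_vectorspace[OF V W])
  have av: "a \<odot>\<^bsub>V\<^esub> v \<in> carrier V" and bw: "b \<odot>\<^bsub>W\<^esub> w \<in> carrier W"
    using v w by (auto intro!: V.smult_closed W.smult_closed)
  have "tensor_elt V W (a \<odot>\<^bsub>V\<^esub> v) (b \<odot>\<^bsub>W\<^esub> w) = a \<odot>\<^bsub>tensor_vs V W\<^esub> tensor_elt V W v (b \<odot>\<^bsub>W\<^esub> w)"
    unfolding tensor_vs_def tensor_elt_def
    by (rule presented_vs(3)[OF tensor_rels_carrier[OF V W]]) (use av bw v in \<open>auto simp: tensor_rels_def\<close>)
  also have "tensor_elt V W v (b \<odot>\<^bsub>W\<^esub> w) = b \<odot>\<^bsub>tensor_vs V W\<^esub> tensor_elt V W v w"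
    unfolding tensor_vs_def tensor_elt_def
    by (rule presented_vs(3)[OF tensor_rels_carrier[OF V W]]) (use v bw w in \<open>auto simp: tensor_rels_def\<close>)
  also have "a \<odot>\<^bsub>tensor_vs V W\<^esub> (b \<odot>\<^bsub>tensor_vs V W\<^esub> tensor_elt V W v w) =
      (a * b) \<odot>\<^bsub>tensor_vs V W\<^esub> tensor_elt V W v w"
    using T.smult_assoc1[of a b] tensor_elt_carrier[OF V W v w] by simp
  finally show ?thesis .
qed

text \<open>The product of the two forms is bilinear and so kills every relator. It shows a pure
  tensor to be nonzero as soon as both factors are detected by forms.\<close>

lemma tensor_functional:
  assumes V: "vectorspace CC V" and W: "vectorspace CC W" and L: "functional V L" and M: "functional W M"
  shows "\<exists>K. functional (tensor_vs V W) K \<and>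
    (\<forall>v\<in>carrier V. \<forall>w\<in>carrier W. K (tensor_elt V W v w) = L v * M w)"
proof -
  let ?\<phi> = "\<lambda>(v, w). L v * M w"
  have "\<exists>K. functional (tensor_vs V W) K \<and>
    (\<forall>s\<in>carrier V \<times> carrier W. K (presented_class (carrier V \<times> carrier W) (tensor_rels V W) s) = ?\<phi> s)"
    unfolding tensor_vs_def
  proof (rule presented_vs(4)[OF tensor_rels_carrier[OF V W]], intro ballI)
    fix K r
    assume K: "\<And>a b c. K (\<lambda>p. free_gen a p - c * free_gen b p) = ?\<phi> a - c * ?\<phi> b"
      "\<And>a b d. K (\<lambda>p. free_gen a p - free_gen b p - free_gen d p) = ?\<phi> a - ?\<phi> b - ?\<phi> d"
      and r: "r \<in> tensor_rels V W"
    from r show "K r = 0"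
      unfolding tensor_rels_def
      by (elim UnE CollectE exE conjE; hypsubst; subst K)
        (use L M in \<open>simp_all add: functional_def algebra_simps\<close>)
  qed
  then show ?thesis by (auto simp: tensor_elt_def)
qed

lemma wedge_rels_carrier:
  assumes V: "vectorspace CC V"
  shows "wedge_rels m V \<subseteq> carrier (free_vs (tuples m (carrier V)))"
proof -
  interpret V: vectorspace CC V by fact
  have 1: "c \<odot>\<^bsub>V\<^esub> v \<in> carrier V" if "v \<in> carrier V" for c v
    using that by (intro V.smult_closed) simp_all
  have upd: "vs[i := v] \<in> tuples m (carrier V)" if "vs \<in> tuples m (carrier V)" "v \<in> carrier V" for vs i v
    using that set_update_subset_insert[of vs i v] by (auto simp: tuples_def)
  show ?thesis
    unfolding wedge_rels_def
    by (intro Un_least subsetI; elim CollectE exE conjE; hypsubst;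
        (intro free_gen_combinations free_gen_carrier)?) (simp_all add: upd 1)
qed

lemma wedge_vs_vectorspace:
  assumes "vectorspace CC V"
  shows "vectorspace CC (wedge_vs m V)"
  unfolding wedge_vs_def by (rule presented_vs(1)[OF wedge_rels_carrier[OF assms]])

lemma wedge_elt_carrier:
  assumes "vectorspace CC V" "vs \<in> tuples m (carrier V)"
  shows "wedge_elt m V vs \<in> carrier (wedge_vs m V)"
  unfolding wedge_vs_def wedge_elt_def
  by (rule presented_vs(2)[OF wedge_rels_carrier]) (use assms in auto)

lemma wedge_elt_smult:
  assumes V: "vectorspace CC V" and vs: "vs \<in> tuples m (carrier V)"
  shows "wedge_elt m V (map (\<lambda>v. c \<odot>\<^bsub>V\<^esub> v) vs) = (c ^ m) \<odot>\<^bsub>wedge_vs m V\<^esub> wedge_elt m V vs"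
proof -
  interpret V: vectorspace CC V by fact
  interpret W: vectorspace CC "wedge_vs m V" by (rule wedge_vs_vectorspace[OF V])
  have sm: "c \<odot>\<^bsub>V\<^esub> v \<in> carrier V" if "v \<in> carrier V" for v
    using that by (intro V.smult_closed) simp_all
  have len: "length vs = m" and sub: "set vs \<subseteq> carrier V" using vs by (auto simp: tuples_def)
  \<comment> \<open>The first \<open>i\<close> entries of \<open>?sc i\<close> are already scaled;
    passing to \<open>i + 1\<close> changes a single slot and costs one factor
    \<open>c\<close>.\<close>
  let ?sc = "\<lambda>i. map (\<lambda>v. c \<odot>\<^bsub>V\<^esub> v) (take i vs) @ drop i vs"
  have tup: "?sc i \<in> tuples m (carrier V)" for i
    using len sub sm by (auto simp: tuples_def dest: in_set_takeD in_set_dropD)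
  have "wedge_elt m V (?sc i) = (c ^ i) \<odot>\<^bsub>wedge_vs m V\<^esub> wedge_elt m V vs" if "i \<le> m" for i
    using that
  proof (induction i)
    case 0
    then show ?case using W.smult_one[OF wedge_elt_carrier[OF V vs]] by simp
  next
    case (Suc i)
    then have i: "i < length vs" using len by simp
    have vi: "vs ! i \<in> carrier V" using i sub by auto
    \<comment> \<open>Both lists are presented as updates of the same list at slot \<open>i\<close>,
      since that is the literal form of a relator in \<open>wedge_rels\<close>.\<close>
    have scS: "?sc (Suc i) = (?sc i)[i := c \<odot>\<^bsub>V\<^esub> (vs ! i)]"
      using i by (auto simp: take_Suc_conv_app_nth list_update_append min_def Cons_nth_drop_Suc[symmetric])
    have scI: "?sc i = (?sc i)[i := vs ! i]"
      using i by (auto simp: list_update_append min_def Cons_nth_drop_Suc[symmetric])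
    have "(\<lambda>p. free_gen ((?sc i)[i := c \<odot>\<^bsub>V\<^esub> (vs ! i)]) p - c * free_gen ((?sc i)[i := vs ! i]) p)
        \<in> wedge_rels m V"
      unfolding wedge_rels_def using tup[of i] i len vi by blast
    then have "(\<lambda>p. free_gen (?sc (Suc i)) p - c * free_gen (?sc i) p) \<in> wedge_rels m V"
      unfolding scS[symmetric] scI[symmetric] .
    then have "wedge_elt m V (?sc (Suc i)) = c \<odot>\<^bsub>wedge_vs m V\<^esub> wedge_elt m V (?sc i)"
      unfolding wedge_vs_def wedge_elt_def
      by (rule presented_vs(3)[OF wedge_rels_carrier[OF V] tup tup])
    also have "\<dots> = c \<odot>\<^bsub>wedge_vs m V\<^esub> ((c ^ i) \<odot>\<^bsub>wedge_vs m V\<^esub> wedge_elt m V vs)"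
      using Suc by simp
    also have "\<dots> = (c ^ Suc i) \<odot>\<^bsub>wedge_vs m V\<^esub> wedge_elt m V vs"
      using W.smult_assoc1[of c "c ^ i"] wedge_elt_carrier[OF V vs] by simp
    finally show ?case .
  qed
  from this[of m] show ?thesis using len by simp
qed

text \<open>The determinant of the matrix of values is multilinear and alternating in the vectors,
  so it factors through the exterior power.\<close>

lemma wedge_functional:
  assumes V: "vectorspace CC V" and a: "\<And>j. j < m \<Longrightarrow> functional V (a j)"
  shows "\<exists>K. functional (wedge_vs m V) K \<and>
    (\<forall>vs\<in>tuples m (carrier V). K (wedge_elt m V vs) = det (mat m m (\<lambda>(i, j). a j (vs ! i))))"
proof -
  have a_add: "a j (v \<oplus>\<^bsub>V\<^esub> w) = a j v + a j w" if "j < m" "v \<in> carrier V" "w \<in> carrier V" for j v w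
    using a[OF that(1)] that unfolding functional_def by blast
  have a_smult: "a j (c \<odot>\<^bsub>V\<^esub> v) = c * a j v" if "j < m" "v \<in> carrier V" for j c v
    using a[OF that(1)] that unfolding functional_def by blast
  let ?M = "\<lambda>vs. mat m m (\<lambda>(i, j). a j (vs ! i))"
  \<comment> \<open>The cofactors along row \<open>i\<close> do not involve the vector in slot
    \<open>i\<close>, so the expansion reduces linearity in that slot to linearity of the
    forms.\<close>
  have laplace: "det (?M (vs[i := v])) = (\<Sum>j<m. a j v * cofactor (?M vs) i j)"
    if "vs \<in> tuples m (carrier V)" "i < m" for vs i v
  proof -
    have "mat_delete (?M (vs[i := v])) i j = mat_delete (?M vs) i j" for j
      using that by (intro eq_matI) (auto simp: mat_delete_def tuples_def nth_list_update)
    then show ?thesis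
      using that by (subst laplace_expansion_row[of _ m i]) (auto simp: cofactor_def tuples_def)
  qed
  let ?\<phi> = "\<lambda>vs. det (?M vs)"
  have "\<exists>K. functional (wedge_vs m V) K \<and>
    (\<forall>s\<in>tuples m (carrier V). K (presented_class (tuples m (carrier V)) (wedge_rels m V) s) = ?\<phi> s)"
    unfolding wedge_vs_def
  proof (rule presented_vs(4)[OF wedge_rels_carrier[OF V]], intro ballI)
    fix K r
    assume K: "\<And>a b c. K (\<lambda>p. free_gen a p - c * free_gen b p) = ?\<phi> a - c * ?\<phi> b"
      "\<And>a b d. K (\<lambda>p. free_gen a p - free_gen b p - free_gen d p) = ?\<phi> a - ?\<phi> b - ?\<phi> d"
      "\<And>a. K (free_gen a) = ?\<phi> a"
    assume "r \<in> wedge_rels m V"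
    then consider
      (add) vs i v w where "vs \<in> tuples m (carrier V)" "i < m" "v \<in> carrier V" "w \<in> carrier V"
        "r = (\<lambda>p. free_gen (vs[i := v \<oplus>\<^bsub>V\<^esub> w]) p - free_gen (vs[i := v]) p - free_gen (vs[i := w]) p)"
    | (smult) vs i c v where "vs \<in> tuples m (carrier V)" "i < m" "v \<in> carrier V"
        "r = (\<lambda>p. free_gen (vs[i := c \<odot>\<^bsub>V\<^esub> v]) p - c * free_gen (vs[i := v]) p)"
    | (alt) vs i j where "i < j" "j < m" "vs ! i = vs ! j" "r = free_gen vs"
      unfolding wedge_rels_def by blast
    then show "K r = 0"
    proof cases
      case add
      then have "(\<Sum>j<m. a j (v \<oplus>\<^bsub>V\<^esub> w) * cofactor (?M vs) i j) =
          (\<Sum>j<m. a j v * cofactor (?M vs) i j) + (\<Sum>j<m. a j w * cofactor (?M vs) i j)"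
        unfolding sum.distrib[symmetric]
        by (intro sum.cong refl) (use a_add add in \<open>simp add: ring_distribs\<close>)
      with add show ?thesis by (simp add: K laplace)
    next
      case smult
      then have "(\<Sum>j<m. a j (c \<odot>\<^bsub>V\<^esub> v) * cofactor (?M vs) i j) =
          c * (\<Sum>j<m. a j v * cofactor (?M vs) i j)"
        unfolding sum_distrib_left
        by (intro sum.cong refl) (use a_smult smult in simp)
      with smult show ?thesis by (simp add: K laplace)
    next
      case alt
      have "det (?M vs) = 0"
        by (rule det_identical_rows[of _ m i j]) (use alt in auto)
      with alt show ?thesis by (simp add: K)
    qed
  qed
  then show ?thesis by (auto simp: wedge_elt_def)
qed

text \<open>Thinning \<open>S\<close> to a basis and reading off coordinates gives the dual forms.
  The vectors are taken from \<open>S\<close> itself because later they must be values at one point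
  of fields given on whole charts.\<close>

lemma dual_family_exists:
  assumes V: "vectorspace CC V" and S: "finite S" "S \<subseteq> carrier V"
    and span: "linear_span V S = carrier V"
    and m: "m \<le> vectorspace.dim CC V"
  shows "\<exists>vs a. vs \<in> tuples m S \<and> (\<forall>j<m. functional V (a j)) \<and>
    (\<forall>i<m. \<forall>j<m. a j (vs ! i) = of_bool (i = j))"
proof -
  interpret V: vectorspace CC V by (rule V)
  obtain B where B: "B \<subseteq> S" "minimal B (\<lambda>S. S \<subseteq> carrier V \<and> V.span S = carrier V)"
    using minimal_exists[of S "\<lambda>S. S \<subseteq> carrier V \<and> V.span S = carrier V"] S span by blast
  have fin: "finite B" using B(1) S(1) by (rule finite_subset)
  have BV: "B \<subseteq> carrier V" using B(1) S(2) by simp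
  have basis: "V.basis B" by (rule V.min_gen_is_basis[OF B(2)])
  have uniq: "\<exists>!a. a \<in> B \<rightarrow>\<^sub>E UNIV \<and> V.lincomb a B = v" if "v \<in> carrier V" for v
    using V.basis_criterion[OF fin BV] basis that by simp
  define cf where "cf v = (THE a. a \<in> B \<rightarrow>\<^sub>E UNIV \<and> V.lincomb a B = v)" for v
  have cf: "cf v \<in> B \<rightarrow>\<^sub>E UNIV" "V.lincomb (cf v) B = v" if "v \<in> carrier V" for v
    using theI'[OF uniq[OF that]] unfolding cf_def by auto
  \<comment> \<open>Coefficients are unique only among functions that are \<open>undefined\<close>
    outside \<open>B\<close>, so an arbitrary coefficient function is restricted first.\<close>
  have cfI: "cf v b = a b" if "v \<in> carrier V" "V.lincomb a B = v" "b \<in> B" for v a b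
  proof -
    have "V.lincomb (restrict a B) B = V.lincomb a B"
      by (rule V.lincomb_cong) (use BV in auto)
    moreover have "restrict a B \<in> B \<rightarrow>\<^sub>E UNIV" by simp
    ultimately have "cf v = restrict a B"
      using ex1E[OF uniq[OF that(1)]] cf[OF that(1)] that(2) by metis
    then show ?thesis using that(3) by simp
  qed
  have func: "functional V (\<lambda>v. cf v b)" if b: "b \<in> B" for b
    unfolding functional_def
  proof (intro conjI ballI allI)
    fix v w assume vw: "v \<in> carrier V" "w \<in> carrier V"
    have "V.lincomb (\<lambda>b. cf v b + cf w b) B = v \<oplus>\<^bsub>V\<^esub> w"
      using V.lincomb_sum[OF fin BV, of "cf v" "cf w"] cf[OF vw(1)] cf[OF vw(2)] by simp
    then show "cf (v \<oplus>\<^bsub>V\<^esub> w) b = cf v b + cf w b" using vw b by (intro cfI) auto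
  next
    fix c v assume v: "v \<in> carrier V"
    have "V.lincomb (\<lambda>b. c * cf v b) B = c \<odot>\<^bsub>V\<^esub> v"
      using V.lincomb_smult[OF BV, of "cf v" c] cf[OF v] by simp
    then show "cf (c \<odot>\<^bsub>V\<^esub> v) b = c * cf v b" using v b V.smult_closed[of c v] by (intro cfI) auto
  qed
  have unit: "cf b b' = of_bool (b = b')" if b: "b \<in> B" "b' \<in> B" for b b'
  proof -
    have bc: "b \<in> carrier V" using b BV by auto
    have z: "0 \<odot>\<^bsub>V\<^esub> v = \<zero>\<^bsub>V\<^esub>" if "v \<in> carrier V" for v
      using V.smult_l_null[OF that] by simp
    have o: "1 \<odot>\<^bsub>V\<^esub> b = b" using V.smult_one[OF bc] by simp
    have "V.lincomb (\<lambda>b'. of_bool (b = b')) B = (\<Oplus>\<^bsub>V\<^esub>v\<in>B. if b = v then v else \<zero>\<^bsub>V\<^esub>)"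
      unfolding V.lincomb_def
      by (intro V.M.add.finprod_cong') (use BV z o in auto)
    also have "\<dots> = b"
      by (rule V.M.add.finprod_singleton[OF b(1) fin]) (use BV in auto)
    finally show ?thesis using cfI[OF bc _ b(2)] by simp
  qed
  obtain xs where xs: "set xs = B" "distinct xs" using finite_distinct_list[OF fin] by blast
  have "V.dim = card B" by (rule V.dim_basis[OF fin basis])
  then have len: "m \<le> length xs" using m xs distinct_card by metis
  have nth: "xs ! j \<in> B" if "j < m" for j using that len xs by auto
  show ?thesis
  proof (intro exI[of _ "take m xs"] exI[of _ "\<lambda>j v. cf v (xs ! j)"] conjI allI impI)
    show "take m xs \<in> tuples m S"
      using len xs B(1) by (auto simp: tuples_def dest: in_set_takeD)
    fix i j assume "i < m" "j < m"
    then show "cf (take m xs ! i) (xs ! j) = of_bool (i = j)"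
      using unit[OF nth nth] len xs(2) by (simp add: nth_eq_iff_index_eq)
  qed (use func nth in auto)
qed

text \<open>On a dual family the determinant form evaluates the identity matrix.\<close>

lemma wedge_elt_nonzero:
  assumes V: "vectorspace CC V" and vs: "vs \<in> tuples m (carrier V)"
    and a: "\<And>j. j < m \<Longrightarrow> functional V (a j)"
    and dual: "\<And>i j. i < m \<Longrightarrow> j < m \<Longrightarrow> a j (vs ! i) = of_bool (i = j)"
  shows "\<exists>K. functional (wedge_vs m V) K \<and> K (wedge_elt m V vs) = 1"
proof -
  obtain K where K: "functional (wedge_vs m V) K"
    "K (wedge_elt m V vs) = det (mat m m (\<lambda>(i, j). a j (vs ! i)))"
    using wedge_functional[OF V, of m a] a vs by blast
  have "mat m m (\<lambda>(i, j). a j (vs ! i)) = (1\<^sub>m m :: complex mat)"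
    using dual by (intro eq_matI) auto
  then show ?thesis using K by auto
qed

section \<open>Projective space\<close>

abbreviation zariski_open :: "nat \<Rightarrow> (nat \<Rightarrow> complex) set set \<Rightarrow> bool" where
  "zariski_open N \<equiv> openin (tsp (proj_space N))"

abbreviation regular :: "nat \<Rightarrow> (nat \<Rightarrow> complex) set set \<Rightarrow> ((nat \<Rightarrow> complex) set \<Rightarrow> complex) set" where
  "regular N \<equiv> reg (proj_space N)"

abbreviation germs :: "nat \<Rightarrow> (nat \<Rightarrow> complex) \<Rightarrow> ((nat \<Rightarrow> complex) set \<Rightarrow> complex) set" where
  "germs N v \<equiv> near_reg (proj_space N) (hline v)"

section \<open>Homogeneous polynomials as functions of the coordinates\<close>

lemma hom_poly_zero: "hom_poly N d (\<lambda>_. 0)"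
  unfolding hom_poly_def by (rule exI[of _ "{}"]) auto

lemma hom_poly_monomial:
  assumes "(\<Sum>i\<le>N. \<alpha> i) = d"
  shows "hom_poly N d (\<lambda>v. c * (\<Prod>i\<le>N. v i ^ \<alpha> i))"
  unfolding hom_poly_def using assms by (intro exI[of _ "{\<alpha>}"] exI[of _ "\<lambda>_. c"]) auto

lemma hom_poly_add:
  assumes "hom_poly N d g" "hom_poly N d h"
  shows "hom_poly N d (\<lambda>v. g v + h v)"
proof -
  obtain A a B b where A: "finite A" "\<forall>\<alpha>\<in>A. (\<Sum>i\<le>N. \<alpha> i) = d" "g = (\<lambda>v. \<Sum>\<alpha>\<in>A. a \<alpha> * (\<Prod>i\<le>N. v i ^ \<alpha> i))"
    and B: "finite B" "\<forall>\<alpha>\<in>B. (\<Sum>i\<le>N. \<alpha> i) = d" "h = (\<lambda>v. \<Sum>\<alpha>\<in>B. b \<alpha> * (\<Prod>i\<le>N. v i ^ \<alpha> i))"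
    using assms unfolding hom_poly_def by blast
  \<comment> \<open>Different sets of monomials are merged by padding with zero coefficients; on a
    common monomial the coefficients add.\<close>
  let ?c = "\<lambda>\<alpha>. (if \<alpha> \<in> A then a \<alpha> else 0) + (if \<alpha> \<in> B then b \<alpha> else 0)"
  have "(\<Sum>\<alpha>\<in>A. a \<alpha> * (\<Prod>i\<le>N. v i ^ \<alpha> i)) =
      (\<Sum>\<alpha>\<in>A \<union> B. (if \<alpha> \<in> A then a \<alpha> else 0) * (\<Prod>i\<le>N. v i ^ \<alpha> i))" for v :: "nat \<Rightarrow> complex"
    using A(1) B(1) by (intro sum.mono_neutral_cong_left) auto
  moreover have "(\<Sum>\<alpha>\<in>B. b \<alpha> * (\<Prod>i\<le>N. v i ^ \<alpha> i)) =
      (\<Sum>\<alpha>\<in>A \<union> B. (if \<alpha> \<in> B then b \<alpha> else 0) * (\<Prod>i\<le>N. v i ^ \<alpha> i))" for v :: "nat \<Rightarrow> complex"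
    using A(1) B(1) by (intro sum.mono_neutral_cong_left) auto
  ultimately have "(\<lambda>v. g v + h v) = (\<lambda>v. \<Sum>\<alpha>\<in>A \<union> B. ?c \<alpha> * (\<Prod>i\<le>N. v i ^ \<alpha> i))"
    unfolding A(3) B(3) by (simp only: sum.distrib[symmetric] distrib_right)
  then show ?thesis
    unfolding hom_poly_def using A B by (intro exI[of _ "A \<union> B"] exI[of _ ?c]) auto
qed

lemma hom_poly_sum:
  assumes "\<And>a. a \<in> A \<Longrightarrow> hom_poly N d (g a)"
  shows "hom_poly N d (\<lambda>v. \<Sum>a\<in>A. g a v)"
  using assms
  by (induction A rule: infinite_finite_induct) (auto intro: hom_poly_add hom_poly_zero)

lemma hom_poly_coord:
  assumes "hom_poly N d g" and i: "i \<le> N"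
  shows "hom_poly N (Suc d) (\<lambda>v. v i * g v)"
proof -
  obtain A a where A: "finite A" "\<forall>\<alpha>\<in>A. (\<Sum>i\<le>N. \<alpha> i) = d" "g = (\<lambda>v. \<Sum>\<alpha>\<in>A. a \<alpha> * (\<Prod>i\<le>N. v i ^ \<alpha> i))"
    using assms unfolding hom_poly_def by blast
  have "hom_poly N (Suc d) (\<lambda>v. v i * (a \<alpha> * (\<Prod>i\<le>N. v i ^ \<alpha> i)))" if "\<alpha> \<in> A" for \<alpha>
  proof -
    have "(\<Sum>k\<le>N. (\<alpha>(i := Suc (\<alpha> i))) k) = Suc d"
      using A(2) that i by (simp add: sum.remove[of "{..N}" i])
    moreover have "(\<Prod>k\<le>N. v k ^ (\<alpha>(i := Suc (\<alpha> i))) k) = v i * (\<Prod>k\<le>N. v k ^ \<alpha> k)" for v :: "nat \<Rightarrow> complex"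
      using i by (simp add: prod.remove[of "{..N}" i])
    ultimately show ?thesis
      using hom_poly_monomial[of "\<alpha>(i := Suc (\<alpha> i))" N "Suc d" "a \<alpha>"] by (simp add: mult_ac)
  qed
  then have "hom_poly N (Suc d) (\<lambda>v. \<Sum>\<alpha>\<in>A. v i * (a \<alpha> * (\<Prod>i\<le>N. v i ^ \<alpha> i)))"
    by (rule hom_poly_sum)
  then show ?thesis unfolding A(3) by (simp add: sum_distrib_left)
qed

lemma hom_poly_const: "hom_poly N 0 (\<lambda>_. c)"
  using hom_poly_monomial[of "\<lambda>_. 0" N 0 c] by simp

text \<open>Homogeneous polynomials arise from constants by addition and by multiplication with one
  coordinate, which raises the degree by one. Zero is a case in every degree, being the empty sum of
  monomials.\<close>

lemma hom_poly_induct [consumes 1, case_names const zero add coord]: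
  assumes "hom_poly N d g"
    and const: "\<And>c. P 0 (\<lambda>_. c)"
    and zero: "\<And>d. P d (\<lambda>_. 0)"
    and add: "\<And>d g h. hom_poly N d g \<Longrightarrow> hom_poly N d h \<Longrightarrow> P d g \<Longrightarrow> P d h \<Longrightarrow> P d (\<lambda>v. g v + h v)"
    and coord: "\<And>d g i. hom_poly N d g \<Longrightarrow> i \<le> N \<Longrightarrow> P d g \<Longrightarrow> P (Suc d) (\<lambda>v. v i * g v)"
  shows "P d g"
proof -
  have monomial: "P d (\<lambda>v. c * (\<Prod>i\<le>N. v i ^ \<alpha> i))" if "(\<Sum>i\<le>N. \<alpha> i) = d" for \<alpha> d c
    using that
  proof (induction d arbitrary: \<alpha>)
    case 0
    then show ?case using const[of c] by simp
  next
    case (Suc d)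
    \<comment> \<open>Positive total degree forces a positive exponent, and one copy of that
      coordinate is split off.\<close>
    then obtain i where i: "i \<le> N" "\<alpha> i > 0"
      by (metis atMost_iff finite_atMost neq0_conv sum.neutral zero_less_Suc less_numeral_extra(3))
    let ?\<beta> = "\<alpha>(i := \<alpha> i - 1)"
    have eq: "(\<Sum>k\<le>N. \<alpha> k) = Suc (\<Sum>k\<le>N. ?\<beta> k)"
      using i by (simp add: sum.remove[of "{..N}" i])
    have "(\<Prod>k\<le>N. v k ^ \<alpha> k) = v i * (\<Prod>k\<le>N. v k ^ ?\<beta> k)" for v :: "nat \<Rightarrow> complex"
    proof -
      have "v i ^ \<alpha> i = v i * v i ^ (\<alpha> i - 1)" using i by (simp flip: power_Suc)
      then show ?thesis using i by (simp add: prod.remove[of "{..N}" i])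
    qed
    then have "(\<lambda>v. c * (\<Prod>i\<le>N. v i ^ \<alpha> i)) = (\<lambda>v. v i * (c * (\<Prod>k\<le>N. v k ^ ?\<beta> k)))"
      by (simp add: mult_ac)
    moreover have "(\<Sum>k\<le>N. ?\<beta> k) = d" using eq Suc.prems by simp
    ultimately show ?case
      using coord[OF hom_poly_monomial i(1) Suc.IH] by simp
  qed
  obtain A a where A: "finite A" "\<forall>\<alpha>\<in>A. (\<Sum>i\<le>N. \<alpha> i) = d" "g = (\<lambda>v. \<Sum>\<alpha>\<in>A. a \<alpha> * (\<Prod>i\<le>N. v i ^ \<alpha> i))"
    using assms(1) unfolding hom_poly_def by blast
  have "P d (\<lambda>v. \<Sum>\<alpha>\<in>A. a \<alpha> * (\<Prod>i\<le>N. v i ^ \<alpha> i))"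
    using A(1,2)
  proof (induction A)
    case (insert \<alpha> A)
    then show ?case
      by (simp, intro add monomial hom_poly_sum hom_poly_monomial) auto
  qed (simp add: zero)
  with A(3) show ?thesis by simp
qed

lemma hom_poly_cmult: "hom_poly N d g \<Longrightarrow> hom_poly N d (\<lambda>v. c * g v)"
proof (induction rule: hom_poly_induct)
  case (add d g h)
  then show ?case by (simp add: distrib_left hom_poly_add)
next
  case (coord d g i)
  then show ?case using hom_poly_coord[of N d "\<lambda>v. c * g v" i] by (simp add: mult_ac)
qed (auto intro: hom_poly_const hom_poly_zero)

lemma hom_poly_mult: "hom_poly N d g \<Longrightarrow> hom_poly N e h \<Longrightarrow> hom_poly N (d + e) (\<lambda>v. g v * h v)"
proof (induction rule: hom_poly_induct)
  case (add d g h)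
  then show ?case by (simp add: distrib_right hom_poly_add)
next
  case (coord d g i)
  then show ?case using hom_poly_coord[of N "d + e" "\<lambda>v. g v * h v" i] by (simp add: mult_ac)
qed (auto intro: hom_poly_cmult hom_poly_zero)

lemma hom_poly_var: "i \<le> N \<Longrightarrow> hom_poly N (Suc 0) (\<lambda>v. v i)"
  using hom_poly_coord[OF hom_poly_const, of i N 1] by simp

lemma hom_poly_power: "i \<le> N \<Longrightarrow> hom_poly N d (\<lambda>v. v i ^ d)"
  by (induction d) (auto intro: hom_poly_const hom_poly_coord)

lemma hom_poly_scale: "hom_poly N d g \<Longrightarrow> g (\<lambda>i. c * v i) = c ^ d * g v"
  by (induction rule: hom_poly_induct) (auto simp: algebra_simps)

section \<open>Partial derivatives of homogeneous polynomials\<close>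

definition shift :: "nat \<Rightarrow> (nat \<Rightarrow> complex) \<Rightarrow> complex \<Rightarrow> nat \<Rightarrow> complex" where
  "shift j v t = v(j := v j + t)"

lemma shift_0 [simp]: "shift j v 0 = v"
  by (simp add: shift_def)

text \<open>Differentiating along coordinate lines keeps everything within complex analysis in one
  variable. A relation between functions is used because polynomials carry no syntax here.\<close>

definition has_partial :: "nat \<Rightarrow> ((nat \<Rightarrow> complex) \<Rightarrow> complex) \<Rightarrow> ((nat \<Rightarrow> complex) \<Rightarrow> complex) \<Rightarrow> bool" where
  "has_partial j g g' \<longleftrightarrow> (\<forall>v. ((\<lambda>t. g (shift j v t)) has_field_derivative g' v) (at 0))"

lemma has_partial_const: "has_partial j (\<lambda>_. c) (\<lambda>_. 0)"
  unfolding has_partial_def by simp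

lemma has_partial_add:
  "has_partial j g g' \<Longrightarrow> has_partial j h h' \<Longrightarrow> has_partial j (\<lambda>v. g v + h v) (\<lambda>v. g' v + h' v)"
  unfolding has_partial_def by (intro allI DERIV_add) simp_all

lemma has_partial_coord:
  assumes "has_partial j g g'"
  shows "has_partial j (\<lambda>v. v i * g v) (\<lambda>v. of_bool (i = j) * g v + v i * g' v)"
  unfolding has_partial_def
proof
  fix v :: "nat \<Rightarrow> complex"
  have "((\<lambda>t. shift j v t i) has_field_derivative of_bool (i = j)) (at 0)"
    by (cases "i = j") (auto simp: shift_def intro!: derivative_eq_intros)
  from DERIV_mult[OF this assms[unfolded has_partial_def, rule_format, of v]]
  show "((\<lambda>t. shift j v t i * g (shift j v t)) has_field_derivative
      of_bool (i = j) * g v + v i * g' v) (at 0)"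
    by (rule DERIV_cong) simp
qed

text \<open>The product rule along the construction of the polynomial. Degree 0 has its own clause:
  when a constant is multiplied by a coordinate, the derivative has degree 0 again only because the
  term with \<open>g'\<close> is literally zero.\<close>

lemma hom_poly_partial:
  assumes "hom_poly N d g"
  shows "\<exists>g'. has_partial j g g' \<and> (\<forall>e. d = Suc e \<longrightarrow> hom_poly N e g') \<and> (d = 0 \<longrightarrow> g' = (\<lambda>_. 0))"
  using assms
proof (induction rule: hom_poly_induct)
  case (const c)
  show ?case using has_partial_const[of j c] by (intro exI[of _ "\<lambda>_. 0"]) simp
next
  case (zero d)
  show ?case using has_partial_const[of j 0] hom_poly_zero by (intro exI[of _ "\<lambda>_. 0"]) simp
next
  case (add d g h)
  then obtain g' h' where g': "has_partial j g g'"
    "\<forall>e. d = Suc e \<longrightarrow> hom_poly N e g'" "d = 0 \<longrightarrow> g' = (\<lambda>_. 0)"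
    and h': "has_partial j h h'"
    "\<forall>e. d = Suc e \<longrightarrow> hom_poly N e h'" "d = 0 \<longrightarrow> h' = (\<lambda>_. 0)"
    by metis
  show ?case
    using has_partial_add[OF g'(1) h'(1)] g'(2,3) h'(2,3) hom_poly_add[of N _ g' h']
    by (intro exI[of _ "\<lambda>v. g' v + h' v"]) simp
next
  case (coord d g i)
  then obtain g' where g': "has_partial j g g'"
    "\<forall>e. d = Suc e \<longrightarrow> hom_poly N e g'" "d = 0 \<longrightarrow> g' = (\<lambda>_. 0)"
    by metis
  let ?h = "\<lambda>v. of_bool (i = j) * g v + v i * g' v"
  have "hom_poly N d ?h"
  proof (cases d)
    case 0
    then show ?thesis using g'(3) coord.hyps by (simp add: hom_poly_cmult)
  next
    case (Suc e)
    then show ?thesis using g'(2) coord.hyps by (intro hom_poly_add hom_poly_cmult) (auto intro!: hom_poly_coord)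
  qed
  then show ?case using has_partial_coord[OF g'(1)] by (intro exI[of _ ?h]) simp
qed

section \<open>Points of projective space and a base of the Zariski topology\<close>

definition coords :: "nat \<Rightarrow> (nat \<Rightarrow> complex) \<Rightarrow> bool" where
  "coords N v \<longleftrightarrow> (\<exists>i. v i \<noteq> 0) \<and> (\<forall>i>N. v i = 0)"

lemma hline_self: "v \<in> hline v"
  unfolding hline_def by (intro CollectI exI[of _ 1]) auto

lemma hlineD: "w \<in> hline v \<Longrightarrow> \<exists>c. c \<noteq> 0 \<and> w = (\<lambda>i. c * v i)"
  unfolding hline_def by blast

lemma hline_scale_subset: "c \<noteq> 0 \<Longrightarrow> hline (\<lambda>i. c * v i) \<subseteq> hline v"
proof
  fix w assume c: "c \<noteq> 0" and "w \<in> hline (\<lambda>i. c * v i)"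
  then obtain d where "d \<noteq> 0" "w = (\<lambda>i. d * (c * v i))" by (blast dest: hlineD)
  then show "w \<in> hline v"
    unfolding hline_def using c by (intro CollectI exI[of _ "d * c"]) (auto simp: mult_ac)
qed

lemma hline_scale: assumes c: "c \<noteq> 0" shows "hline (\<lambda>i. c * v i) = hline v"
proof
  have "(\<lambda>i. inverse c * (c * v i)) = v" using c by (simp add: field_simps)
  then show "hline v \<subseteq> hline (\<lambda>i. c * v i)"
    using hline_scale_subset[of "inverse c" "\<lambda>i. c * v i"] c by simp
qed (rule hline_scale_subset[OF c])

lemma proj_points_iff: "p \<in> proj_points N \<longleftrightarrow> (\<exists>v. coords N v \<and> p = hline v)"
  unfolding proj_points_def coords_def by blast

lemma proj_pointsE:
  assumes "p \<in> proj_points N"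
  obtains v where "coords N v" "p = hline v"
  using assms unfolding proj_points_iff by blast

lemma proj_points_rep:
  assumes "p \<in> proj_points N" "w \<in> p"
  shows "coords N w" "p = hline w"
proof -
  obtain v where v: "coords N v" "p = hline v" using assms(1) by (rule proj_pointsE)
  obtain c where c: "c \<noteq> 0" "w = (\<lambda>i. c * v i)" using assms(2) v(2) hlineD by blast
  show "coords N w" using v c by (auto simp: coords_def)
  show "p = hline w" using v c hline_scale by simp
qed

definition nonvanishing :: "nat \<Rightarrow> ((nat \<Rightarrow> complex) \<Rightarrow> complex) \<Rightarrow> (nat \<Rightarrow> complex) set set" where
  "nonvanishing N g = {p \<in> proj_points N. \<forall>v\<in>p. g v \<noteq> 0}"

text \<open>Rescaling a representative multiplies \<open>g\<close> by a power of a nonzero number,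
  so one representative decides.\<close>

lemma hline_nonvanishing:
  assumes g: "hom_poly N d g" and v: "coords N v"
  shows "hline v \<in> nonvanishing N g \<longleftrightarrow> g v \<noteq> 0"
proof
  assume "hline v \<in> nonvanishing N g"
  then show "g v \<noteq> 0" using hline_self[of v] by (simp add: nonvanishing_def)
next
  assume nz: "g v \<noteq> 0"
  have "g w \<noteq> 0" if "w \<in> hline v" for w
    using hlineD[OF that] nz hom_poly_scale[OF g] by auto
  then show "hline v \<in> nonvanishing N g"
    using v unfolding nonvanishing_def proj_points_iff by blast
qed

lemma tsp_proj_space: "tsp (proj_space N) = topology_generated_by {nonvanishing N g | g d. hom_poly N d g}"
  by (simp add: proj_space_def Let_def nonvanishing_def)

lemma reg_proj_space:
  "f \<in> regular N U \<longleftrightarrow> (\<forall>p\<in>U. \<exists>W. zariski_open N W \<and> p \<in> W \<and> W \<subseteq> U \<and>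
     (\<exists>d g h. hom_poly N d g \<and> hom_poly N d h \<and> (\<forall>q\<in>W. \<forall>v\<in>q. h v \<noteq> 0 \<and> f q = g v / h v)))"
  by (simp add: proj_space_def Let_def)

lemma openin_nonvanishing: "hom_poly N d g \<Longrightarrow> zariski_open N (nonvanishing N g)"
  unfolding tsp_proj_space by (intro topology_generated_by_Basis) blast

lemma pts_proj_space [simp]: "pts (proj_space N) = proj_points N"
proof -
  have "nonvanishing N (\<lambda>_. 1) = proj_points N"
    by (auto simp: nonvanishing_def)
  then have "proj_points N \<in> {nonvanishing N g | g d. hom_poly N d g}"
    using hom_poly_const[of N 1] by blast
  then show ?thesis
    unfolding tsp_proj_space topology_generated_by_topspace by (auto simp: nonvanishing_def)
qed

text \<open>Products of homogeneous polynomials make the generating sets closed under intersection,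
  so this subbase is already a base.\<close>

lemma proj_space_basis:
  assumes "zariski_open N W" "p \<in> W"
  shows "\<exists>d g. hom_poly N d g \<and> p \<in> nonvanishing N g \<and> nonvanishing N g \<subseteq> W"
proof -
  have "generate_topology_on {nonvanishing N g | g d. hom_poly N d g} W"
    using assms(1) unfolding tsp_proj_space openin_topology_generated_by_iff .
  then show ?thesis using assms(2)
  proof (induction arbitrary: p)
    case (Int A B)
    from Int.prems Int.IH(1)[of p] obtain d g
      where g: "hom_poly N d g" "p \<in> nonvanishing N g" "nonvanishing N g \<subseteq> A" by blast
    from Int.prems Int.IH(2)[of p] obtain e h
      where h: "hom_poly N e h" "p \<in> nonvanishing N h" "nonvanishing N h \<subseteq> B" by blast
    have "nonvanishing N (\<lambda>v. g v * h v) = nonvanishing N g \<inter> nonvanishing N h"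
      by (auto simp: nonvanishing_def)
    then show ?case using hom_poly_mult[OF g(1) h(1)] g h by blast
  next
    case (UN K)
    then obtain k where k: "k \<in> K" "p \<in> k" by blast
    from UN.IH[OF k] k(1) show ?case by blast
  qed blast+
qed

subsection \<open>Local rings of projective space\<close>

text \<open>The fraction represents \<open>f\<close> wherever \<open>h\<close> does not vanish, not
  merely near \<open>v\<close>: the neighbourhood is absorbed into the denominator.\<close>

definition local_fraction ::
  "nat \<Rightarrow> (nat \<Rightarrow> complex) \<Rightarrow> ((nat \<Rightarrow> complex) set \<Rightarrow> complex) \<Rightarrow> nat \<Rightarrow>
   ((nat \<Rightarrow> complex) \<Rightarrow> complex) \<Rightarrow> ((nat \<Rightarrow> complex) \<Rightarrow> complex) \<Rightarrow> bool" where
  "local_fraction N v f d g h \<longleftrightarrow> hom_poly N d g \<and> hom_poly N d h \<and> h v \<noteq> 0 \<and>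
     (\<forall>w. coords N w \<and> h w \<noteq> 0 \<longrightarrow> f (hline w) = g w / h w)"

lemma reg_local_fraction:
  assumes f: "f \<in> regular N U" and vU: "hline v \<in> U" and v: "coords N v"
  shows "\<exists>d g h. local_fraction N v f d g h"
proof -
  from f[unfolded reg_proj_space, rule_format, OF vU]
  obtain W d g h where W: "zariski_open N W" "hline v \<in> W" "hom_poly N d g" "hom_poly N d h"
    and gh: "\<forall>q\<in>W. \<forall>w\<in>q. h w \<noteq> 0 \<and> f q = g w / h w"
    by blast
  obtain e u where u: "hom_poly N e u" "hline v \<in> nonvanishing N u" "nonvanishing N u \<subseteq> W"
    using proj_space_basis[OF W(1,2)] by blast
  have frac: "h w \<noteq> 0" "f (hline w) = g w / h w" if "coords N w" "u w \<noteq> 0" for w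
  proof -
    have "hline w \<in> W" using that u(3) hline_nonvanishing[OF u(1)] by blast
    then show "h w \<noteq> 0" "f (hline w) = g w / h w" using gh hline_self[of w] by blast+
  qed
  have uv: "u v \<noteq> 0" using u(2) hline_nonvanishing[OF u(1) v] by blast
  \<comment> \<open>Multiplying numerator and denominator by \<open>u\<close> shrinks the locus of
    nonzero denominator into \<open>W\<close>.\<close>
  have "local_fraction N v f (d + e) (\<lambda>w. g w * u w) (\<lambda>w. h w * u w)"
    unfolding local_fraction_def
  proof (intro conjI allI impI hom_poly_mult W u(1))
    show "h v * u v \<noteq> 0" using uv frac(1)[OF v uv] by simp
    fix w assume w: "coords N w \<and> h w * u w \<noteq> 0"
    then show "f (hline w) = g w * u w / (h w * u w)" using frac(2)[of w] by simp
  qed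
  then show ?thesis by blast
qed

lemma local_fraction_reg:
  assumes f: "local_fraction N v f d g h"
  shows "f \<in> regular N (nonvanishing N h)"
  unfolding reg_proj_space
proof
  fix p assume p: "p \<in> nonvanishing N h"
  have hom: "hom_poly N d g" "hom_poly N d h" using f by (simp_all add: local_fraction_def)
  have "h w \<noteq> 0 \<and> f q = g w / h w" if "q \<in> nonvanishing N h" "w \<in> q" for q w
  proof -
    have q: "q \<in> proj_points N" "h w \<noteq> 0" using that by (auto simp: nonvanishing_def)
    then show ?thesis using proj_points_rep[OF q(1) that(2)] f unfolding local_fraction_def by metis
  qed
  then show "\<exists>W. zariski_open N W \<and> p \<in> W \<and> W \<subseteq> nonvanishing N h \<and>
     (\<exists>d g h. hom_poly N d g \<and> hom_poly N d h \<and> (\<forall>q\<in>W. \<forall>v\<in>q. h v \<noteq> 0 \<and> f q = g v / h v))"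
    using p hom openin_nonvanishing[OF hom(2)]
    by (intro exI[of _ "nonvanishing N h"] conjI exI[of _ d] exI[of _ g] exI[of _ h]) auto
qed

lemma near_reg_iff:
  assumes "coords N v"
  shows "f \<in> germs N v \<longleftrightarrow> (\<exists>d g h. local_fraction N v f d g h)"
proof
  assume "f \<in> germs N v"
  then show "\<exists>d g h. local_fraction N v f d g h"
    unfolding near_reg_def using reg_local_fraction[OF _ _ assms] by blast
next
  assume "\<exists>d g h. local_fraction N v f d g h"
  then obtain d g h where f: "local_fraction N v f d g h" by blast
  then have "hline v \<in> nonvanishing N h" "zariski_open N (nonvanishing N h)"
    using assms by (auto simp: local_fraction_def hline_nonvanishing openin_nonvanishing)
  then show "f \<in> germs N v"
    using local_fraction_reg[OF f] unfolding near_reg_def by blast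
qed

lemma local_fraction_mult:
  assumes "local_fraction N v f d g h" "local_fraction N v f' d' g' h'"
  shows "local_fraction N v (\<lambda>p. f p * f' p) (d + d') (\<lambda>w. g w * g' w) (\<lambda>w. h w * h' w)"
  using assms by (auto simp: local_fraction_def hom_poly_mult)

lemma local_fraction_add:
  assumes "local_fraction N v f d g h" "local_fraction N v f' d' g' h'"
  shows "local_fraction N v (\<lambda>p. f p + f' p) (d + d') (\<lambda>w. g w * h' w + h w * g' w) (\<lambda>w. h w * h' w)"
proof -
  have "hom_poly N (d + d') (\<lambda>w. g w * h' w + h w * g' w)" "hom_poly N (d + d') (\<lambda>w. h w * h' w)"
    using assms unfolding local_fraction_def by (auto intro!: hom_poly_mult hom_poly_add)
  then show ?thesis using assms by (auto simp: local_fraction_def add_frac_eq mult_ac)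
qed

lemma local_fraction_cmult:
  assumes "local_fraction N v f d g h"
  shows "local_fraction N v (\<lambda>p. c * f p) d (\<lambda>w. c * g w) h"
  using assms by (auto simp: local_fraction_def intro!: hom_poly_cmult)

lemma near_reg_closed:
  assumes "coords N v" "f \<in> germs N v"
  shows "(\<lambda>p. c * f p) \<in> germs N v"
    and "g \<in> germs N v \<Longrightarrow> (\<lambda>p. f p + g p) \<in> germs N v"
    and "g \<in> germs N v \<Longrightarrow> (\<lambda>p. f p * g p) \<in> germs N v"
  using assms(2) unfolding near_reg_iff[OF assms(1)]
  by (blast intro: local_fraction_mult local_fraction_add local_fraction_cmult)+

subsection \<open>Directional derivatives\<close>

text \<open>The image of the j-th coordinate field at \<open>v\<close> under the projection from the
  punctured cone: functions are pulled back to the cone and differentiated there. It depends on the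
  vector \<open>v\<close> and not just on its line. The default 0 is the one that
  \<open>point_derivation\<close> demands.\<close>

definition dir_deriv :: "nat \<Rightarrow> nat \<Rightarrow> (nat \<Rightarrow> complex) \<Rightarrow> ((nat \<Rightarrow> complex) set \<Rightarrow> complex) \<Rightarrow> complex" where
  "dir_deriv N j v f = (if f \<in> germs N v
     then THE D. ((\<lambda>t. f (hline (shift j v t))) has_field_derivative D) (at 0) else 0)"

lemma has_partial_eventually_nonzero:
  assumes "has_partial j g g'" "g v \<noteq> 0"
  shows "\<forall>\<^sub>F t in nhds 0. g (shift j v t) \<noteq> 0"
proof -
  have "isCont (\<lambda>t. g (shift j v t)) 0"
    using assms(1) unfolding has_partial_def by (blast intro: DERIV_isCont)
  then have "((\<lambda>t. g (shift j v t)) \<longlongrightarrow> g v) (nhds 0)"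
    using tendsto_at_iff_tendsto_nhds[of "\<lambda>t. g (shift j v t)" 0] by (simp add: isCont_def)
  then show ?thesis using assms(2) by (rule tendsto_imp_eventually_ne)
qed

lemma eventually_coords:
  assumes "coords N v" "j \<le> N"
  shows "\<forall>\<^sub>F t in nhds 0. coords N (shift j v t)"
proof -
  obtain i where i: "v i \<noteq> 0" using assms(1) by (auto simp: coords_def)
  have "has_partial j (\<lambda>v. v i * 1) (\<lambda>v. of_bool (i = j) * 1 + v i * 0)"
    by (rule has_partial_coord[OF has_partial_const])
  from has_partial_eventually_nonzero[OF this, of v] i
  have "\<forall>\<^sub>F t in nhds 0. shift j v t i \<noteq> 0" by simp
  then show ?thesis
  proof eventually_elim
    case (elim t)
    moreover have "\<forall>i>N. shift j v t i = 0" using assms by (simp add: shift_def coords_def)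
    ultimately show ?case unfolding coords_def by blast
  qed
qed

text \<open>Polynomials are continuous along a coordinate line, so Zariski neighbourhoods contain
  all nearby points of it. Hence a derivative at 0 depends only on the germ.\<close>

lemma eventually_in_open:
  assumes "coords N v" "j \<le> N" "zariski_open N W" "hline v \<in> W"
  shows "\<forall>\<^sub>F t in nhds 0. hline (shift j v t) \<in> W"
proof -
  obtain d g where g: "hom_poly N d g" "hline v \<in> nonvanishing N g" "nonvanishing N g \<subseteq> W"
    using proj_space_basis[OF assms(3,4)] by blast
  obtain g' where g': "has_partial j g g'" using hom_poly_partial[OF g(1), of j] by blast
  have "g v \<noteq> 0" using g hline_nonvanishing[OF g(1) assms(1)] by simp
  from has_partial_eventually_nonzero[OF g' this] eventually_coords[OF assms(1,2)]
  show ?thesis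
    by eventually_elim (use g hline_nonvanishing[OF g(1)] in auto)
qed

lemma local_fraction_deriv:
  assumes v: "coords N v" "j \<le> N" and f: "local_fraction N v f d g h"
    and g': "has_partial j g g'" and h': "has_partial j h h'"
  shows "((\<lambda>t. f (hline (shift j v t))) has_field_derivative (g' v * h v - g v * h' v) / (h v * h v)) (at 0)"
proof -
  have h0: "h v \<noteq> 0" using f by (simp add: local_fraction_def)
  have "((\<lambda>t. g (shift j v t) / h (shift j v t)) has_field_derivative
      (g' v * h (shift j v 0) - g (shift j v 0) * h' v) / (h (shift j v 0) * h (shift j v 0))) (at 0)"
    using g' h' h0 unfolding has_partial_def by (intro DERIV_divide) simp_all
  then have "((\<lambda>t. g (shift j v t) / h (shift j v t)) has_field_derivative
      (g' v * h v - g v * h' v) / (h v * h v)) (at 0)"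
    by simp
  moreover have "\<forall>\<^sub>F t in nhds 0. f (hline (shift j v t)) = g (shift j v t) / h (shift j v t)"
    using has_partial_eventually_nonzero[OF h' h0] eventually_coords[OF v]
    by eventually_elim (use f in \<open>auto simp: local_fraction_def\<close>)
  ultimately show ?thesis by (subst DERIV_cong_ev[OF refl _ refl])
qed

lemma dir_deriv_fraction:
  assumes v: "coords N v" "j \<le> N" and f: "local_fraction N v f d g h"
    and g': "has_partial j g g'" and h': "has_partial j h h'"
  shows "dir_deriv N j v f = (g' v * h v - g v * h' v) / (h v * h v)"
proof -
  have "f \<in> germs N v" using f near_reg_iff[OF v(1)] by blast
  then show ?thesis
    using the_equality[where P = "\<lambda>D. ((\<lambda>t. f (hline (shift j v t))) has_field_derivative D) (at 0)",
        OF local_fraction_deriv[OF assms] DERIV_unique[OF _ local_fraction_deriv[OF assms]]]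
    by (simp add: dir_deriv_def)
qed

lemma dir_deriv_DERIV:
  assumes v: "coords N v" "j \<le> N" and f: "f \<in> germs N v"
  shows "((\<lambda>t. f (hline (shift j v t))) has_field_derivative dir_deriv N j v f) (at 0)"
proof -
  obtain d g h where f: "local_fraction N v f d g h" using f near_reg_iff[OF v(1)] by blast
  obtain g' where g': "has_partial j g g'"
    using f hom_poly_partial[of N d g j] unfolding local_fraction_def by blast
  obtain h' where h': "has_partial j h h'"
    using f hom_poly_partial[of N d h j] unfolding local_fraction_def by blast
  show ?thesis
    using local_fraction_deriv[OF v f g' h'] dir_deriv_fraction[OF v f g' h'] by simp
qed

text \<open>Every law compares two derivatives at 0 of one function of one variable.\<close>

lemma dir_deriv_point_derivation:
  assumes v: "coords N v" "j \<le> N"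
  shows "point_derivation (proj_space N) (hline v) (dir_deriv N j v)"
  unfolding point_derivation_def
proof (intro conjI allI impI ballI)
  fix f assume "f \<notin> germs N v"
  then show "dir_deriv N j v f = 0" by (simp add: dir_deriv_def)
next
  fix f g assume f: "f \<in> germs N v" and g: "g \<in> germs N v"
  note Df = dir_deriv_DERIV[OF v f] and Dg = dir_deriv_DERIV[OF v g]
  show "dir_deriv N j v (\<lambda>y. f y + g y) = dir_deriv N j v f + dir_deriv N j v g"
    using DERIV_unique[OF dir_deriv_DERIV[OF v near_reg_closed(2)[OF v(1) f g]] DERIV_add[OF Df Dg]] .
  show "dir_deriv N j v (\<lambda>y. f y * g y) = f (hline v) * dir_deriv N j v g + g (hline v) * dir_deriv N j v f"
    using DERIV_unique[OF dir_deriv_DERIV[OF v near_reg_closed(3)[OF v(1) f g]] DERIV_mult[OF Df Dg]]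
    by (simp add: mult.commute add.commute)
  fix U assume U: "zariski_open N U \<and> hline v \<in> U \<and> (\<forall>y\<in>U. f y = g y)"
  have "\<forall>\<^sub>F t in nhds 0. f (hline (shift j v t)) = g (hline (shift j v t))"
    using eventually_in_open[OF v, of U] U by (auto elim: eventually_mono)
  then have "((\<lambda>t. f (hline (shift j v t))) has_field_derivative dir_deriv N j v g) (at 0)"
    using Dg by (subst DERIV_cong_ev[OF refl _ refl])
  then show "dir_deriv N j v f = dir_deriv N j v g" using DERIV_unique[OF Df] by blast
next
  fix c f assume f: "f \<in> germs N v"
  show "dir_deriv N j v (\<lambda>y. c * f y) = c * dir_deriv N j v f"
    using DERIV_unique[OF dir_deriv_DERIV[OF v near_reg_closed(1)[OF v(1) f]] DERIV_cmult[OF dir_deriv_DERIV[OF v f]]] .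
qed

text \<open>Moving from \<open>c v\<close> by \<open>t\<close> gives the same point as moving from
  \<open>v\<close> by \<open>t / c\<close>. The factor \<open>1 / c\<close> is what places the
  coordinate fields in the tangent bundle twisted by -1.\<close>

lemma dir_deriv_scale:
  assumes v: "coords N v" "j \<le> N" and c: "c \<noteq> 0"
  shows "dir_deriv N j (\<lambda>i. c * v i) = (\<lambda>f. inverse c * dir_deriv N j v f)"
proof
  fix f
  have cv: "coords N (\<lambda>i. c * v i)" using v(1) c by (auto simp: coords_def)
  show "dir_deriv N j (\<lambda>i. c * v i) f = inverse c * dir_deriv N j v f"
  proof (cases "f \<in> germs N v")
    case True
    have line: "hline (shift j (\<lambda>i. c * v i) t) = hline (shift j v (inverse c * t))" for t
    proof -
      have "shift j (\<lambda>i. c * v i) t = (\<lambda>i. c * shift j v (inverse c * t) i)"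
        using c by (auto simp: shift_def field_simps)
      then show ?thesis using hline_scale[OF c] by metis
    qed
    have "((\<lambda>t. f (hline (shift j v (inverse c * t)))) has_field_derivative
        dir_deriv N j v f * inverse c) (at 0)"
    proof (rule DERIV_chain2[where f = "\<lambda>t. f (hline (shift j v t))"])
      show "((\<lambda>t. f (hline (shift j v t))) has_field_derivative dir_deriv N j v f) (at (inverse c * 0))"
        using dir_deriv_DERIV[OF v True] by simp
      show "((\<lambda>t. inverse c * t) has_field_derivative inverse c) (at 0)"
        by (rule DERIV_cmult_Id)
    qed
    moreover have "((\<lambda>t. f (hline (shift j v (inverse c * t)))) has_field_derivative
        dir_deriv N j (\<lambda>i. c * v i) f) (at 0)"
      using dir_deriv_DERIV[OF cv v(2), of f] True by (simp add: hline_scale[OF c] line)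
    ultimately show ?thesis using DERIV_unique by (simp add: mult.commute)
  next
    case False
    then show ?thesis by (simp add: dir_deriv_def hline_scale[OF c])
  qed
qed

section \<open>Tangent spaces of projective space\<close>

lemma tangent_space_vectorspace: "vectorspace CC (tangent_space X x)"
  unfolding tangent_space_def
  by (rule fun_vs_vectorspace) (auto simp: point_derivation_def algebra_simps)

lemma tangent_space_simps:
  "\<delta> \<in> carrier (tangent_space X x) \<longleftrightarrow> point_derivation X x \<delta>"
  "\<zero>\<^bsub>tangent_space X x\<^esub> = (\<lambda>_. 0)"
  "\<delta> \<oplus>\<^bsub>tangent_space X x\<^esub> \<epsilon> = (\<lambda>f. \<delta> f + \<epsilon> f)"
  "c \<odot>\<^bsub>tangent_space X x\<^esub> \<delta> = (\<lambda>f. c * \<delta> f)"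
  by (simp_all add: tangent_space_def fun_vs_simps)

lemma tangent_space_finsum:
  assumes "finite A" "F \<in> A \<rightarrow> carrier (tangent_space X x)"
  shows "finsum (tangent_space X x) F A = (\<lambda>f. \<Sum>a\<in>A. F a f)"
  using fun_vs_finsum[OF tangent_space_vectorspace[unfolded tangent_space_def] assms(1)] assms(2)
  by (simp add: tangent_space_def fun_vs_simps)

text \<open>Where coordinate \<open>l\<close> is nonzero, this is the representative whose
  \<open>l\<close>-th coordinate is 1; its entries are the affine coordinates. The choice of
  \<open>w\<close> is immaterial because only ratios remain.\<close>

definition dehom :: "nat \<Rightarrow> (nat \<Rightarrow> complex) set \<Rightarrow> nat \<Rightarrow> complex" where
  "dehom l p = (let w = SOME w. w \<in> p in (\<lambda>i. w i / w l))"

lemma dehom_hline: "dehom l (hline v) = (\<lambda>i. inverse (v l) * v i)"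
proof -
  have "(SOME w. w \<in> hline v) \<in> hline v" by (rule someI[of "\<lambda>w. w \<in> hline v", OF hline_self])
  then obtain c where "c \<noteq> 0" "(SOME w. w \<in> hline v) = (\<lambda>i. c * v i)" using hlineD by blast
  then have "dehom l (hline v) = (\<lambda>i. v i / v l)" by (simp add: dehom_def Let_def)
  then show ?thesis by (simp add: divide_inverse mult.commute)
qed

lemma hom_poly_dehom: "hom_poly N d g \<Longrightarrow> g (dehom l (hline v)) = g v / v l ^ d"
  by (simp only: dehom_hline hom_poly_scale) (simp add: power_inverse divide_inverse)

abbreviation chart :: "nat \<Rightarrow> nat \<Rightarrow> (nat \<Rightarrow> complex) set set" where
  "chart N l \<equiv> nonvanishing N (\<lambda>v. v l)"

lemma chartE:
  assumes "p \<in> chart N l"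
  obtains v where "coords N v" "v l = 1" "p = hline v" "dehom l p = v"
proof -
  from assms obtain w where w: "coords N w" "p = hline w"
    by (auto simp: nonvanishing_def elim: proj_pointsE)
  then have wl: "w l \<noteq> 0" using assms hline_self[of w] by (auto simp: nonvanishing_def)
  let ?v = "\<lambda>i. inverse (w l) * w i"
  show ?thesis
  proof (rule that)
    show "coords N ?v" using w(1) wl unfolding coords_def by simp
    show "?v l = 1" using wl by simp
    show "p = hline ?v" using w wl hline_scale[of "inverse (w l)" w] by simp
    show "dehom l p = ?v" by (simp only: w(2) dehom_hline)
  qed
qed

lemma near_reg_dehom:
  assumes g: "hom_poly N d g" and l: "l \<le> N" and v: "coords N v" "v l \<noteq> 0"
  shows "(\<lambda>p. g (dehom l p)) \<in> germs N v"
proof -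
  have "local_fraction N v (\<lambda>p. g (dehom l p)) d g (\<lambda>w. w l ^ d)"
    unfolding local_fraction_def
  proof (intro conjI allI impI)
    show "g (dehom l (hline w)) = g w / w l ^ d" for w by (rule hom_poly_dehom[OF g])
  qed (use g v hom_poly_power[OF l] in simp_all)
  then show ?thesis using near_reg_iff[OF v(1)] by blast
qed

lemma point_derivationD:
  assumes \<delta>: "point_derivation X x \<delta>" and f: "f \<in> near_reg X x"
  shows "\<delta> (\<lambda>y. c * f y) = c * \<delta> f"
    and "g \<in> near_reg X x \<Longrightarrow> \<delta> (\<lambda>y. f y + g y) = \<delta> f + \<delta> g"
    and "g \<in> near_reg X x \<Longrightarrow> \<delta> (\<lambda>y. f y * g y) = f x * \<delta> g + g x * \<delta> f"
    and "g \<in> near_reg X x \<Longrightarrow> openin (tsp X) U \<Longrightarrow> x \<in> U \<Longrightarrow> (\<And>y. y \<in> U \<Longrightarrow> f y = g y) \<Longrightarrow> \<delta> f = \<delta> g"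
proof -
  note \<delta>' = \<delta>[unfolded point_derivation_def]
  note * = bspec[OF bspec[OF conjunct1[OF conjunct2[OF \<delta>']] f]]
  show "\<delta> (\<lambda>y. c * f y) = c * \<delta> f"
    by (rule bspec[OF spec[OF conjunct2[OF conjunct2[OF \<delta>']], of c] f])
  show "\<delta> (\<lambda>y. f y + g y) = \<delta> f + \<delta> g" if "g \<in> near_reg X x"
    by (rule conjunct1[OF conjunct2[OF *[OF that]]])
  show "\<delta> (\<lambda>y. f y * g y) = f x * \<delta> g + g x * \<delta> f" if "g \<in> near_reg X x"
    by (rule conjunct2[OF conjunct2[OF *[OF that]]])
  show "\<delta> f = \<delta> g" if "g \<in> near_reg X x" "openin (tsp X) U" "x \<in> U" "\<And>y. y \<in> U \<Longrightarrow> f y = g y"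
    by (rule conjunct1[OF *[OF that(1)], rule_format, of U]) (use that in blast)
qed

text \<open>The Leibniz rule for the product of 1 with itself makes the value at 1 equal to its
  double.\<close>

lemma point_derivation_const:
  assumes \<delta>: "point_derivation X x \<delta>" and one: "(\<lambda>_. 1) \<in> near_reg X x"
  shows "\<delta> (\<lambda>_. c) = 0"
  using point_derivationD(3)[OF \<delta> one one] point_derivationD(1)[OF \<delta> one, of c] by simp

text \<open>Agreement on affine coordinates passes to polynomials in them by the Leibniz rule, and
  to a fraction \<open>f = g / h\<close> by applying the rule to \<open>f h = g\<close> and
  cancelling the nonzero value of \<open>h\<close>.\<close>

lemma point_derivation_eqI:
  assumes v: "coords N v" "v l \<noteq> 0" and l: "l \<le> N"
    and d: "point_derivation (proj_space N) (hline v) \<delta>" and e: "point_derivation (proj_space N) (hline v) \<epsilon>"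
    and eq: "\<And>i. i \<le> N \<Longrightarrow> \<delta> (\<lambda>p. dehom l p i) = \<epsilon> (\<lambda>p. dehom l p i)"
  shows "\<delta> = \<epsilon>"
proof
  let ?R = "germs N v"
  note near = near_reg_dehom[OF _ l v]
  have one: "(\<lambda>_. 1) \<in> ?R" using near[OF hom_poly_const[of N 1]] by simp
  have poly: "\<delta> (\<lambda>p. g (dehom l p)) = \<epsilon> (\<lambda>p. g (dehom l p))" if "hom_poly N d g" for d g
    using that
  proof (induction rule: hom_poly_induct)
    case (add d g h)
    have *: "\<delta>' (\<lambda>p. g (dehom l p) + h (dehom l p)) =
        \<delta>' (\<lambda>p. g (dehom l p)) + \<delta>' (\<lambda>p. h (dehom l p))"
      if "point_derivation (proj_space N) (hline v) \<delta>'" for \<delta>'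
      by (rule point_derivationD(2)[OF that near[OF add(1)] near[OF add(2)]])
    show ?case by (simp only: *[OF d] *[OF e] add.IH)
  next
    case (coord d g i)
    have *: "\<delta>' (\<lambda>p. dehom l p i * g (dehom l p)) =
        dehom l (hline v) i * \<delta>' (\<lambda>p. g (dehom l p)) + g (dehom l (hline v)) * \<delta>' (\<lambda>p. dehom l p i)"
      if "point_derivation (proj_space N) (hline v) \<delta>'" for \<delta>'
      by (rule point_derivationD(3)[OF that near[OF hom_poly_var[OF coord(2)]] near[OF coord(1)]])
    show ?case by (simp only: *[OF d] *[OF e] coord.IH eq[OF coord(2)])
  qed (use point_derivation_const[OF d one] point_derivation_const[OF e one] in auto)
  fix f
  show "\<delta> f = \<epsilon> f"
  proof (cases "f \<in> ?R")
    case False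
    then show ?thesis using d e unfolding point_derivation_def by simp
  next
    case True
    then obtain m g h where f: "local_fraction N v f m g h" using near_reg_iff[OF v(1)] by blast
    then have g: "hom_poly N m g" and h: "hom_poly N m h" and hv: "h v \<noteq> 0"
      by (auto simp: local_fraction_def)
    let ?h = "\<lambda>p. h (dehom l p)" and ?g = "\<lambda>p. g (dehom l p)"
    \<comment> \<open>The extra factor \<open>w l\<close> cuts down to the locus where both the
      fraction for \<open>f\<close> and the affine coordinates make sense.\<close>
    let ?u = "\<lambda>w. h w * w l"
    have u: "hom_poly N (m + Suc 0) ?u" using hom_poly_mult[OF h hom_poly_var[OF l]] .
    have hn: "?h (hline v) \<noteq> 0"
      using v hv by (simp add: hom_poly_dehom[OF h])
    have germ: "f p * ?h p = ?g p" if "p \<in> nonvanishing N ?u" for p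
    proof -
      from that obtain w where w: "coords N w" "p = hline w"
        by (auto simp: nonvanishing_def elim: proj_pointsE)
      then have "h w * w l \<noteq> 0" using that hline_nonvanishing[OF u] by auto
      then have "f p = g w / h w" "h w \<noteq> 0" using f w unfolding local_fraction_def by auto
      then show ?thesis by (simp add: w(2) hom_poly_dehom[OF h] hom_poly_dehom[OF g])
    qed
    have "f (hline v) * \<delta>' ?h + ?h (hline v) * \<delta>' f = \<delta>' ?g"
      if \<delta>': "point_derivation (proj_space N) (hline v) \<delta>'" for \<delta>'
    proof -
      have "\<delta>' (\<lambda>p. f p * ?h p) = \<delta>' ?g"
        by (rule point_derivationD(4)[OF \<delta>' near_reg_closed(3)[OF v(1) True near[OF h]] near[OF g]
              openin_nonvanishing[OF u] _ germ])
          (use hline_nonvanishing[OF u v(1)] hv v in simp_all)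
      then show ?thesis using point_derivationD(3)[OF \<delta>' True near[OF h]] by simp
    qed
    from this[OF d] this[OF e] have "?h (hline v) * \<delta> f = ?h (hline v) * \<epsilon> f"
      using poly[OF h] poly[OF g] by (metis add_left_cancel)
    then show ?thesis using hn by simp
  qed
qed

lemma dir_deriv_dehom:
  assumes v: "coords N v" "v l = 1" and "l \<le> N" "i \<le> N" "j \<le> N" "j \<noteq> l"
  shows "dir_deriv N j v (\<lambda>p. dehom l p i) = of_bool (i = j)"
proof -
  \<comment> \<open>The factors 1 match the shape of \<open>has_partial_coord\<close>.\<close>
  have f: "local_fraction N v (\<lambda>p. dehom l p i) (Suc 0) (\<lambda>w. w i * 1) (\<lambda>w. w l * 1)"
    using assms unfolding local_fraction_def dehom_hline by (auto intro!: hom_poly_var simp: divide_inverse)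
  show ?thesis
    using dir_deriv_fraction[OF v(1) \<open>j \<le> N\<close> f has_partial_coord has_partial_coord,
        OF has_partial_const has_partial_const] assms
    by auto
qed

text \<open>The fields with index other than \<open>l\<close> are dual to the affine coordinates, so
  a derivation is recovered from its values on these. The spanning family nevertheless includes
  index \<open>l\<close>, so that one index set serves all charts.\<close>

lemma proj_space_tangent_basis:
  assumes v: "coords N v" "v l = 1" and l: "l \<le> N"
  shows "vectorspace.fin_dim CC (tangent_space (proj_space N) (hline v))"
    and "vectorspace.dim CC (tangent_space (proj_space N) (hline v)) = N"
    and "linear_span (tangent_space (proj_space N) (hline v)) ((\<lambda>j. dir_deriv N j v) ` {..N})
      = carrier (tangent_space (proj_space N) (hline v))"
proof -
  let ?T = "tangent_space (proj_space N) (hline v)"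
  let ?D = "\<lambda>j. dir_deriv N j v" and ?J = "{..N} - {l}"
  let ?y = "\<lambda>i p. dehom l p i"
  interpret T: vectorspace CC ?T by (rule tangent_space_vectorspace)
  have Dy: "?D j (?y i) = of_bool (i = j)" if "j \<in> ?J" "i \<le> N" for i j
    using dir_deriv_dehom[OF v l] that by auto
  have inj: "inj_on ?D ?J"
  proof (rule inj_onI)
    fix j k assume "j \<in> ?J" "k \<in> ?J" "?D j = ?D k"
    then show "j = k" using Dy[of j j] Dy[of k j] by (auto split: if_splits)
  qed
  have carr: "?D ` {..N} \<subseteq> carrier ?T"
    using dir_deriv_point_derivation[OF v(1)] by (auto simp: tangent_space_simps)
  then have carrJ: "?D ` ?J \<subseteq> carrier ?T" by blast
  have lc: "T.lincomb a (?D ` ?J) = (\<lambda>f. \<Sum>j\<in>?J. a (?D j) * ?D j f)" for a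
  proof -
    have "T.lincomb a (?D ` ?J) = (\<lambda>f. \<Sum>\<delta>\<in>?D ` ?J. (a \<delta> \<odot>\<^bsub>?T\<^esub> \<delta>) f)"
      unfolding T.lincomb_def
      by (rule tangent_space_finsum) (use carrJ in \<open>auto intro!: T.smult_closed\<close>)
    also have "\<dots> = (\<lambda>f. \<Sum>j\<in>?J. a (?D j) * ?D j f)"
      by (simp add: tangent_space_simps sum.reindex[OF inj])
    finally show ?thesis .
  qed
  have lcy: "T.lincomb a (?D ` ?J) (?y i) = a (?D i)" if "i \<in> ?J" for a i
  proof -
    have "T.lincomb a (?D ` ?J) (?y i) = (\<Sum>j\<in>?J. a (?D j) * of_bool (i = j))"
      unfolding lc using Dy that by (intro sum.cong) auto
    also have "\<dots> = a (?D i)" using that by (subst sum.remove[of _ i]) auto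
    finally show ?thesis .
  qed
  have indpt: "T.lin_indpt (?D ` ?J)"
  proof (rule T.finite_lin_indpt2)
    fix a assume "T.lincomb a (?D ` ?J) = \<zero>\<^bsub>?T\<^esub>"
    then have "a (?D i) = 0" if "i \<in> ?J" for i
      using lcy[OF that, of a] by (simp add: tangent_space_simps)
    then show "\<forall>\<delta>\<in>?D ` ?J. a \<delta> = \<zero>\<^bsub>CC\<^esub>" by auto
  qed (use carrJ in auto)
  have span: "T.span (?D ` ?J) = carrier ?T"
  proof
    show "T.span (?D ` ?J) \<subseteq> carrier ?T" by (rule T.span_is_subset2[OF carrJ])
    show "carrier ?T \<subseteq> T.span (?D ` ?J)"
    proof
      fix \<delta> assume \<delta>: "\<delta> \<in> carrier ?T"
      \<comment> \<open>The coefficient of a field is the value of \<delta> on the affine coordinate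
        of the same index. Linear combinations are indexed by vectors, whence the inverse of
        \<open>?D\<close>.\<close>
      let ?a = "\<lambda>\<epsilon>. \<delta> (?y (the_inv_into ?J ?D \<epsilon>))"
      let ?\<epsilon> = "T.lincomb ?a (?D ` ?J)"
      have inv: "?a (?D i) = \<delta> (?y i)" if "i \<in> ?J" for i
        using the_inv_into_f_f[OF inj that] by simp
      have span: "?\<epsilon> \<in> T.span (?D ` ?J)" unfolding T.span_def by (intro CollectI exI conjI) auto
      then have \<epsilon>: "?\<epsilon> \<in> carrier ?T" using T.span_is_subset2[OF carrJ] by blast
      have "(\<lambda>_. 1) \<in> germs N v"
        using near_reg_dehom[OF hom_poly_const[of N 1] l v(1)] v(2) by simp
      note const = point_derivation_const[OF _ this]
      \<comment> \<open>The \<open>l\<close>-th affine coordinate is constantly 1 on the chart, so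
        every derivation annihilates it.\<close>
      have "\<delta>' (?y l) = 0" if "point_derivation (proj_space N) (hline v) \<delta>'" for \<delta>'
      proof -
        have "\<delta>' (?y l) = \<delta>' (\<lambda>_. 1)"
        proof (rule point_derivationD(4)[OF that])
          show "?y l \<in> germs N v"
            using near_reg_dehom[OF hom_poly_var[OF l] l v(1)] v(2) by simp
          show "(\<lambda>_. 1) \<in> germs N v" by fact
          show "zariski_open N (chart N l)" by (rule openin_nonvanishing[OF hom_poly_var[OF l]])
          show "hline v \<in> chart N l" using hline_nonvanishing[OF hom_poly_var[OF l] v(1)] v(2) by simp
          show "dehom l p l = 1" if "p \<in> chart N l" for p using that by (metis chartE)
        qed
        then show ?thesis using const[OF that] by simp
      qed
      note yl = this
      have "\<delta> (?y i) = ?\<epsilon> (?y i)" if "i \<le> N" for i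
      proof (cases "i = l")
        case True
        then show ?thesis using yl[of \<delta>] yl[of ?\<epsilon>] \<delta> \<epsilon> by (simp add: tangent_space_simps)
      next
        case False
        then show ?thesis using lcy[of i ?a] inv[of i] that by simp
      qed
      then have "\<delta> = ?\<epsilon>"
        using \<delta> \<epsilon> v by (intro point_derivation_eqI[OF v(1) _ l]) (auto simp: tangent_space_simps)
      then show "\<delta> \<in> T.span (?D ` ?J)" using span by simp
    qed
  qed
  have "T.basis (?D ` ?J)" using indpt span carrJ unfolding T.basis_def by blast
  from T.dim_basis[OF _ this] show "T.dim = N" using card_image[OF inj] l by simp
  show "T.fin_dim" unfolding T.fin_dim_def using span carrJ by (intro exI[of _ "?D ` ?J"]) auto
  have "T.span (?D ` ?J) \<subseteq> T.span (?D ` {..N})" by (rule T.span_is_monotone) auto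
  then show "T.span (?D ` {..N}) = carrier ?T"
    using span T.span_is_subset2[OF carr] by auto
qed

section \<open>Coordinate fields on the standard charts\<close>

lemma reg_proj_space_restrict:
  assumes "f \<in> regular N U" "zariski_open N V" "V \<subseteq> U"
  shows "f \<in> regular N V"
  unfolding reg_proj_space
proof
  fix p assume p: "p \<in> V"
  then obtain W d g h where W: "zariski_open N W" "p \<in> W" "hom_poly N d g" "hom_poly N d h"
    "\<forall>q\<in>W. \<forall>v\<in>q. h v \<noteq> 0 \<and> f q = g v / h v"
    using assms(1)[unfolded reg_proj_space, rule_format, of p] assms(3) by blast
  then show "\<exists>W. zariski_open N W \<and> p \<in> W \<and> W \<subseteq> V \<and>
     (\<exists>d g h. hom_poly N d g \<and> hom_poly N d h \<and> (\<forall>q\<in>W. \<forall>v\<in>q. h v \<noteq> 0 \<and> f q = g v / h v))"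
    using p assms(2) by (intro exI[of _ "W \<inter> V"] conjI exI[of _ d] exI[of _ g] exI[of _ h]) auto
qed

lemma reg_proj_space_cong:
  assumes "f \<in> regular N U" "\<And>p. p \<in> U \<Longrightarrow> f p = g p"
  shows "g \<in> regular N U"
  unfolding reg_proj_space
proof
  fix p assume p: "p \<in> U"
  then obtain W d a h where W: "zariski_open N W" "p \<in> W" "W \<subseteq> U" "hom_poly N d a" "hom_poly N d h"
    "\<forall>q\<in>W. \<forall>v\<in>q. h v \<noteq> 0 \<and> f q = a v / h v"
    using assms(1)[unfolded reg_proj_space, rule_format, of p] by blast
  moreover from this have "\<forall>q\<in>W. \<forall>v\<in>q. h v \<noteq> 0 \<and> g q = a v / h v"
    using assms(2) by (metis subsetD)
  ultimately show "\<exists>W. zariski_open N W \<and> p \<in> W \<and> W \<subseteq> U \<and>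
     (\<exists>d a h. hom_poly N d a \<and> hom_poly N d h \<and> (\<forall>q\<in>W. \<forall>v\<in>q. h v \<noteq> 0 \<and> g q = a v / h v))"
    by blast
qed

lemma chart_field_regular:
  assumes l: "l \<le> N" and j: "j \<le> N" and W: "zariski_open N W" "W \<subseteq> chart N l"
    and f: "f \<in> regular N W"
  shows "(\<lambda>p. dir_deriv N j (dehom l p) f) \<in> regular N W"
  unfolding reg_proj_space
proof
  fix p assume p: "p \<in> W"
  have "p \<in> chart N l" using W(2) p by blast
  then obtain v where v: "coords N v" "v l = 1" "p = hline v" by (rule chartE)
  obtain d g h where gh: "local_fraction N v f d g h"
    using reg_local_fraction[OF f _ v(1)] p v(3) by blast
  then have hom: "hom_poly N d g" "hom_poly N d h" by (simp_all add: local_fraction_def)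
  let ?g = "\<lambda>w. w l * g w" and ?h = "\<lambda>w. w l * h w"
  have hom': "hom_poly N (Suc d) ?g" "hom_poly N (Suc d) ?h"
    using hom_poly_coord[OF hom(1) l] hom_poly_coord[OF hom(2) l] .
  \<comment> \<open>The factor \<open>w l\<close> makes the degree positive, so that the partial derivatives have degree exactly \<open>d\<close>.\<close>
  have frac: "local_fraction N w f (Suc d) ?g ?h" if "w l \<noteq> 0" "h w \<noteq> 0" for w
    using gh hom' that unfolding local_fraction_def by auto
  obtain g' where g': "has_partial j ?g g'" "hom_poly N d g'"
    using hom_poly_partial[OF hom'(1), of j] by blast
  obtain h' where h': "has_partial j ?h h'" "hom_poly N d h'"
    using hom_poly_partial[OF hom'(2), of j] by blast
  \<comment> \<open>The quotient rule at \<open>w\<close> gives degree \<open>2 d + 1\<close> over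
    degree \<open>2 d + 2\<close>. The leading \<open>w l\<close>, which arises on passing from
    \<open>w\<close> to the representative with \<open>l\<close>-th coordinate 1, balances the
    degrees.\<close>
  let ?a = "\<lambda>w. w l * (g' w * ?h w + (- 1) * (?g w * h' w))" and ?b = "\<lambda>w. ?h w * ?h w"
  have "hom_poly N (d + Suc d) (\<lambda>w. g' w * ?h w)" "hom_poly N (Suc d + d) (\<lambda>w. ?g w * h' w)"
    by (intro hom_poly_mult g' h' hom')+
  then have "hom_poly N (Suc d + d) (\<lambda>w. g' w * ?h w + (- 1) * (?g w * h' w))"
    by (intro hom_poly_add hom_poly_cmult) (simp_all add: add.commute)
  from hom_poly_coord[OF this l] have a: "hom_poly N (Suc d + Suc d) ?a" by simp
  have b: "hom_poly N (Suc d + Suc d) ?b" by (intro hom_poly_mult hom')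
  let ?U = "W \<inter> nonvanishing N ?h"
  have "h v \<noteq> 0" using gh by (simp add: local_fraction_def)
  then have "p \<in> nonvanishing N ?h" using hline_nonvanishing[OF hom'(2) v(1)] v by simp
  then have U: "zariski_open N ?U" "p \<in> ?U" "?U \<subseteq> W"
    using openin_Int[OF W(1) openin_nonvanishing[OF hom'(2)]] p by blast+
  have val: "?b w \<noteq> 0 \<and> dir_deriv N j (dehom l q) f = ?a w / ?b w" if q: "q \<in> ?U" "w \<in> q" for q w
  proof -
    have q': "q \<in> proj_points N" "w l * h w \<noteq> 0" using q by (auto simp: nonvanishing_def)
    then have w: "coords N w" "q = hline w" "w l \<noteq> 0" "h w \<noteq> 0"
      using proj_points_rep[OF q'(1) q(2)] by simp_all
    have "dir_deriv N j (dehom l q) f = w l * dir_deriv N j w f"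
      using dir_deriv_scale[OF w(1) j, of "inverse (w l)"] w by (simp add: dehom_hline)
    also have "dir_deriv N j w f = (g' w * ?h w - ?g w * h' w) / ?b w"
      by (rule dir_deriv_fraction[OF w(1) j frac[OF w(3,4)] g'(1) h'(1)])
    finally show ?thesis using w by simp
  qed
  show "\<exists>W'. zariski_open N W' \<and> p \<in> W' \<and> W' \<subseteq> W \<and>
     (\<exists>d a b. hom_poly N d a \<and> hom_poly N d b \<and>
       (\<forall>q\<in>W'. \<forall>w\<in>q. b w \<noteq> 0 \<and> dir_deriv N j (dehom l q) f = a w / b w))"
    by (intro exI[of _ ?U] conjI exI[of _ "Suc d + Suc d"] exI[of _ ?a] exI[of _ ?b] ballI U a b val)
qed

lemma chart_field_section:
  assumes l: "l \<le> N" and j: "j \<le> N"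
  shows "(\<lambda>p\<in>chart N l. dir_deriv N j (dehom l p)) \<in> sect (tangent_bundle (proj_space N)) (chart N l)"
proof -
  have "dir_deriv N j (dehom l p) \<in> carrier (tangent_space (proj_space N) p)" if "p \<in> chart N l" for p
    using that
  proof (rule chartE)
    fix v assume "coords N v" "p = hline v" "dehom l p = v"
    then show ?thesis using dir_deriv_point_derivation[of N v j] j by (simp add: tangent_space_simps)
  qed
  moreover have "(\<lambda>p. (\<lambda>p\<in>chart N l. dir_deriv N j (dehom l p)) p f) \<in> regular N W"
    if "zariski_open N W" "W \<subseteq> chart N l" "f \<in> regular N W" for W f
    by (rule reg_proj_space_cong[OF chart_field_regular[OF l j that]]) (use that in auto)
  ultimately show ?thesis by (simp add: tangent_bundle_def)
qed

text \<open>The representative normalised at \<open>l'\<close> is the one normalised at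
  \<open>l\<close> divided by its \<open>l'\<close>-th coordinate; a field of degree -1 picks up
  that coordinate as a factor.\<close>

lemma chart_field_change:
  assumes "p \<in> chart N l" "p \<in> chart N l'" "j \<le> N"
  shows "dir_deriv N j (dehom l' p) = (\<lambda>f. dehom l p l' * dir_deriv N j (dehom l p) f)"
    and "dehom l p l' \<noteq> 0"
proof -
  from assms(1) obtain v where v: "coords N v" "v l = 1" "p = hline v" "dehom l p = v" by (rule chartE)
  have "v l' \<noteq> 0" using assms(2) v hline_self[of v] by (auto simp: nonvanishing_def)
  then show "dehom l p l' \<noteq> 0" "dir_deriv N j (dehom l' p) = (\<lambda>f. dehom l p l' * dir_deriv N j (dehom l p) f)"
    using dir_deriv_scale[OF v(1) assms(3), of "inverse (v l')"] v by (simp_all add: dehom_hline)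
qed

section \<open>Projective varieties\<close>

locale embedded_variety =
  fixes X :: "'x fspace" and N :: nat and \<iota> :: "'x \<Rightarrow> (nat \<Rightarrow> complex) set"
  assumes sheaf: "sheaf_of_functions X" and irreducible: "irreducible_in (tsp X) (pts X)"
    and embedding: "closed_embedding X (proj_space N) \<iota>"
begin

abbreviation "Z \<equiv> subvariety (proj_space N) (\<iota> ` pts X)"
abbreviation "T \<equiv> restricted_tangent_bundle X (proj_space N) \<iota>"
abbreviation "NX \<equiv> normal_bundle X (proj_space N) \<iota>"
abbreviation "tangent_map \<equiv> differential X (proj_space N) \<iota>"
abbreviation "ambient_tangent x \<equiv> tangent_space (proj_space N) (\<iota> x)"

section \<open>Topology and regular functions induced by the embedding\<close>

lemma morphism: "fmorphism X Z \<iota>"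
  using embedding by (simp add: closed_embedding_def fisomorphism_def)

lemma inverse_morphism:
  obtains \<psi> where "fmorphism Z X \<psi>" "\<And>x. x \<in> pts X \<Longrightarrow> \<psi> (\<iota> x) = x"
  using embedding unfolding closed_embedding_def fisomorphism_def by blast

lemma openin_Z: "openin (tsp Z) V \<longleftrightarrow> (\<exists>W. zariski_open N W \<and> V = W \<inter> \<iota> ` pts X)"
  by (simp add: subvariety_def openin_subtopology)

lemma iota_points: "x \<in> pts X \<Longrightarrow> \<iota> x \<in> proj_points N"
  using embedding closedin_subset unfolding closed_embedding_def by fastforce

lemma pts_Z: "pts Z = \<iota> ` pts X"
  using iota_points by (auto simp: subvariety_def)

lemma openin_preimage:
  assumes "zariski_open N W"
  shows "openin (tsp X) {x \<in> pts X. \<iota> x \<in> W}"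
proof -
  have "continuous_map (tsp X) (tsp Z) \<iota>" using morphism by (simp add: fmorphism_def)
  then have "openin (tsp X) {x \<in> pts X. \<iota> x \<in> W \<inter> \<iota> ` pts X}"
    by (rule openin_continuous_map_preimage) (use assms openin_Z in blast)
  moreover have "{x \<in> pts X. \<iota> x \<in> W \<inter> \<iota> ` pts X} = {x \<in> pts X. \<iota> x \<in> W}" by auto
  ultimately show ?thesis by simp
qed

text \<open>Continuity of the inverse morphism on the image makes open sets of X traces of ambient
  open sets.\<close>

lemma openin_induced:
  assumes U: "openin (tsp X) U"
  shows "\<exists>W. zariski_open N W \<and> U = {x \<in> pts X. \<iota> x \<in> W}"
proof -
  obtain \<psi> where \<psi>: "fmorphism Z X \<psi>" "\<And>x. x \<in> pts X \<Longrightarrow> \<psi> (\<iota> x) = x"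
    using inverse_morphism by blast
  have "continuous_map (tsp Z) (tsp X) \<psi>" using \<psi>(1) by (simp add: fmorphism_def)
  then have "openin (tsp Z) {z \<in> pts Z. \<psi> z \<in> U}" using U by (rule openin_continuous_map_preimage)
  then obtain W where W: "zariski_open N W" "{z \<in> pts Z. \<psi> z \<in> U} = W \<inter> \<iota> ` pts X"
    using openin_Z by blast
  have "U \<subseteq> pts X" using U by (rule openin_subset)
  have "x \<in> U \<longleftrightarrow> \<iota> x \<in> W" if "x \<in> pts X" for x
  proof -
    have "\<iota> x \<in> {z \<in> pts Z. \<psi> z \<in> U} \<longleftrightarrow> x \<in> U" using that \<psi>(2) by (simp add: pts_Z)
    then show ?thesis unfolding W(2) using that by blast
  qed
  then show ?thesis using W(1) \<open>U \<subseteq> pts X\<close> by blast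
qed

lemma regI:
  assumes "openin (tsp X) U"
    "\<And>x. x \<in> U \<Longrightarrow> \<exists>V. openin (tsp X) V \<and> x \<in> V \<and> V \<subseteq> U \<and> (\<exists>g\<in>reg X V. \<forall>y\<in>V. f y = g y)"
  shows "f \<in> reg X U"
proof -
  note s = sheaf[unfolded sheaf_of_functions_def, THEN spec, THEN mp, OF assms(1)]
  show ?thesis
    by (rule conjunct2[OF conjunct2[OF s], THEN spec, THEN iffD2]) (use assms(2) in blast)
qed

lemma reg_pullback:
  assumes "zariski_open N W" "F \<in> regular N W"
  shows "(\<lambda>x. F (\<iota> x)) \<in> reg X {x \<in> pts X. \<iota> x \<in> W}"
proof -
  have "openin (tsp Z) (W \<inter> \<iota> ` pts X)" using assms(1) openin_Z by blast
  moreover have "F \<in> reg Z (W \<inter> \<iota> ` pts X)"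
    using assms by (auto simp: subvariety_def)
  ultimately have "(\<lambda>x. F (\<iota> x)) \<in> reg X {x \<in> pts X. \<iota> x \<in> W \<inter> \<iota> ` pts X}"
    using morphism unfolding fmorphism_def by blast
  moreover have "{x \<in> pts X. \<iota> x \<in> W \<inter> \<iota> ` pts X} = {x \<in> pts X. \<iota> x \<in> W}" by auto
  ultimately show ?thesis by simp
qed

text \<open>The inverse morphism carries \<open>f\<close> to a regular function on the image, and
  such functions extend locally by the definition of \<open>subvariety\<close>.\<close>

lemma reg_extend:
  assumes U: "openin (tsp X) U" and f: "f \<in> reg X U" and x: "x \<in> U"
  shows "\<exists>W F. zariski_open N W \<and> \<iota> x \<in> W \<and> F \<in> regular N W \<and>
    (\<forall>y\<in>U. \<iota> y \<in> W \<longrightarrow> f y = F (\<iota> y))"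
proof -
  obtain \<psi> where \<psi>: "fmorphism Z X \<psi>" "\<And>x. x \<in> pts X \<Longrightarrow> \<psi> (\<iota> x) = x"
    using inverse_morphism by blast
  let ?V = "{z \<in> pts Z. \<psi> z \<in> U}"
  have "(\<lambda>z. f (\<psi> z)) \<in> reg Z ?V" using \<psi>(1) U f unfolding fmorphism_def by blast
  then have *: "\<forall>y\<in>?V. \<exists>W. zariski_open N W \<and> y \<in> W \<and>
      (\<exists>F\<in>regular N W. \<forall>z\<in>W \<inter> ?V. f (\<psi> z) = F z)"
    by (simp add: subvariety_def)
  have UX: "U \<subseteq> pts X" using U by (rule openin_subset)
  have V: "\<iota> y \<in> ?V" if "y \<in> U" for y using that UX \<psi>(2) by (auto simp: pts_Z)
  obtain W F where W: "zariski_open N W" "\<iota> x \<in> W" "F \<in> regular N W"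
    and F: "\<forall>z\<in>W \<inter> ?V. f (\<psi> z) = F z"
    using *[rule_format, OF V[OF x]] by blast
  have "f y = F (\<iota> y)" if "y \<in> U" "\<iota> y \<in> W" for y
    using F[rule_format, of "\<iota> y"] that V[OF that(1)] \<psi>(2)[of y] UX by auto
  then show ?thesis using W by blast
qed

text \<open>
  The fraction is only required to be valid at the points of \<open>U\<close> where its denominator does not
  vanish, so that no auxiliary open set occurs and the condition passes to subsets of \<open>U\<close>.
\<close>

definition fraction_on :: "'x set \<Rightarrow> ('x \<Rightarrow> complex) \<Rightarrow> nat \<Rightarrow>
    ((nat \<Rightarrow> complex) \<Rightarrow> complex) \<Rightarrow> ((nat \<Rightarrow> complex) \<Rightarrow> complex) \<Rightarrow> bool" where
  "fraction_on U f d g h \<longleftrightarrow> hom_poly N d g \<and> hom_poly N d h \<and>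
     (\<forall>y\<in>U. \<forall>w\<in>\<iota> y. h w \<noteq> 0 \<longrightarrow> f y = g w / h w)"

text \<open>Regular functions on X are locally quotients of ambient homogeneous polynomials. The
  properties missing from \<open>sheaf_of_functions\<close>, such as restriction and inversion, are
  all derived from this form.\<close>

lemma reg_iff:
  assumes U: "openin (tsp X) U"
  shows "f \<in> reg X U \<longleftrightarrow> (\<forall>x\<in>U. \<exists>d g h. fraction_on U f d g h \<and> \<iota> x \<in> nonvanishing N h)"
proof
  assume f: "f \<in> reg X U"
  show "\<forall>x\<in>U. \<exists>d g h. fraction_on U f d g h \<and> \<iota> x \<in> nonvanishing N h"
  proof
    fix x assume x: "x \<in> U"
    then have xX: "x \<in> pts X" using openin_subset[OF U] by blast
    obtain W F where W: "zariski_open N W" "\<iota> x \<in> W" "F \<in> regular N W"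
      and F: "\<forall>y\<in>U. \<iota> y \<in> W \<longrightarrow> f y = F (\<iota> y)"
      using reg_extend[OF U f x] by blast
    obtain v where v: "coords N v" "\<iota> x = hline v" using iota_points[OF xX] by (rule proj_pointsE)
    obtain d g h where gh: "local_fraction N v F d g h"
      using reg_local_fraction[OF W(3) _ v(1)] W(2) v(2) by auto
    obtain e u where u: "hom_poly N e u" "hline v \<in> nonvanishing N u" "nonvanishing N u \<subseteq> W"
      using proj_space_basis[OF W(1)] W(2) v(2) by metis
    \<comment> \<open>The factor \<open>u\<close> confines the points with nonzero denominator to
      \<open>W\<close>, where \<open>f\<close> agrees with \<open>F\<close>.\<close>
    have hom: "hom_poly N (d + e) (\<lambda>w. g w * u w)" "hom_poly N (d + e) (\<lambda>w. h w * u w)"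
      using gh hom_poly_mult u(1) unfolding local_fraction_def by blast+
    have "f y = g w * u w / (h w * u w)" if y: "y \<in> U" "w \<in> \<iota> y" "h w * u w \<noteq> 0" for y w
    proof -
      have "\<iota> y \<in> proj_points N" using iota_points openin_subset[OF U] y(1) by blast
      then have w: "coords N w" "\<iota> y = hline w" using proj_points_rep y(2) by auto
      have "\<iota> y \<in> W" using u(3) hline_nonvanishing[OF u(1) w(1)] w(2) y(3) by auto
      then have "f y = F (hline w)" using F y(1) w(2) by simp
      also have "\<dots> = g w / h w" using gh w(1) y(3) unfolding local_fraction_def by simp
      finally show ?thesis using y(3) by simp
    qed
    moreover have "\<iota> x \<in> nonvanishing N (\<lambda>w. h w * u w)"
      using v hline_nonvanishing[OF hom(2) v(1)] gh hline_nonvanishing[OF u(1) v(1)] u(2)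
      by (simp add: local_fraction_def)
    ultimately show "\<exists>d g h. fraction_on U f d g h \<and> \<iota> x \<in> nonvanishing N h"
      using hom unfolding fraction_on_def by blast
  qed
next
  assume *: "\<forall>x\<in>U. \<exists>d g h. fraction_on U f d g h \<and> \<iota> x \<in> nonvanishing N h"
  show "f \<in> reg X U"
  proof (rule regI[OF U])
    fix x assume x: "x \<in> U"
    obtain d g h where gh: "fraction_on U f d g h" "\<iota> x \<in> nonvanishing N h" using * x by blast
    then have hom: "hom_poly N d g" "hom_poly N d h" by (simp_all add: fraction_on_def)
    \<comment> \<open>Numerator and denominator have the same degree, so the arbitrary
      representative does not affect the value.\<close>
    define F where "F p = (let w = SOME w. w \<in> p in g w / h w)" for p
    have F: "F (hline w) = g w / h w" for w
    proof -
      have "(SOME u. u \<in> hline w) \<in> hline w" by (rule someI[of "\<lambda>u. u \<in> hline w", OF hline_self])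
      then obtain c where "c \<noteq> 0" "(SOME u. u \<in> hline w) = (\<lambda>i. c * w i)" using hlineD by blast
      then show ?thesis by (simp add: F_def hom_poly_scale[OF hom(1)] hom_poly_scale[OF hom(2)])
    qed
    have xX: "x \<in> pts X" using x openin_subset[OF U] by blast
    obtain v where v: "coords N v" "\<iota> x = hline v" using iota_points[OF xX] by (rule proj_pointsE)
    have "local_fraction N v F d g h"
      using hom F gh(2) v hline_nonvanishing[OF hom(2) v(1)] by (simp add: local_fraction_def)
    then have Freg: "F \<in> regular N (nonvanishing N h)" by (rule local_fraction_reg)
    obtain W where W: "zariski_open N W" "U = {x \<in> pts X. \<iota> x \<in> W}"
      using openin_induced[OF U] by blast
    let ?W = "W \<inter> nonvanishing N h"
    have oW: "zariski_open N ?W" using W(1) openin_nonvanishing[OF hom(2)] by blast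
    let ?V = "{x \<in> pts X. \<iota> x \<in> ?W}"
    have "(\<lambda>x. F (\<iota> x)) \<in> reg X ?V"
      by (rule reg_pullback[OF oW reg_proj_space_restrict[OF Freg oW]]) simp
    moreover have "f y = F (\<iota> y)" if "y \<in> ?V" for y
    proof -
      have "\<iota> y \<in> proj_points N" using iota_points that by blast
      then obtain w where w: "coords N w" "\<iota> y = hline w" by (rule proj_pointsE)
      then have "h w \<noteq> 0" using that hline_nonvanishing[OF hom(2) w(1)] by simp
      then show ?thesis using gh(1) that w W(2) hline_self[of w] F unfolding fraction_on_def by auto
    qed
    moreover have "openin (tsp X) ?V" by (rule openin_preimage[OF oW])
    ultimately show "\<exists>V. openin (tsp X) V \<and> x \<in> V \<and> V \<subseteq> U \<and> (\<exists>g\<in>reg X V. \<forall>y\<in>V. f y = g y)"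
      using x gh(2) W(2) by (intro exI[of _ ?V] conjI bexI[of _ "\<lambda>x. F (\<iota> x)"]) auto
  qed
qed

text \<open>Restriction is not among the axioms of \<open>sheaf_of_functions\<close>; it holds
  because \<open>fraction_on\<close> persists on subsets.\<close>

lemma reg_restrict:
  assumes "f \<in> reg X U" "openin (tsp X) U" "openin (tsp X) V" "V \<subseteq> U"
  shows "f \<in> reg X V"
proof -
  have "fraction_on V f d g h" if "fraction_on U f d g h" for d g h
    using that assms(4) unfolding fraction_on_def by blast
  then show ?thesis
    using assms(1,4) unfolding reg_iff[OF assms(2)] reg_iff[OF assms(3)] by blast
qed

lemma reg_cong:
  assumes "f \<in> reg X U" "openin (tsp X) U" "\<And>x. x \<in> U \<Longrightarrow> f x = g x"
  shows "g \<in> reg X U"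
proof (rule regI[OF assms(2)])
  fix x assume "x \<in> U"
  then show "\<exists>V. openin (tsp X) V \<and> x \<in> V \<and> V \<subseteq> U \<and> (\<exists>h\<in>reg X V. \<forall>y\<in>V. g y = h y)"
    using assms by (intro exI[of _ U] conjI bexI[of _ f]) auto
qed

lemma assumes U: "openin (tsp X) U"
  shows reg_const: "(\<lambda>_. c) \<in> reg X U"
    and reg_add: "f \<in> reg X U \<Longrightarrow> g \<in> reg X U \<Longrightarrow> (\<lambda>x. f x + g x) \<in> reg X U"
    and reg_mult: "f \<in> reg X U \<Longrightarrow> g \<in> reg X U \<Longrightarrow> (\<lambda>x. f x * g x) \<in> reg X U"
proof -
  note s = sheaf[unfolded sheaf_of_functions_def, THEN spec, THEN mp, OF U]
  show "(\<lambda>_. c) \<in> reg X U" using conjunct1[OF s] by (rule spec)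
  note s' = conjunct1[OF conjunct2[OF s]]
  show "(\<lambda>x. f x + g x) \<in> reg X U" "(\<lambda>x. f x * g x) \<in> reg X U" if "f \<in> reg X U" "g \<in> reg X U"
    using bspec[OF bspec[OF s' that(1)] that(2)] by (rule conjunct1, rule conjunct2)
qed

text \<open>The inverse of \<open>g / h\<close> is written as \<open>h h / (g h)\<close>: its
  denominator is nonzero only where \<open>h\<close> is nonzero too, which is where the given
  fraction is known to represent \<open>f\<close>.\<close>

lemma reg_inverse:
  assumes U: "openin (tsp X) U" and f: "f \<in> reg X U" and nz: "\<And>x. x \<in> U \<Longrightarrow> f x \<noteq> 0"
  shows "(\<lambda>x. inverse (f x)) \<in> reg X U"
  unfolding reg_iff[OF U]
proof
  fix x assume x: "x \<in> U"
  obtain d g h where gh: "fraction_on U f d g h" "\<iota> x \<in> nonvanishing N h"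
    using f x unfolding reg_iff[OF U] by blast
  then have hom: "hom_poly N d g" "hom_poly N d h" by (simp_all add: fraction_on_def)
  have "fraction_on U (\<lambda>x. inverse (f x)) (d + d) (\<lambda>w. h w * h w) (\<lambda>w. g w * h w)"
    using hom_poly_mult[OF hom(2,2)] hom_poly_mult[OF hom] gh(1) by (auto simp: fraction_on_def)
  moreover have "g w \<noteq> 0" if "w \<in> \<iota> x" for w
  proof -
    have "h w \<noteq> 0" "f x = g w / h w" using gh that x by (auto simp: nonvanishing_def fraction_on_def)
    then show ?thesis using nz[OF x] by auto
  qed
  then have "\<iota> x \<in> nonvanishing N (\<lambda>w. g w * h w)"
    using gh(2) by (simp add: nonvanishing_def)
  ultimately show "\<exists>d g h. fraction_on U (\<lambda>x. inverse (f x)) d g h \<and> \<iota> x \<in> nonvanishing N h" by blast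
qed

lemma reg_power: "openin (tsp X) U \<Longrightarrow> f \<in> reg X U \<Longrightarrow> (\<lambda>x. f x ^ n) \<in> reg X U"
  by (induction n) (auto intro: reg_const reg_mult)

lemma reg_power_int:
  assumes "openin (tsp X) U" "f \<in> reg X U" "\<And>x. x \<in> U \<Longrightarrow> f x \<noteq> 0"
  shows "(\<lambda>x. f x powi t) \<in> reg X U"
  using reg_power[OF assms(1,2)] reg_power[OF assms(1) reg_inverse[OF assms]]
  by (cases "t \<ge> 0") (simp_all add: power_int_def)

text \<open>Near a point where \<open>f\<close> is nonzero, the locus where \<open>g h\<close> does
  not vanish is an open neighbourhood on which \<open>f = g / h\<close> stays nonzero.\<close>

lemma open_nonzero:
  assumes U: "openin (tsp X) U" and f: "f \<in> reg X U"
  shows "openin (tsp X) {x \<in> U. f x \<noteq> 0}"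
proof (subst openin_subopen, intro ballI)
  fix x assume x: "x \<in> {x \<in> U. f x \<noteq> 0}"
  obtain d g h where gh: "fraction_on U f d g h" "\<iota> x \<in> nonvanishing N h"
    using f x unfolding reg_iff[OF U] by blast
  then have hom: "hom_poly N d g" "hom_poly N d h" by (simp_all add: fraction_on_def)
  have gh': "f y = g w / h w" if "y \<in> U" "w \<in> \<iota> y" "h w \<noteq> 0" for y w
    using gh(1) that unfolding fraction_on_def by blast
  let ?T = "U \<inter> {y \<in> pts X. \<iota> y \<in> nonvanishing N (\<lambda>w. g w * h w)}"
  have "openin (tsp X) ?T"
    by (intro openin_Int U openin_preimage openin_nonvanishing[OF hom_poly_mult[OF hom]])
  moreover have "x \<in> ?T"
  proof -
    have "x \<in> pts X" using openin_subset[OF U] x by blast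
    moreover have "g w * h w \<noteq> 0" if "w \<in> \<iota> x" for w
    proof -
      have "h w \<noteq> 0" using gh(2) that by (simp add: nonvanishing_def)
      then show ?thesis using gh'[of x w] that x by auto
    qed
    ultimately show ?thesis using x gh(2) by (auto simp: nonvanishing_def)
  qed
  moreover have "?T \<subseteq> {x \<in> U. f x \<noteq> 0}"
  proof
    fix y assume y: "y \<in> ?T"
    then have "\<iota> y \<in> proj_points N" by (simp add: nonvanishing_def)
    then obtain w where w: "w \<in> \<iota> y" using hline_self by (metis proj_pointsE)
    then have "g w * h w \<noteq> 0" using y by (auto simp: nonvanishing_def)
    then show "y \<in> {x \<in> U. f x \<noteq> 0}" using gh'[of y w] w y by auto
  qed
  ultimately show "\<exists>T. openin (tsp X) T \<and> x \<in> T \<and> T \<subseteq> {x \<in> U. f x \<noteq> 0}" by blast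
qed

section \<open>Consequences of irreducibility\<close>

lemma opens_meet:
  assumes "openin (tsp X) U" "U \<noteq> {}" "openin (tsp X) V" "V \<noteq> {}"
  shows "U \<inter> V \<noteq> {}"
proof
  assume "U \<inter> V = {}"
  then have "pts X \<subseteq> (pts X - U) \<union> (pts X - V)" by auto
  moreover have "closedin (tsp X) (pts X - U)" "closedin (tsp X) (pts X - V)"
    using assms by (auto simp: openin_closedin_eq)
  ultimately have "pts X \<subseteq> pts X - U \<or> pts X \<subseteq> pts X - V"
    using irreducible unfolding irreducible_in_def by blast
  then show False using assms openin_subset[of "tsp X"] by blast
qed

text \<open>A disagreement would make the nonvanishing locus of the difference a nonempty open set
  missing \<open>V\<close>, against irreducibility.\<close>

lemma identity_theorem:
  assumes U: "openin (tsp X) U" and f: "f \<in> reg X U" and g: "g \<in> reg X U"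
    and V: "openin (tsp X) V" "V \<noteq> {}" and eq: "\<And>x. x \<in> V \<Longrightarrow> x \<in> U \<Longrightarrow> f x = g x" and x: "x \<in> U"
  shows "f x = g x"
proof (rule ccontr)
  assume "f x \<noteq> g x"
  have "(\<lambda>x. f x + (- 1) * g x) \<in> reg X U"
    by (intro reg_add reg_mult reg_const U f g)
  then have "openin (tsp X) {x \<in> U. f x + (- 1) * g x \<noteq> 0}" by (rule open_nonzero[OF U])
  moreover have "{x \<in> U. f x + (- 1) * g x \<noteq> 0} \<noteq> {}" using x \<open>f x \<noteq> g x\<close> by auto
  ultimately have "{x \<in> U. f x + (- 1) * g x \<noteq> 0} \<inter> V \<noteq> {}" using V by (rule opens_meet)
  then show False using eq by auto
qed

subsection \<open>The differential of the embedding\<close>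

lemma near_reg_pullback:
  assumes "x \<in> pts X" "F \<in> near_reg (proj_space N) (\<iota> x)"
  shows "(\<lambda>z. F (\<iota> z)) \<in> near_reg X x"
proof -
  obtain W where "zariski_open N W" "\<iota> x \<in> W" "F \<in> regular N W"
    using assms(2) by (auto simp: near_reg_def)
  then show ?thesis
    using openin_preimage reg_pullback assms(1) unfolding near_reg_def by blast
qed

lemma near_reg_extend:
  assumes "f \<in> near_reg X x"
  shows "\<exists>F U. F \<in> near_reg (proj_space N) (\<iota> x) \<and> openin (tsp X) U \<and> x \<in> U \<and> (\<forall>y\<in>U. f y = F (\<iota> y))"
proof -
  obtain U where U: "openin (tsp X) U" "x \<in> U" "f \<in> reg X U" using assms by (auto simp: near_reg_def)
  obtain W F where W: "zariski_open N W" "\<iota> x \<in> W" "F \<in> regular N W"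
      "\<forall>y\<in>U. \<iota> y \<in> W \<longrightarrow> f y = F (\<iota> y)"
    using reg_extend[OF U(1,3,2)] by blast
  have "F \<in> near_reg (proj_space N) (\<iota> x)" using W by (auto simp: near_reg_def)
  moreover have "openin (tsp X) (U \<inter> {y \<in> pts X. \<iota> y \<in> W})"
    using U(1) openin_preimage[OF W(1)] by blast
  moreover have "x \<in> pts X" using U openin_subset by blast
  ultimately show ?thesis using U(2) W(2,4)
    by (intro exI[of _ F] exI[of _ "U \<inter> {y \<in> pts X. \<iota> y \<in> W}"]) auto
qed

lemma differential_derivation:
  assumes x: "x \<in> pts X" and \<delta>: "point_derivation X x \<delta>"
  shows "point_derivation (proj_space N) (\<iota> x) (tangent_map x \<delta>)"
proof -
  obtain v where v: "coords N v" "\<iota> x = hline v" using iota_points[OF x] by (rule proj_pointsE)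
  let ?R = "near_reg (proj_space N) (\<iota> x)"
  note pb = near_reg_pullback[OF x]
  have d: "tangent_map x \<delta> f = \<delta> (\<lambda>z. f (\<iota> z))" if "f \<in> ?R" for f
    using that by (simp add: differential_def)
  note closed = near_reg_closed[OF v(1), folded v(2)]
  show ?thesis
    unfolding point_derivation_def
  proof (intro conjI allI impI ballI)
    fix f assume "f \<notin> ?R"
    then show "tangent_map x \<delta> f = 0" by (simp add: differential_def)
  next
    fix f g assume f: "f \<in> ?R" and g: "g \<in> ?R"
    show "tangent_map x \<delta> (\<lambda>y. f y + g y) =
        tangent_map x \<delta> f + tangent_map x \<delta> g"
      unfolding d[OF f] d[OF g] d[OF closed(2)[OF f g]] by (rule point_derivationD(2)[OF \<delta> pb[OF f] pb[OF g]])
    show "tangent_map x \<delta> (\<lambda>y. f y * g y) =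
        f (\<iota> x) * tangent_map x \<delta> g + g (\<iota> x) * tangent_map x \<delta> f"
      unfolding d[OF f] d[OF g] d[OF closed(3)[OF f g]] by (rule point_derivationD(3)[OF \<delta> pb[OF f] pb[OF g]])
    fix U assume U: "zariski_open N U \<and> \<iota> x \<in> U \<and> (\<forall>y\<in>U. f y = g y)"
    show "tangent_map x \<delta> f = tangent_map x \<delta> g"
      unfolding d[OF f] d[OF g]
      by (rule point_derivationD(4)[OF \<delta> pb[OF f] pb[OF g] openin_preimage[of U]]) (use U x in auto)
  next
    fix c f assume f: "f \<in> ?R"
    show "tangent_map x \<delta> (\<lambda>y. c * f y) = c * tangent_map x \<delta> f"
      unfolding d[OF f] d[OF closed(1)[OF f]] by (rule point_derivationD(1)[OF \<delta> pb[OF f]])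
  qed
qed

lemma differential_linear:
  assumes "x \<in> pts X"
  shows "linear_map CC (tangent_space X x) (ambient_tangent x) (tangent_map x)"
  using differential_derivation[OF assms]
  by (intro mod_homI tangent_space_vectorspace) (auto simp: tangent_space_simps differential_def)

text \<open>Every germ on X extends to an ambient germ, so a derivation is determined by its values
  on pulled back functions.\<close>

lemma differential_injective:
  assumes x: "x \<in> pts X" and \<delta>: "\<delta> \<in> carrier (tangent_space X x)"
    and zero: "tangent_map x \<delta> = \<zero>\<^bsub>ambient_tangent x\<^esub>"
  shows "\<delta> = \<zero>\<^bsub>tangent_space X x\<^esub>"
proof -
  have \<delta>': "point_derivation X x \<delta>" using \<delta> by (simp add: tangent_space_simps)
  have "\<delta> f = 0" for f
  proof (cases "f \<in> near_reg X x")
    case True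
    then obtain F U where F: "F \<in> near_reg (proj_space N) (\<iota> x)" "openin (tsp X) U" "x \<in> U" "\<forall>y\<in>U. f y = F (\<iota> y)"
      using near_reg_extend by blast
    have "\<delta> f = \<delta> (\<lambda>z. F (\<iota> z))"
      using F(4) by (intro point_derivationD(4)[OF \<delta>' True near_reg_pullback[OF x F(1)] F(2,3)]) blast
    also have "\<dots> = tangent_map x \<delta> F" using F(1) by (simp add: differential_def)
    finally show ?thesis using zero by (simp add: tangent_space_simps)
  qed (use \<delta>' in \<open>simp add: point_derivation_def\<close>)
  then show ?thesis by (auto simp: tangent_space_simps)
qed

end

section \<open>Global sections\<close>

text \<open>On the cover consisting of X alone, \<open>s\<close> and the zero section are cocycles.
  A single cohomology class would make them agree after refinement, and evaluation at
  \<open>x0\<close> refutes this.\<close>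

lemma cohomology_0_nonvanishing:
  assumes vs: "\<And>x. x \<in> pts X \<Longrightarrow> vectorspace CC (fib E x)"
    and s: "s \<in> sect E (pts X)" "\<And>x. x \<in> pts X \<Longrightarrow> s x \<in> carrier (fib E x)"
    and zero: "(\<lambda>x\<in>pts X. \<zero>\<^bsub>fib E x\<^esub>) \<in> sect E (pts X)"
    and x0: "x0 \<in> pts X" "s x0 \<noteq> \<zero>\<^bsub>fib E x0\<^esub>"
  shows "\<not> cohomology_vanishes X E 0"
proof
  assume "cohomology_vanishes X E 0"
  then obtain C where C: "cohomology X E 0 = {C}"
    unfolding cohomology_vanishes_def is_singleton_def by blast
  let ?P = "pts X"
  let ?U = "{?P}"
  define c where "c t = (\<lambda>\<sigma>\<in>tuples (Suc 0) ?U. t)" for t :: "'a \<Rightarrow> 'b"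
  have cover: "open_cover X ?U" by (simp add: open_cover_def)
  have tup: "\<sigma> \<in> tuples q ?U \<longleftrightarrow> \<sigma> = replicate q ?P" for \<sigma> q
    unfolding tuples_def by (auto intro!: replicate_eqI)
  have cocycle: "c t \<in> cocycles E ?U 0"
    if t: "t \<in> sect E ?P" "\<And>x. x \<in> ?P \<Longrightarrow> t x \<in> carrier (fib E x)" for t
  proof -
    have "c t \<in> cochains E ?U 0"
      using t(1) unfolding cochains_def c_def by (auto simp: tup)
    moreover have "coboundary E ?U 0 (c t) = zero_cochain E ?U (Suc 0)"
      unfolding coboundary_def zero_cochain_def
    proof (intro restrict_ext)
      fix \<sigma> x assume \<sigma>: "\<sigma> \<in> tuples (Suc (Suc 0)) ?U" and x: "x \<in> \<Inter> (set \<sigma>)"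
      have xP: "x \<in> ?P" using \<sigma> x by (simp add: tup)
      interpret V: vectorspace CC "fib E x" by (rule vs[OF xP])
      note tx = t(2)[OF xP]
      have m: "(- 1) \<odot>\<^bsub>fib E x\<^esub> t x = \<ominus>\<^bsub>fib E x\<^esub> t x"
        using V.smult_minus_1[OF tx] by (simp only: class_ring_simps)
      have o: "1 \<odot>\<^bsub>fib E x\<^esub> t x = t x" using V.smult_one[OF tx] by simp
      have sm: "a \<odot>\<^bsub>fib E x\<^esub> t x \<in> carrier (fib E x)" for a using tx by (intro V.smult_closed) simp_all
      have "(\<Oplus>\<^bsub>fib E x\<^esub>j\<in>{..Suc 0}. (- 1) ^ j \<odot>\<^bsub>fib E x\<^esub> c t (take j \<sigma> @ drop (Suc j) \<sigma>) x)
          = (\<Oplus>\<^bsub>fib E x\<^esub>j\<in>{..Suc 0}. (- 1) ^ j \<odot>\<^bsub>fib E x\<^esub> t x)"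
      proof (rule V.M.add.finprod_cong')
        fix j assume "j \<in> {..Suc 0}"
        then have "take j \<sigma> @ drop (Suc j) \<sigma> = [?P]"
          using \<sigma> by (cases j) (auto simp: tup)
        then show "(- 1) ^ j \<odot>\<^bsub>fib E x\<^esub> c t (take j \<sigma> @ drop (Suc j) \<sigma>) x = (- 1) ^ j \<odot>\<^bsub>fib E x\<^esub> t x"
          by (simp add: c_def tup)
      qed (use sm in auto)
      also have "\<dots> = (\<Oplus>\<^bsub>fib E x\<^esub>j\<in>insert (Suc 0) (insert 0 {}). (- 1) ^ j \<odot>\<^bsub>fib E x\<^esub> t x)"
        by (simp add: atMost_Suc)
      also have "\<dots> = (- 1) ^ Suc 0 \<odot>\<^bsub>fib E x\<^esub> t x \<oplus>\<^bsub>fib E x\<^esub> ((- 1) ^ 0 \<odot>\<^bsub>fib E x\<^esub> t x \<oplus>\<^bsub>fib E x\<^esub> \<zero>\<^bsub>fib E x\<^esub>)"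
        using V.M.finsum_insert[of "insert 0 {}" "Suc 0" "\<lambda>j. (- 1) ^ j \<odot>\<^bsub>fib E x\<^esub> t x"]
          V.M.finsum_insert[of "{}" 0 "\<lambda>j. (- 1) ^ j \<odot>\<^bsub>fib E x\<^esub> t x"] sm
        by (simp only: finite.intros V.M.finsum_empty Pi_iff) simp
      also have "\<dots> = \<zero>\<^bsub>fib E x\<^esub>"
        using tx by (simp add: m o V.M.l_neg)
      finally show "(\<Oplus>\<^bsub>fib E x\<^esub>j\<in>{..Suc 0}. (- 1) ^ j \<odot>\<^bsub>fib E x\<^esub> c t (take j \<sigma> @ drop (Suc j) \<sigma>) x)
          = \<zero>\<^bsub>fib E x\<^esub>" .
    qed
    ultimately show ?thesis by (simp add: cocycles_def)
  qed
  let ?z = "\<lambda>x\<in>?P. \<zero>\<^bsub>fib E x\<^esub>"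
  have zc: "?z x \<in> carrier (fib E x)" if "x \<in> ?P" for x
  proof -
    interpret V: vectorspace CC "fib E x" by (rule vs[OF that])
    show ?thesis using that by simp
  qed
  have cs: "c s \<in> cocycles E ?U 0" by (rule cocycle[OF s(1)]) (rule s(2))
  have cz: "c ?z \<in> cocycles E ?U 0" by (rule cocycle[OF zero]) (rule zc)
  \<comment> \<open>Reflexivity at this one pair, together with the equality of the two classes,
    already relates the zero section to \<open>s\<close>; symmetry and transitivity of
    \<open>cohomologous\<close> are avoided.\<close>
  have refl: "((?U, c s), (?U, c s)) \<in> cohomologous X E 0"
  proof -
    have "(\<lambda>\<sigma>\<in>tuples (Suc 0) ?U. \<lambda>x\<in>\<Inter> (set \<sigma>). c s (map id \<sigma>) x \<ominus>\<^bsub>fib E x\<^esub> c s (map id \<sigma>) x)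
        = zero_cochain E ?U 0"
      unfolding zero_cochain_def
    proof (intro restrict_ext)
      fix \<sigma> x assume \<sigma>: "\<sigma> \<in> tuples (Suc 0) ?U" and x: "x \<in> \<Inter> (set \<sigma>)"
      have xP: "x \<in> ?P" using \<sigma> x by (simp add: tup)
      interpret V: vectorspace CC "fib E x" by (rule vs[OF xP])
      show "c s (map id \<sigma>) x \<ominus>\<^bsub>fib E x\<^esub> c s (map id \<sigma>) x = \<zero>\<^bsub>fib E x\<^esub>"
        using \<sigma> s(2)[OF xP] by (simp add: c_def a_minus_def V.M.r_neg)
    qed
    then have "\<exists>\<W> \<tau> \<rho>. open_cover X \<W> \<and> refinement \<W> ?U \<tau> \<and> refinement \<W> ?U \<rho> \<and>
        (\<lambda>\<sigma>\<in>tuples (Suc 0) \<W>. \<lambda>x\<in>\<Inter> (set \<sigma>).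
          c s (map \<tau> \<sigma>) x \<ominus>\<^bsub>fib E x\<^esub> c s (map \<rho> \<sigma>) x) \<in> coboundaries E \<W> 0"
      by (intro exI[of _ ?U] exI[of _ id] conjI cover) (simp_all add: refinement_def coboundaries_def)
    then show ?thesis unfolding cohomologous_def using cover cs by blast
  qed
  have classes: "cohomologous X E 0 `` {(?U, c t)} = C" if "c t \<in> cocycles E ?U 0" for t
  proof -
    have "cohomologous X E 0 `` {(?U, c t)} \<in> cohomology X E 0"
      unfolding cohomology_def by (rule quotientI) (use that cover in auto)
    then show ?thesis unfolding C by blast
  qed
  have "((?U, c ?z), (?U, c s)) \<in> cohomologous X E 0"
    using refl classes[OF cs] classes[OF cz] by blast
  then obtain \<W> \<tau> \<rho> where W: "open_cover X \<W>" "refinement \<W> ?U \<tau>" "refinement \<W> ?U \<rho>"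
    and diff: "(\<lambda>\<sigma>\<in>tuples (Suc 0) \<W>. \<lambda>x\<in>\<Inter> (set \<sigma>).
        c ?z (map \<tau> \<sigma>) x \<ominus>\<^bsub>fib E x\<^esub> c s (map \<rho> \<sigma>) x) = zero_cochain E \<W> 0"
    unfolding cohomologous_def coboundaries_def by auto
  \<comment> \<open>A member of the refining cover through \<open>x0\<close>; both refinement maps
    can only send it to X.\<close>
  obtain A where A: "A \<in> \<W>" "x0 \<in> A" using W(1) x0(1) unfolding open_cover_def by blast
  have AP: "\<tau> A = ?P" "\<rho> A = ?P" using W(2,3) A(1) by (auto simp: refinement_def)
  have At: "[A] \<in> tuples (Suc 0) \<W>" using A(1) by (simp add: tuples_def)
  interpret V: vectorspace CC "fib E x0" by (rule vs[OF x0(1)])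
  from fun_cong[OF fun_cong[OF diff, of "[A]"], of x0]
  have "\<zero>\<^bsub>fib E x0\<^esub> \<ominus>\<^bsub>fib E x0\<^esub> s x0 = \<zero>\<^bsub>fib E x0\<^esub>"
    using At A(2) x0(1) by (simp add: zero_cochain_def AP c_def tup)
  then have "\<ominus>\<^bsub>fib E x0\<^esub> s x0 = \<zero>\<^bsub>fib E x0\<^esub>"
    using s(2)[OF x0(1)] by (simp add: a_minus_def)
  then have "s x0 = \<zero>\<^bsub>fib E x0\<^esub>"
    using V.M.r_neg[OF s(2)[OF x0(1)]] V.M.r_zero[OF s(2)[OF x0(1)]] by simp
  then show False using x0(2) by contradiction
qed

text \<open>A local generator is the sum with one term and coefficient 1.\<close>

lemma generated_sectionsI:
  assumes one: "\<And>W. openin (tsp X) W \<Longrightarrow> (\<lambda>_. 1) \<in> reg X W"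
    and vs: "\<And>x. x \<in> U \<Longrightarrow> vectorspace CC (V x)"
    and carr: "s \<in> (\<Pi>\<^sub>E x\<in>U. carrier (V x))"
    and loc: "\<And>x. x \<in> U \<Longrightarrow> \<exists>W. openin (tsp X) W \<and> x \<in> W \<and> W \<subseteq> U \<and> (\<exists>g\<in>G W. \<forall>y\<in>W. s y = g y)"
  shows "s \<in> generated_sections X V G U"
  unfolding generated_sections_def
proof (intro CollectI conjI carr ballI)
  fix x assume "x \<in> U"
  from loc[OF this] obtain W g where W: "openin (tsp X) W" "x \<in> W" "W \<subseteq> U" "g \<in> G W" "\<forall>y\<in>W. s y = g y"
    by blast
  have "s y = (\<Oplus>\<^bsub>V y\<^esub> j\<in>{..<Suc 0}. 1 \<odot>\<^bsub>V y\<^esub> g y)" if y: "y \<in> W" for y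
  proof -
    interpret V: vectorspace CC "V y" by (rule vs) (use y W(3) in blast)
    have gy: "g y \<in> carrier (V y)" using carr W(3,5) y by (metis PiE_mem subsetD)
    have "1 \<odot>\<^bsub>V y\<^esub> g y = g y" using V.smult_one[OF gy] by simp
    moreover have "{..<Suc 0} = insert 0 {}" by auto
    ultimately have "(\<Oplus>\<^bsub>V y\<^esub> j\<in>{..<Suc 0}. 1 \<odot>\<^bsub>V y\<^esub> g y) = g y \<oplus>\<^bsub>V y\<^esub> \<zero>\<^bsub>V y\<^esub>"
      using V.M.finsum_insert[of "{}" 0 "\<lambda>_. g y"] gy by simp
    then show ?thesis using gy W(5) y by simp
  qed
  then show "\<exists>W. openin (tsp X) W \<and> x \<in> W \<and> W \<subseteq> U \<and>
      (\<exists>(r::nat) f g. (\<forall>j<r. f j \<in> reg X W \<and> g j \<in> G W) \<and>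
         (\<forall>y\<in>W. s y = (\<Oplus>\<^bsub>V y\<^esub> j\<in>{..<r}. f j y \<odot>\<^bsub>V y\<^esub> g j y)))"
    using W one[OF W(1)]
    by (intro exI[of _ W] conjI exI[of _ "Suc 0"] exI[of _ "\<lambda>_ _. 1"] exI[of _ "\<lambda>_. g"]) simp_all
qed

text \<open>The zero section is the empty sum.\<close>

lemma generated_sections_zero:
  assumes U: "openin (tsp X) U" and vs: "\<And>x. x \<in> U \<Longrightarrow> vectorspace CC (V x)"
  shows "(\<lambda>x\<in>U. \<zero>\<^bsub>V x\<^esub>) \<in> generated_sections X V G U"
  unfolding generated_sections_def
proof (intro CollectI conjI ballI)
  have *: "\<zero>\<^bsub>V x\<^esub> \<in> carrier (V x)" "(\<Oplus>\<^bsub>V x\<^esub> j\<in>{..<0::nat}. F j) = \<zero>\<^bsub>V x\<^esub>" if "x \<in> U" for x F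
  proof -
    interpret V: vectorspace CC "V x" by (rule vs[OF that])
    show "\<zero>\<^bsub>V x\<^esub> \<in> carrier (V x)" "(\<Oplus>\<^bsub>V x\<^esub> j\<in>{..<0::nat}. F j) = \<zero>\<^bsub>V x\<^esub>" by simp_all
  qed
  then show "(\<lambda>x\<in>U. \<zero>\<^bsub>V x\<^esub>) \<in> (\<Pi>\<^sub>E x\<in>U. carrier (V x))" by auto
  fix x assume "x \<in> U"
  then show "\<exists>W. openin (tsp X) W \<and> x \<in> W \<and> W \<subseteq> U \<and>
      (\<exists>(r::nat) f g. (\<forall>j<r. f j \<in> reg X W \<and> g j \<in> G W) \<and>
         (\<forall>y\<in>W. (\<lambda>x\<in>U. \<zero>\<^bsub>V x\<^esub>) y = (\<Oplus>\<^bsub>V y\<^esub> j\<in>{..<r}. f j y \<odot>\<^bsub>V y\<^esub> g j y)))"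
    using U * by (intro exI[of _ U] conjI exI[of _ "0::nat"]) simp_all
qed

section \<open>Powers of the polarization\<close>

text \<open>The map whose image is \<open>divisor_multiple\<close>, named so that each equation of a
  multiple of H can be traced back to an equation of H.\<close>

definition local_eq_multiple :: "int \<Rightarrow> 'x local_eq \<Rightarrow> 'x local_eq" where
  "local_eq_multiple t e = (if t \<ge> 0
     then \<lparr>eq_dom = eq_dom e, eq_num = (\<lambda>x. eq_num e x ^ nat t), eq_den = (\<lambda>x. eq_den e x ^ nat t)\<rparr>
     else \<lparr>eq_dom = eq_dom e, eq_num = (\<lambda>x. eq_den e x ^ nat (- t)), eq_den = (\<lambda>x. eq_num e x ^ nat (- t))\<rparr>)"

lemma divisor_multiple_eq: "divisor_multiple t D = local_eq_multiple t ` D"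
  by (simp add: divisor_multiple_def local_eq_multiple_def[abs_def])

lemma eq_dom_local_eq_multiple [simp]: "eq_dom (local_eq_multiple t e) = eq_dom e"
  by (simp add: local_eq_multiple_def)

lemma divisor_bundle_vectorspace: "vectorspace CC (fib (divisor_bundle X D) x)"
  unfolding divisor_bundle_def Let_def vbundle.simps
proof (rule fun_vs_vectorspace, goal_cases)
  case 1
  show ?case by simp
next
  case (2 f g)
  show ?case
  proof (intro CollectI conjI allI ballI impI)
    fix e assume "f e + g e \<noteq> 0"
    then have "f e \<noteq> 0 \<or> g e \<noteq> 0" by auto
    then show "e \<in> D" "x \<in> eq_dom e" using 2 by blast+
  next
    fix e e' h assume "e \<in> D" "e' \<in> D" "x \<in> eq_dom e \<inter> eq_dom e' \<and> transition X e e' h"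
    then have "f e = h x * f e'" "g e = h x * g e'" using 2 by blast+
    then show "f e + g e = h x * (f e' + g e')" by (simp only: distrib_left)
  qed
next
  case (3 c f)
  show ?case
  proof (intro CollectI conjI allI ballI impI)
    fix e assume "c * f e \<noteq> 0"
    then have "f e \<noteq> 0" by auto
    then show "e \<in> D" "x \<in> eq_dom e" using 3 by blast+
  next
    fix e e' h assume "e \<in> D" "e' \<in> D" "x \<in> eq_dom e \<inter> eq_dom e' \<and> transition X e e' h"
    then have "f e = h x * f e'" using 3 by blast
    then show "c * f e = h x * (c * f e')" by (simp only: mult.left_commute)
  qed
qed

lemma divisor_bundle_fibre:
  "\<xi> \<in> carrier (fib (divisor_bundle X D) x) \<longleftrightarrow>
     (\<forall>e. \<xi> e \<noteq> 0 \<longrightarrow> e \<in> D \<and> x \<in> eq_dom e) \<and>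
     (\<forall>e\<in>D. \<forall>e'\<in>D. \<forall>g. x \<in> eq_dom e \<inter> eq_dom e' \<and> transition X e e' g \<longrightarrow> \<xi> e = g x * \<xi> e')"
  "\<xi> \<oplus>\<^bsub>fib (divisor_bundle X D) x\<^esub> \<eta> = (\<lambda>e. \<xi> e + \<eta> e)"
  "c \<odot>\<^bsub>fib (divisor_bundle X D) x\<^esub> \<xi> = (\<lambda>e. c * \<xi> e)"
  by (simp_all add: divisor_bundle_def fun_vs_simps)

lemma divisor_bundle_sections:
  "s \<in> sect (divisor_bundle X D) U \<longleftrightarrow> s \<in> (\<Pi>\<^sub>E x\<in>U. carrier (fib (divisor_bundle X D) x)) \<and>
     (\<forall>e\<in>D. (\<lambda>x. s x e) \<in> reg X (U \<inter> eq_dom e))"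
  by (simp add: divisor_bundle_def)

text \<open>The local form of the identification of the line bundle of H with the pullback of O(1):
  the \<open>s j\<close> transform as sections of the former and are the homogeneous coordinates of
  the embedding.\<close>

locale polarized_variety = embedded_variety X N \<iota>
  for X :: "'x fspace" and N :: nat and \<iota> :: "'x \<Rightarrow> (nat \<Rightarrow> complex) set" +
  fixes H :: "'x local_eq set" and s :: "nat \<Rightarrow> 'x \<Rightarrow> 'x local_eq \<Rightarrow> complex"
  assumes cartier: "cartier_divisor X H"
    and s_reg: "j \<le> N \<Longrightarrow> e \<in> H \<Longrightarrow> (\<lambda>x. s j x e) \<in> reg X (eq_dom e)"
    and s_transition: "j \<le> N \<Longrightarrow> e \<in> H \<Longrightarrow> e' \<in> H \<Longrightarrow> x \<in> eq_dom e \<Longrightarrow> x \<in> eq_dom e' \<Longrightarrow>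
      transition X e e' g \<Longrightarrow> s j x e = g x * s j x e'"
    and s_coords: "e \<in> H \<Longrightarrow> x \<in> eq_dom e \<Longrightarrow> \<iota> x = hline (\<lambda>j. if j \<le> N then s j x e else 0)"
begin

lemma H_open: "e \<in> H \<Longrightarrow> openin (tsp X) (eq_dom e)"
  and H_num: "e \<in> H \<Longrightarrow> eq_num e \<in> reg X (eq_dom e)" "e \<in> H \<Longrightarrow> {x \<in> eq_dom e. eq_num e x \<noteq> 0} \<noteq> {}"
  and H_den: "e \<in> H \<Longrightarrow> eq_den e \<in> reg X (eq_dom e)" "e \<in> H \<Longrightarrow> {x \<in> eq_dom e. eq_den e x \<noteq> 0} \<noteq> {}"
  and H_transition: "e \<in> H \<Longrightarrow> e' \<in> H \<Longrightarrow> \<exists>g. transition X e e' g"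
  using cartier unfolding cartier_divisor_def by auto

lemma H_covers: "x \<in> pts X \<Longrightarrow> \<exists>e\<in>H. x \<in> eq_dom e"
  using cartier unfolding cartier_divisor_def by blast

definition chart_domain :: "nat \<Rightarrow> 'x set" where
  "chart_domain l = {x \<in> pts X. \<iota> x \<in> chart N l}"

lemma openin_chart_domain: "l \<le> N \<Longrightarrow> openin (tsp X) (chart_domain l)"
  unfolding chart_domain_def by (intro openin_preimage openin_nonvanishing[OF hom_poly_var])

lemma chart_domain_covers: "x \<in> pts X \<Longrightarrow> \<exists>l\<le>N. x \<in> chart_domain l"
proof -
  assume x: "x \<in> pts X"
  obtain v where v: "coords N v" "\<iota> x = hline v" using iota_points[OF x] by (rule proj_pointsE)
  then obtain l where l: "v l \<noteq> 0" "l \<le> N" unfolding coords_def by (meson not_le)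
  then show ?thesis
    using x v hline_nonvanishing[OF hom_poly_var[OF l(2)] v(1)] by (auto simp: chart_domain_def)
qed

lemma s_nonzero:
  assumes "x \<in> chart_domain l" "l \<le> N" "e \<in> H" "x \<in> eq_dom e"
  shows "s l x e \<noteq> 0"
  using assms s_coords[OF assms(3,4)] hline_self[of "\<lambda>j. if j \<le> N then s j x e else 0"]
  by (auto simp: chart_domain_def nonvanishing_def)

lemma dehom_s:
  assumes "j \<le> N" "l \<le> N" "e \<in> H" "x \<in> eq_dom e"
  shows "dehom l (\<iota> x) j = s j x e / s l x e"
  using assms by (simp add: s_coords[OF assms(3,4)] dehom_hline divide_inverse mult.commute)

text \<open>
  Transition functions between powers of local equations are only constrained where the
  equations do not vanish; elsewhere they are determined by the identity theorem.
\<close>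

lemma transition_power:
  assumes e: "e \<in> H" "e' \<in> H" and g0: "transition X e e' g0"
    and g: "transition X (local_eq_multiple t e) (local_eq_multiple t e') g"
    and x: "x \<in> eq_dom e" "x \<in> eq_dom e'"
  shows "g x = g0 x powi t"
proof -
  let ?U = "eq_dom e \<inter> eq_dom e'"
  have U: "openin (tsp X) ?U" using H_open e by blast
  \<comment> \<open>Here all four numerators and denominators are nonzero; irreducibility keeps the
    set nonempty.\<close>
  let ?V = "({x \<in> eq_dom e. eq_num e x \<noteq> 0} \<inter> {x \<in> eq_dom e. eq_den e x \<noteq> 0}) \<inter>
    ({x \<in> eq_dom e'. eq_num e' x \<noteq> 0} \<inter> {x \<in> eq_dom e'. eq_den e' x \<noteq> 0})"
  note on = open_nonzero[OF H_open H_num(1)] and od = open_nonzero[OF H_open H_den(1)]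
  have o: "openin (tsp X) ({x \<in> eq_dom e. eq_num e x \<noteq> 0} \<inter> {x \<in> eq_dom e. eq_den e x \<noteq> 0})"
    "{x \<in> eq_dom e. eq_num e x \<noteq> 0} \<inter> {x \<in> eq_dom e. eq_den e x \<noteq> 0} \<noteq> {}" if "e \<in> H" for e
    using openin_Int[OF on od] opens_meet[OF on H_num(2) od H_den(2)] that by blast+
  show ?thesis
  proof (rule identity_theorem[OF U])
    show "g \<in> reg X ?U" using g by (simp add: transition_def)
    show "(\<lambda>x. g0 x powi t) \<in> reg X ?U" using g0 by (intro reg_power_int[OF U]) (auto simp: transition_def)
    show "openin (tsp X) ?V" by (intro openin_Int[OF o(1) o(1)] e)
    show "?V \<noteq> {}" by (rule opens_meet[OF o(1) o(2) o(1) o(2)]) (use e in auto)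
    show "x \<in> ?U" using x by blast
    fix y assume y: "y \<in> ?V" "y \<in> ?U"
    let ?n = "eq_num e y" and ?d = "eq_den e y" and ?n' = "eq_num e' y" and ?d' = "eq_den e' y"
    have nz: "?n \<noteq> 0" "?d \<noteq> 0" "?n' \<noteq> 0" "?d' \<noteq> 0" using y by auto
    have eq0: "?n * ?d' = g0 y * (?d * ?n')" and g0nz: "g0 y \<noteq> 0" using g0 y(2) by (auto simp: transition_def)
    \<comment> \<open>A negative multiple exchanges numerator and denominator, so the two signs of
      \<open>t\<close> give the equation in mirrored forms.\<close>
    show "g y = g0 y powi t"
    proof (cases "t \<ge> 0")
      case True
      have "(?n * ?d') ^ nat t = g y * (?d * ?n') ^ nat t"
        using g y(2) True by (simp add: transition_def local_eq_multiple_def power_mult_distrib)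
      then have "g0 y ^ nat t * (?d * ?n') ^ nat t = g y * (?d * ?n') ^ nat t"
        unfolding eq0 by (simp only: power_mult_distrib)
      then show ?thesis using nz True by (simp add: power_int_def)
    next
      case False
      have "(?d * ?n') ^ nat (- t) = g y * (?n * ?d') ^ nat (- t)"
        using g y(2) False by (simp add: transition_def local_eq_multiple_def power_mult_distrib)
      then have "1 * (?d * ?n') ^ nat (- t) = (g y * g0 y ^ nat (- t)) * (?d * ?n') ^ nat (- t)"
        unfolding eq0 by (simp only: power_mult_distrib mult.assoc mult_1)
      then have "g y * g0 y ^ nat (- t) = 1" using nz by simp
      then show ?thesis using False g0nz by (simp add: power_int_def field_simps)
    qed
  qed
qed

lemma s_power_transition:
  assumes e: "e \<in> H" "e' \<in> H" and x: "x \<in> eq_dom e" "x \<in> eq_dom e'" and l: "l \<le> N"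
    and g: "transition X (local_eq_multiple t e) (local_eq_multiple t e') g"
  shows "s l x e powi t = g x * s l x e' powi t"
proof -
  obtain g0 where g0: "transition X e e' g0" using H_transition[OF e] by blast
  show ?thesis
    unfolding transition_power[OF e g0 g x] s_transition[OF l e x g0] by (rule power_int_mult_distrib)
qed

text \<open>
  The power \<open>s\<^sub>l\<^sup>t\<close> as a frame of the line bundle of \<open>t H\<close>. Distinct local equations of \<open>H\<close> may have
  equal \<open>t\<close>-th powers, whence the choice.
\<close>

definition power_frame :: "int \<Rightarrow> nat \<Rightarrow> 'x \<Rightarrow> 'x local_eq \<Rightarrow> complex" where
  "power_frame t l x e' = (if \<exists>e\<in>H. e' = local_eq_multiple t e \<and> x \<in> eq_dom e
     then s l x (SOME e. e \<in> H \<and> e' = local_eq_multiple t e \<and> x \<in> eq_dom e) powi t else 0)"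

text \<open>If two equations of H have the same multiple, the transition between these multiples can
  be taken to be 1, so the power of \<open>s l\<close> reads the same in both and the choice is
  harmless.\<close>

lemma power_frame_eq:
  assumes e: "e \<in> H" and x: "x \<in> eq_dom e" and l: "l \<le> N"
  shows "power_frame t l x (local_eq_multiple t e) = s l x e powi t"
proof -
  let ?P = "\<lambda>e'. e' \<in> H \<and> local_eq_multiple t e = local_eq_multiple t e' \<and> x \<in> eq_dom e'"
  define e' where "e' = (SOME e'. ?P e')"
  have "?P e'" unfolding e'_def by (rule someI[of ?P e]) (use e x in simp)
  moreover have "transition X (local_eq_multiple t e) (local_eq_multiple t e) (\<lambda>_. 1)"
    using reg_const[OF H_open[OF e]] by (simp add: transition_def)
  ultimately have "s l x e powi t = s l x e' powi t"
    using s_power_transition[of e e' x l t "\<lambda>_. 1"] e x l by simp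
  moreover have "power_frame t l x (local_eq_multiple t e) = s l x e' powi t"
    unfolding power_frame_def e'_def using e x by auto
  ultimately show ?thesis by simp
qed

lemma power_frame_carrier:
  assumes "l \<le> N"
  shows "power_frame t l x \<in> carrier (fib (divisor_bundle X (divisor_multiple t H)) x)"
  unfolding divisor_bundle_fibre divisor_multiple_eq
proof (intro conjI allI impI ballI)
  fix e assume "power_frame t l x e \<noteq> 0"
  then show "e \<in> local_eq_multiple t ` H" "x \<in> eq_dom e"
    unfolding power_frame_def by (auto split: if_splits)
next
  fix a a' g
  assume "a \<in> local_eq_multiple t ` H" "a' \<in> local_eq_multiple t ` H"
    and *: "x \<in> eq_dom a \<inter> eq_dom a' \<and> transition X a a' g"
  then obtain e e' where e: "e \<in> H" "e' \<in> H" "a = local_eq_multiple t e" "a' = local_eq_multiple t e'" by blast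
  have x: "x \<in> eq_dom e" "x \<in> eq_dom e'" using * e by auto
  show "power_frame t l x a = g x * power_frame t l x a'"
    unfolding e(3,4) power_frame_eq[OF e(1) x(1) assms] power_frame_eq[OF e(2) x(2) assms]
    by (rule s_power_transition[OF e(1,2) x assms]) (use * e in simp)
qed

text \<open>Negative powers are regular because \<open>s l\<close> vanishes nowhere on its
  chart.\<close>

lemma power_frame_section:
  assumes l: "l \<le> N"
  shows "(\<lambda>x\<in>chart_domain l. power_frame t l x) \<in> sect (divisor_bundle X (divisor_multiple t H)) (chart_domain l)"
  unfolding divisor_bundle_sections
proof (intro conjI ballI)
  show "(\<lambda>x\<in>chart_domain l. power_frame t l x) \<in>
      (\<Pi>\<^sub>E x\<in>chart_domain l. carrier (fib (divisor_bundle X (divisor_multiple t H)) x))"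
    using power_frame_carrier[OF l] by auto
  fix a assume "a \<in> divisor_multiple t H"
  then obtain e where e: "e \<in> H" "a = local_eq_multiple t e" by (auto simp: divisor_multiple_eq)
  let ?U = "chart_domain l \<inter> eq_dom e"
  have U: "openin (tsp X) ?U" using openin_chart_domain[OF l] H_open[OF e(1)] by blast
  have "(\<lambda>x. s l x e) \<in> reg X ?U"
    by (rule reg_restrict[OF s_reg[OF l e(1)] H_open[OF e(1)] U]) simp
  then have "(\<lambda>x. s l x e powi t) \<in> reg X ?U"
    by (rule reg_power_int[OF U]) (use s_nonzero l e(1) in auto)
  then have "(\<lambda>x. (\<lambda>x\<in>chart_domain l. power_frame t l x) x a) \<in> reg X ?U"
    by (rule reg_cong[OF _ U]) (use power_frame_eq l e in auto)
  then show "(\<lambda>x. (\<lambda>x\<in>chart_domain l. power_frame t l x) x a) \<in> reg X (chart_domain l \<inter> eq_dom a)"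
    using e by simp
qed

text \<open>The ratio of \<open>s l'\<close> to \<open>s l\<close> is an affine coordinate,
  independent of the trivialisation.\<close>

lemma power_frame_change:
  assumes l: "l \<le> N" "l' \<le> N" and x: "x \<in> chart_domain l" "x \<in> chart_domain l'"
  shows "power_frame t l' x = (\<lambda>e. dehom l (\<iota> x) l' powi t * power_frame t l x e)"
proof
  fix a
  show "power_frame t l' x a = dehom l (\<iota> x) l' powi t * power_frame t l x a"
  proof (cases "\<exists>e\<in>H. a = local_eq_multiple t e \<and> x \<in> eq_dom e")
    case True
    then obtain e where e: "e \<in> H" "a = local_eq_multiple t e" "x \<in> eq_dom e" by blast
    have "s l x e \<noteq> 0" by (rule s_nonzero[OF x(1) l(1) e(1,3)])
    then show ?thesis
      unfolding e(2) power_frame_eq[OF e(1,3) l(1)] power_frame_eq[OF e(1,3) l(2)]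
        dehom_s[OF l(2,1) e(1,3)] power_int_mult_distrib[symmetric] by simp
  next
    case False
    have "power_frame t l x a = 0" for l unfolding power_frame_def using False by (rule if_not_P)
    then show ?thesis by simp
  qed
qed

text \<open>Reading a vector of the fibre in one trivialisation at \<open>x\<close> is a linear
  form, and the frame is nonzero there.\<close>

lemma power_frame_functional:
  assumes l: "l \<le> N" and x: "x \<in> chart_domain l"
  shows "\<exists>L. functional (fib (divisor_bundle X (divisor_multiple t H)) x) L \<and> L (power_frame t l x) \<noteq> 0"
proof -
  obtain e where e: "e \<in> H" "x \<in> eq_dom e" using H_covers x by (auto simp: chart_domain_def)
  have "power_frame t l x (local_eq_multiple t e) \<noteq> 0"
    using s_nonzero[OF x l e] by (simp add: power_frame_eq[OF e l])
  then show ?thesis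
    by (intro exI[of _ "\<lambda>\<xi>. \<xi> (local_eq_multiple t e)"]) (simp add: functional_def divisor_bundle_fibre(2,3))
qed

end

section \<open>A section of the twisted exterior power\<close>

lemma fib_wedge_bundle: "fib (wedge_bundle X m B) x = wedge_vs m (fib B x)"
  and fib_twist: "fib (twist X H E t) x = tensor_vs (fib E x) (fib (divisor_bundle X (divisor_multiple t H)) x)"
  by (simp_all add: wedge_bundle_def twist_def tensor_bundle_def)

lemma bundle_rank_eq:
  assumes "pts X \<noteq> {}"
    and "\<And>x. x \<in> pts X \<Longrightarrow> vectorspace.fin_dim CC (fib E x) \<and> vectorspace.dim CC (fib E x) = r"
  shows "bundle_rank X E = r"
  unfolding bundle_rank_def
proof (rule the_equality)
  fix r' assume "\<forall>x\<in>pts X. vectorspace.fin_dim CC (fib E x) \<and> vectorspace.dim CC (fib E x) = r'"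
  then show "r' = r" using assms by auto
qed (use assms in blast)

context embedded_variety
begin

lemma pts_nonempty: "pts X \<noteq> {}"
  using irreducible by (simp add: irreducible_in_def)

lemma reg_one: "openin (tsp X) W \<Longrightarrow> (\<lambda>_. 1) \<in> reg X W"
  by (rule reg_const)

lemma wedge_section:
  assumes W: "openin (tsp X) W" and vs: "\<And>x. x \<in> W \<Longrightarrow> vectorspace CC (fib B x)"
    and s: "\<And>j. j \<in> set js \<Longrightarrow> (\<lambda>x\<in>W. d j x) \<in> sect B W"
    and carr: "\<And>j x. j \<in> set js \<Longrightarrow> x \<in> W \<Longrightarrow> d j x \<in> carrier (fib B x)"
    and len: "length js = m"
  shows "(\<lambda>x\<in>W. wedge_elt m (fib B x) (map (\<lambda>j. d j x) js)) \<in> sect (wedge_bundle X m B) W"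
  unfolding wedge_bundle_def vbundle.simps
proof (rule generated_sectionsI[OF reg_one])
  show "vectorspace CC (wedge_vs m (fib B x))" if "x \<in> W" for x
    by (rule wedge_vs_vectorspace[OF vs[OF that]])
  have tup: "map (\<lambda>j. d j x) js \<in> tuples m (carrier (fib B x))" if "x \<in> W" for x
    using carr that len by (auto simp: tuples_def)
  show "(\<lambda>x\<in>W. wedge_elt m (fib B x) (map (\<lambda>j. d j x) js)) \<in> (\<Pi>\<^sub>E x\<in>W. carrier (wedge_vs m (fib B x)))"
    using wedge_elt_carrier[OF vs tup] by auto
  fix x assume x: "x \<in> W"
  let ?ss = "map (\<lambda>j. \<lambda>x\<in>W. d j x) js"
  let ?g = "\<lambda>x. wedge_elt m (fib B x) (map (\<lambda>s. s x) ?ss)"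
  have ss: "?ss \<in> tuples m (sect B W)" using s len by (auto simp: tuples_def)
  have "(\<lambda>x\<in>W. wedge_elt m (fib B x) (map (\<lambda>j. d j x) js)) y = ?g y" if "y \<in> W" for y
  proof -
    have "map (\<lambda>s. s y) ?ss = map (\<lambda>j. d j y) js" using that by simp
    then show ?thesis using that by (simp only: restrict_apply if_True)
  qed
  then show "\<exists>V. openin (tsp X) V \<and> x \<in> V \<and> V \<subseteq> W \<and>
      (\<exists>g\<in>{\<lambda>x. wedge_elt m (fib B x) (map (\<lambda>s. s x) ss) | ss. ss \<in> tuples m (sect B V)}.
        \<forall>y\<in>V. (\<lambda>x\<in>W. wedge_elt m (fib B x) (map (\<lambda>j. d j x) js)) y = g y)"
    using W x ss
    by (intro exI[of _ W] conjI bexI[of _ ?g] CollectI exI[of _ ?ss] ballI order_refl refl)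
qed

lemma tensor_section:
  assumes U: "\<And>x. x \<in> U \<Longrightarrow> \<exists>W. openin (tsp X) W \<and> x \<in> W \<and> W \<subseteq> U \<and>
      (\<exists>s\<in>sect E W. \<exists>t\<in>sect F W. \<forall>y\<in>W. \<sigma> y = tensor_elt (fib E y) (fib F y) (s y) (t y))"
    and E: "\<And>x. x \<in> U \<Longrightarrow> vectorspace CC (fib E x)" and F: "\<And>x. x \<in> U \<Longrightarrow> vectorspace CC (fib F x)"
    and \<sigma>: "\<sigma> \<in> (\<Pi>\<^sub>E x\<in>U. carrier (tensor_vs (fib E x) (fib F x)))"
  shows "\<sigma> \<in> sect (tensor_bundle X E F) U"
  unfolding tensor_bundle_def vbundle.simps
proof (rule generated_sectionsI[OF reg_one _ \<sigma>])
  show "vectorspace CC (tensor_vs (fib E x) (fib F x))" if "x \<in> U" for x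
    by (rule tensor_vs_vectorspace[OF E[OF that] F[OF that]])
  fix x assume "x \<in> U"
  from U[OF this] obtain W s t where W: "openin (tsp X) W" "x \<in> W" "W \<subseteq> U" "s \<in> sect E W" "t \<in> sect F W"
    and st: "\<forall>y\<in>W. \<sigma> y = tensor_elt (fib E y) (fib F y) (s y) (t y)"
    by blast
  show "\<exists>W. openin (tsp X) W \<and> x \<in> W \<and> W \<subseteq> U \<and>
      (\<exists>g\<in>{\<lambda>x. tensor_elt (fib E x) (fib F x) (s x) (t x) | s t. s \<in> sect E W \<and> t \<in> sect F W}. \<forall>y\<in>W. \<sigma> y = g y)"
    by (intro exI[of _ W] conjI bexI[of _ "\<lambda>x. tensor_elt (fib E x) (fib F x) (s x) (t x)"]
        CollectI exI[of _ s] exI[of _ t] W st refl)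
qed

end

text \<open>Replaces a list of vectors at one point by a list of indices, which then makes sense at
  all points.\<close>

lemma tuples_image:
  assumes "vs \<in> tuples m (f ` A)"
  shows "\<exists>xs\<in>tuples m A. vs = map f xs"
proof -
  have "\<forall>v\<in>set vs. \<exists>a\<in>A. v = f a" using assms by (auto simp: tuples_def)
  then obtain g where g: "\<And>v. v \<in> set vs \<Longrightarrow> g v \<in> A \<and> f (g v) = v" by metis
  then have "map f (map g vs) = vs" by (simp add: map_idI)
  moreover have "map g vs \<in> tuples m A" using assms g by (auto simp: tuples_def)
  ultimately show ?thesis by metis
qed

context polarized_variety
begin

text \<open>The argument common to both bundles. All that is asked of \<open>B\<close> is vector
  space fibres of dimension at least \<open>m\<close> and fields \<open>d l j\<close> on the charts
  that generate each fibre and scale with the coordinate ratio.\<close>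

lemma twisted_wedge_not_ulrich:
  fixes B :: "('x, 'v) vbundle" and d :: "nat \<Rightarrow> nat \<Rightarrow> 'x \<Rightarrow> 'v" and k :: int
  assumes vs: "\<And>x. x \<in> pts X \<Longrightarrow> vectorspace CC (fib B x)"
    and dim: "\<And>x. x \<in> pts X \<Longrightarrow> m \<le> vectorspace.dim CC (fib B x)"
    and carr: "\<And>l j x. l \<le> N \<Longrightarrow> j \<le> N \<Longrightarrow> x \<in> chart_domain l \<Longrightarrow> d l j x \<in> carrier (fib B x)"
    and span: "\<And>l x. l \<le> N \<Longrightarrow> x \<in> chart_domain l \<Longrightarrow>
      linear_span (fib B x) ((\<lambda>j. d l j x) ` {..N}) = carrier (fib B x)"
    and sec: "\<And>l j. l \<le> N \<Longrightarrow> j \<le> N \<Longrightarrow> (\<lambda>x\<in>chart_domain l. d l j x) \<in> sect B (chart_domain l)"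
    and change: "\<And>l l' j x. l \<le> N \<Longrightarrow> l' \<le> N \<Longrightarrow> j \<le> N \<Longrightarrow> x \<in> chart_domain l \<Longrightarrow> x \<in> chart_domain l' \<Longrightarrow>
      d l' j x = dehom l (\<iota> x) l' \<odot>\<^bsub>fib B x\<^esub> d l j x"
    and i: "1 \<le> k + int m" "enat (nat (k + int m)) \<le> dimension X"
  shows "\<not> ulrich X H (twist X H (wedge_bundle X m B) k)"
proof -
  let ?i = "- (k + int m)"
  let ?L1 = "divisor_bundle X (divisor_multiple k H)" and ?L2 = "divisor_bundle X (divisor_multiple ?i H)"
  let ?W = "wedge_bundle X m B"
  let ?E1 = "twist X H ?W k"
  let ?E2 = "twist X H ?E1 ?i"
  have cdX: "chart_domain l \<subseteq> pts X" for l by (auto simp: chart_domain_def)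
  have Wvs: "vectorspace CC (fib ?W x)" if "x \<in> pts X" for x
    unfolding fib_wedge_bundle by (rule wedge_vs_vectorspace[OF vs[OF that]])
  have E1vs: "vectorspace CC (fib ?E1 x)" if "x \<in> pts X" for x
    unfolding fib_twist by (rule tensor_vs_vectorspace[OF Wvs[OF that] divisor_bundle_vectorspace])
  have E2vs: "vectorspace CC (fib ?E2 x)" if "x \<in> pts X" for x
    unfolding fib_twist[of X H ?E1] by (rule tensor_vs_vectorspace[OF E1vs[OF that] divisor_bundle_vectorspace])
  obtain x0 where x0: "x0 \<in> pts X" using pts_nonempty by blast
  obtain l0 where l0: "l0 \<le> N" "x0 \<in> chart_domain l0" using chart_domain_covers[OF x0] by blast
  let ?S = "(\<lambda>j. d l0 j x0) ` {..N}"
  have S: "finite ?S" "?S \<subseteq> carrier (fib B x0)" using carr l0 by auto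
  \<comment> \<open>The \<open>m\<close> fields are selected for independence at \<open>x0\<close>
    alone; elsewhere their exterior product may vanish.\<close>
  obtain us a where us: "us \<in> tuples m ?S" "\<forall>j<m. functional (fib B x0) (a j)"
      "\<forall>i<m. \<forall>j<m. a j (us ! i) = of_bool (i = j)"
    using dual_family_exists[OF vs[OF x0] S span[OF l0] dim[OF x0]] by blast
  obtain js where js: "js \<in> tuples m {..N}" "us = map (\<lambda>j. d l0 j x0) js"
    using tuples_image[OF us(1)] by blast
  have jsN: "j \<le> N" if "j \<in> set js" for j using js(1) that by (auto simp: tuples_def)
  have len: "length js = m" using js(1) by (simp add: tuples_def)
  define \<omega> where "\<omega> l x = wedge_elt m (fib B x) (map (\<lambda>j. d l j x) js)" for l x
  define \<tau>1 where "\<tau>1 l x = tensor_elt (fib ?W x) (fib ?L1 x) (\<omega> l x) (power_frame k l x)" for l x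
  define \<tau>2 where "\<tau>2 l x = tensor_elt (fib ?E1 x) (fib ?L2 x) (\<tau>1 l x) (power_frame ?i l x)" for l x
  have tup: "map (\<lambda>j. d l j x) js \<in> tuples m (carrier (fib B x))" if "l \<le> N" "x \<in> chart_domain l" for l x
    using carr[OF that(1) _ that(2)] jsN len by (auto simp: tuples_def)
  have \<omega>c: "\<omega> l x \<in> carrier (fib ?W x)" if "l \<le> N" "x \<in> chart_domain l" for l x
    unfolding \<omega>_def fib_wedge_bundle
    by (rule wedge_elt_carrier[OF vs tup[OF that]]) (use that cdX in blast)
  have \<tau>1c: "\<tau>1 l x \<in> carrier (fib ?E1 x)" if "l \<le> N" "x \<in> chart_domain l" for l x
    unfolding \<tau>1_def fib_twist
    by (rule tensor_elt_carrier[OF Wvs divisor_bundle_vectorspace \<omega>c[OF that] power_frame_carrier[OF that(1)]])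
      (use that cdX in blast)
  have \<tau>2c: "\<tau>2 l x \<in> carrier (fib ?E2 x)" if "l \<le> N" "x \<in> chart_domain l" for l x
    unfolding \<tau>2_def fib_twist[of X H ?E1]
    by (rule tensor_elt_carrier[OF E1vs divisor_bundle_vectorspace \<tau>1c[OF that] power_frame_carrier[OF that(1)]])
      (use that cdX in blast)
  \<comment> \<open>With \<open>?c\<close> the ratio of coordinates, the exterior product
    contributes \<open>?c\<close> to the power \<open>m\<close> and the two frames the powers
    \<open>k\<close> and \<open>?i\<close>; the exponents sum to 0, and \<open>?c\<close> is
    nonzero, so they may be added.\<close>
  have \<tau>2_change: "\<tau>2 l' x = \<tau>2 l x"
    if l: "l \<le> N" "l' \<le> N" and x: "x \<in> chart_domain l" "x \<in> chart_domain l'" for l l' x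
  proof -
    let ?c = "dehom l (\<iota> x) l'"
    have xX: "x \<in> pts X" using x cdX by blast
    have c0: "?c \<noteq> 0"
      using chart_field_change(2)[of "\<iota> x" N l l' l'] x l by (simp add: chart_domain_def)
    have "map (\<lambda>j. d l' j x) js = map (\<lambda>v. ?c \<odot>\<^bsub>fib B x\<^esub> v) (map (\<lambda>j. d l j x) js)"
      using change[OF l _ x] jsN by simp
    then have \<omega>: "\<omega> l' x = (?c ^ m) \<odot>\<^bsub>fib ?W x\<^esub> \<omega> l x"
      unfolding \<omega>_def fib_wedge_bundle by (simp only: wedge_elt_smult[OF vs[OF xX] tup[OF l(1) x(1)]])
    have pf: "power_frame t l' x = (?c powi t) \<odot>\<^bsub>fib (divisor_bundle X (divisor_multiple t H)) x\<^esub> power_frame t l x" for t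
      unfolding divisor_bundle_fibre by (rule power_frame_change[OF l x])
    have \<tau>1: "\<tau>1 l' x = (?c ^ m * ?c powi k) \<odot>\<^bsub>fib ?E1 x\<^esub> \<tau>1 l x"
      unfolding \<tau>1_def \<omega> pf fib_twist
      by (rule tensor_elt_smult[OF Wvs[OF xX] divisor_bundle_vectorspace \<omega>c[OF l(1) x(1)] power_frame_carrier[OF l(1)]])
    have "\<tau>2 l' x = (?c ^ m * ?c powi k * ?c powi ?i) \<odot>\<^bsub>fib ?E2 x\<^esub> \<tau>2 l x"
      unfolding \<tau>2_def \<tau>1 pf fib_twist[of X H ?E1]
      by (rule tensor_elt_smult[OF E1vs[OF xX] divisor_bundle_vectorspace \<tau>1c[OF l(1) x(1)] power_frame_carrier[OF l(1)]])
    also have "?c ^ m * ?c powi k * ?c powi ?i = ?c powi (int m + k + ?i)"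
      unfolding power_int_add[OF disjI1[OF c0]] power_int_of_nat by (rule refl)
    also have "\<dots> = 1" by simp
    also have "1 \<odot>\<^bsub>fib ?E2 x\<^esub> \<tau>2 l x = \<tau>2 l x"
    proof -
      interpret V: vectorspace CC "fib ?E2 x" by (rule E2vs[OF xX])
      show ?thesis using V.smult_one[OF \<tau>2c[OF l(1) x(1)]] by simp
    qed
    finally show ?thesis .
  qed
  \<comment> \<open>Gluing by choosing any chart at each point; \<open>\<tau>2_change\<close> makes
    the choice irrelevant.\<close>
  define \<sigma> where "\<sigma> = (\<lambda>x\<in>pts X. \<tau>2 (SOME l. l \<le> N \<and> x \<in> chart_domain l) x)"
  have \<sigma>: "\<sigma> x = \<tau>2 l x" if "l \<le> N" "x \<in> chart_domain l" for l x
  proof -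
    define l' where "l' = (SOME l. l \<le> N \<and> x \<in> chart_domain l)"
    have l': "l' \<le> N" "x \<in> chart_domain l'"
      using someI[of "\<lambda>l. l \<le> N \<and> x \<in> chart_domain l" l] that unfolding l'_def by blast+
    have "\<sigma> x = \<tau>2 l' x" using that(2) cdX unfolding \<sigma>_def l'_def by (simp add: subset_iff)
    also have "\<dots> = \<tau>2 l x" by (rule \<tau>2_change[OF that(1) l'(1) that(2) l'(2)])
    finally show ?thesis .
  qed
  have \<sigma>c: "\<sigma> x \<in> carrier (fib ?E2 x)" if "x \<in> pts X" for x
  proof -
    from chart_domain_covers[OF that] obtain l where l: "l \<le> N" "x \<in> chart_domain l" by (elim exE conjE)
    show ?thesis unfolding \<sigma>[OF l] by (rule \<tau>2c[OF l])
  qed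
  have \<omega>_sec: "(\<lambda>x\<in>chart_domain l. \<omega> l x) \<in> sect ?W (chart_domain l)" if l: "l \<le> N" for l
    unfolding \<omega>_def
  proof (rule wedge_section[where d = "d l" and B = B and js = js, OF openin_chart_domain[OF l]])
    show "vectorspace CC (fib B x)" if "x \<in> chart_domain l" for x by (rule vs[OF subsetD[OF cdX that]])
    show "(\<lambda>x\<in>chart_domain l. d l j x) \<in> sect B (chart_domain l)" if "j \<in> set js" for j
      by (rule sec[OF l jsN[OF that]])
    show "d l j x \<in> carrier (fib B x)" if "j \<in> set js" "x \<in> chart_domain l" for j x
      by (rule carr[OF l jsN[OF that(1)] that(2)])
  qed (rule len)
  have \<tau>1_sec: "(\<lambda>x\<in>chart_domain l. \<tau>1 l x) \<in> sect ?E1 (chart_domain l)" if l: "l \<le> N" for l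
    unfolding twist_def
  proof (rule tensor_section)
    show "vectorspace CC (fib ?W x)" if "x \<in> chart_domain l" for x using Wvs cdX that by blast
    show "vectorspace CC (fib ?L1 x)" for x by (rule divisor_bundle_vectorspace)
    show "(\<lambda>x\<in>chart_domain l. \<tau>1 l x) \<in> (\<Pi>\<^sub>E x\<in>chart_domain l. carrier (tensor_vs (fib ?W x) (fib ?L1 x)))"
      using \<tau>1c[OF l] by (simp add: fib_twist)
    show "\<exists>V. openin (tsp X) V \<and> x \<in> V \<and> V \<subseteq> chart_domain l \<and>
        (\<exists>s\<in>sect ?W V. \<exists>t\<in>sect ?L1 V. \<forall>y\<in>V. (\<lambda>x\<in>chart_domain l. \<tau>1 l x) y = tensor_elt (fib ?W y) (fib ?L1 y) (s y) (t y))"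
      if "x \<in> chart_domain l" for x
      by (intro exI[of _ "chart_domain l"] conjI bexI[of _ "\<lambda>x\<in>chart_domain l. \<omega> l x"] ballI
          bexI[of _ "\<lambda>x\<in>chart_domain l. power_frame k l x"] that openin_chart_domain[OF l] order_refl
          \<omega>_sec[OF l] power_frame_section[OF l]) (simp only: \<tau>1_def restrict_apply if_True)
  qed
  have \<sigma>_sec: "\<sigma> \<in> sect ?E2 (pts X)"
    unfolding twist_def[of X H ?E1]
  proof (rule tensor_section)
    show "vectorspace CC (fib ?E1 x)" if "x \<in> pts X" for x by (rule E1vs[OF that])
    show "vectorspace CC (fib ?L2 x)" for x by (rule divisor_bundle_vectorspace)
    show "\<sigma> \<in> (\<Pi>\<^sub>E x\<in>pts X. carrier (tensor_vs (fib ?E1 x) (fib ?L2 x)))"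
      using \<sigma>c unfolding fib_twist[of X H ?E1] by (auto simp: \<sigma>_def)
    fix x assume "x \<in> pts X"
    then obtain l where l: "l \<le> N" "x \<in> chart_domain l" using chart_domain_covers by blast
    show "\<exists>V. openin (tsp X) V \<and> x \<in> V \<and> V \<subseteq> pts X \<and>
        (\<exists>s\<in>sect ?E1 V. \<exists>t\<in>sect ?L2 V. \<forall>y\<in>V. \<sigma> y = tensor_elt (fib ?E1 y) (fib ?L2 y) (s y) (t y))"
      by (intro exI[of _ "chart_domain l"] conjI bexI[of _ "\<lambda>x\<in>chart_domain l. \<tau>1 l x"] ballI
          bexI[of _ "\<lambda>x\<in>chart_domain l. power_frame ?i l x"] l(2) openin_chart_domain[OF l(1)] cdX
          \<tau>1_sec[OF l(1)] power_frame_section[OF l(1)])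
        (simp only: \<sigma>[OF l(1)] \<tau>2_def restrict_apply if_True)
  qed
  have zero_sec: "(\<lambda>x\<in>pts X. \<zero>\<^bsub>fib ?E2 x\<^esub>) \<in> sect ?E2 (pts X)"
    unfolding fib_twist[of X H ?E1]
    unfolding twist_def[of X H ?E1] tensor_bundle_def vbundle.simps
    by (rule generated_sections_zero) (use E2vs in \<open>simp_all add: fib_twist[of X H ?E1]\<close>)
  have \<sigma>_x0: "\<sigma> x0 \<noteq> \<zero>\<^bsub>fib ?E2 x0\<^esub>"
  proof -
    have us0: "us \<in> tuples m (carrier (fib B x0))" unfolding js(2) by (rule tup[OF l0])
    \<comment> \<open>A form with value 1 on the exterior product is extended through the two tensor
      factors; its value on the section is a product of nonzero numbers.\<close>
    obtain K where K: "functional (fib ?W x0) K" "K (\<omega> l0 x0) = 1"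
      using wedge_elt_nonzero[OF vs[OF x0] us0, of a] us(2,3) unfolding fib_wedge_bundle \<omega>_def js(2) by blast
    obtain M1 where M1: "functional (fib ?L1 x0) M1" "M1 (power_frame k l0 x0) \<noteq> 0"
      using power_frame_functional[OF l0] by blast
    obtain M2 where M2: "functional (fib ?L2 x0) M2" "M2 (power_frame ?i l0 x0) \<noteq> 0"
      using power_frame_functional[OF l0] by blast
    obtain K1 where K1: "functional (fib ?E1 x0) K1" "K1 (\<tau>1 l0 x0) = K (\<omega> l0 x0) * M1 (power_frame k l0 x0)"
      using tensor_functional[OF Wvs[OF x0] divisor_bundle_vectorspace K(1) M1(1)]
        \<omega>c[OF l0] power_frame_carrier[OF l0(1)] unfolding fib_twist \<tau>1_def by blast
    obtain K2 where K2: "functional (fib ?E2 x0) K2" "K2 (\<tau>2 l0 x0) = K1 (\<tau>1 l0 x0) * M2 (power_frame ?i l0 x0)"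
      using tensor_functional[OF E1vs[OF x0] divisor_bundle_vectorspace K1(1) M2(1)]
        \<tau>1c[OF l0] power_frame_carrier[OF l0(1)] unfolding fib_twist[of X H ?E1] \<tau>2_def by blast
    have "K2 (\<sigma> x0) \<noteq> 0" unfolding \<sigma>[OF l0] K2(2) K1(2) K(2) using M1(2) M2(2) by simp
    then show ?thesis using functional_zero[OF E2vs[OF x0] K2(1)] by auto
  qed
  have nonvanishing: "\<not> cohomology_vanishes X ?E2 0"
    by (rule cohomology_0_nonvanishing[OF E2vs \<sigma>_sec \<sigma>c zero_sec x0 \<sigma>_x0])
  \<comment> \<open>The Ulrich index is a natural number whereas \<open>k\<close> may be negative;
    the bound \<open>1 \<le> k + int m\<close> makes the conversion exact.\<close>
  have "- int (nat (k + int m)) = ?i" using i(1) by simp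
  moreover have "1 \<le> nat (k + int m)" using i(1) by simp
  ultimately have "ulrich X H ?E1 \<Longrightarrow> cohomology_vanishes X ?E2 0"
    unfolding ulrich_def using i(2) by (elim allE[of _ "nat (k + int m)"] allE[of _ "0::nat"]) simp
  with nonvanishing show ?thesis by blast
qed

end

section \<open>The restricted tangent bundle and the normal bundle\<close>

context embedded_variety
begin

lemma restricted_tangent_bundle_fibre:
  "fib T x = ambient_tangent x"
  by (simp add: restricted_tangent_bundle_def pullback_bundle_def tangent_bundle_def)

lemma normal_bundle_fibre:
  "fib NX x = quot_vs (ambient_tangent x)
     (tangent_map x ` carrier (tangent_space X x))"
  by (simp add: normal_bundle_def quotient_bundle_def restricted_tangent_bundle_fibre)

lemma chart_rep:
  assumes "x \<in> pts X"
  obtains l v where "l \<le> N" "coords N v" "v l = 1" "\<iota> x = hline v"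
proof -
  obtain w where w: "coords N w" "\<iota> x = hline w" using iota_points[OF assms] by (rule proj_pointsE)
  obtain l where l: "w l \<noteq> 0" "l \<le> N" using w(1) unfolding coords_def by (meson not_le)
  have "\<iota> x \<in> chart N l"
    using w l hline_nonvanishing[OF hom_poly_var[OF l(2)] w(1)] by simp
  then obtain v where "coords N v" "v l = 1" "\<iota> x = hline v" by (rule chartE)
  then show ?thesis by (rule that[OF l(2)])
qed

lemma tangent_dim:
  assumes "x \<in> pts X"
  shows "vectorspace.fin_dim CC (ambient_tangent x)"
    and "vectorspace.dim CC (ambient_tangent x) = N"
proof -
  obtain l v where v: "l \<le> N" "coords N v" "v l = 1" "\<iota> x = hline v" using assms by (rule chart_rep)
  show "vectorspace.fin_dim CC (ambient_tangent x)"
    "vectorspace.dim CC (ambient_tangent x) = N"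
    unfolding v(4) by (rule proj_space_tangent_basis[OF v(2,3,1)])+
qed

lemma tangent_image_submodule:
  assumes "x \<in> pts X"
  shows "submodule CC (tangent_map x ` carrier (tangent_space X x))
    (ambient_tangent x)"
proof -
  interpret d: linear_map CC "tangent_space X x" "ambient_tangent x" "tangent_map x"
    by (rule differential_linear[OF assms])
  show ?thesis using d.im_is_submodule unfolding d.im_def .
qed

text \<open>Smoothness gives each tangent space of X dimension \<open>n\<close>, which the injective
  differential preserves; the quotient has the complementary dimension. The subtraction is not
  truncated, since the dimensions add up to \<open>N\<close>.\<close>

lemma normal_dim:
  assumes x: "x \<in> pts X" and smooth: "smooth X" and n: "dimension X = enat n"
  shows "vectorspace.fin_dim CC (fib NX x)"
    and "vectorspace.dim CC (fib NX x) = N - n"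
proof -
  let ?T = "ambient_tangent x"
  let ?F = "tangent_map x ` carrier (tangent_space X x)"
  have X: "vectorspace.fin_dim CC (tangent_space X x)" "vectorspace.dim CC (tangent_space X x) = n"
    using smooth x n unfolding smooth_def by auto
  have "vectorspace.dim CC (?T\<lparr>carrier := ?F\<rparr>) = n"
    unfolding X(2)[symmetric]
    by (rule linear_map_image_dim[OF differential_linear[OF x] X(1) differential_injective[OF x]])
  moreover note Q = quot_vs_dim[OF tangent_space_vectorspace tangent_image_submodule[OF x] tangent_dim(1)[OF x]]
  ultimately show "vectorspace.fin_dim CC (fib NX x)"
    "vectorspace.dim CC (fib NX x) = N - n"
    using tangent_dim(2)[OF x] unfolding normal_bundle_fibre by simp_all
qed

end

context polarized_variety
begin

text \<open>The field on the chart pulled back along the embedding: its value at \<open>x\<close>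
  uses the representative of the image point with \<open>l\<close>-th coordinate 1.\<close>

definition chart_field :: "nat \<Rightarrow> nat \<Rightarrow> 'x \<Rightarrow> ((nat \<Rightarrow> complex) set \<Rightarrow> complex) \<Rightarrow> complex" where
  "chart_field l j x = dir_deriv N j (dehom l (\<iota> x))"

abbreviation "TX x \<equiv> tangent_map x ` carrier (tangent_space X x)"

lemma chart_field_carrier:
  assumes "j \<le> N" "x \<in> chart_domain l"
  shows "chart_field l j x \<in> carrier (ambient_tangent x)"
proof -
  have "\<iota> x \<in> chart N l" using assms(2) by (simp add: chart_domain_def)
  then obtain v where v: "coords N v" "\<iota> x = hline v" "dehom l (\<iota> x) = v" by (rule chartE)
  show ?thesis
    using dir_deriv_point_derivation[OF v(1) assms(1)]
    by (simp add: chart_field_def v(3) tangent_space_simps) (simp add: v(2))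
qed

lemma chart_field_span:
  assumes "l \<le> N" "x \<in> chart_domain l"
  shows "linear_span (ambient_tangent x) ((\<lambda>j. chart_field l j x) ` {..N})
    = carrier (ambient_tangent x)"
proof -
  have "\<iota> x \<in> chart N l" using assms(2) by (simp add: chart_domain_def)
  then obtain v where v: "coords N v" "v l = 1" "\<iota> x = hline v" "dehom l (\<iota> x) = v" by (rule chartE)
  have "(\<lambda>j. chart_field l j x) = (\<lambda>j. dir_deriv N j v)" by (simp add: chart_field_def v(4))
  then show ?thesis using proj_space_tangent_basis(3)[OF v(1,2) assms(1)] by (simp only: v(3))
qed

lemma chart_field_change_domain:
  assumes "j \<le> N" "x \<in> chart_domain l" "x \<in> chart_domain l'"
  shows "chart_field l' j x = dehom l (\<iota> x) l' \<odot>\<^bsub>ambient_tangent x\<^esub> chart_field l j x"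
  unfolding chart_field_def tangent_space_simps
  by (rule chart_field_change(1)) (use assms in \<open>simp_all add: chart_domain_def\<close>)

text \<open>The field on the ambient chart is itself a generator of the pullback over the whole
  chart domain.\<close>

lemma chart_field_pullback_section:
  assumes l: "l \<le> N" and j: "j \<le> N"
  shows "(\<lambda>x\<in>chart_domain l. chart_field l j x) \<in> sect T (chart_domain l)"
  unfolding restricted_tangent_bundle_def pullback_bundle_def vbundle.simps
proof (rule generated_sectionsI[OF reg_one])
  have fib: "fib (tangent_bundle (proj_space N)) p = tangent_space (proj_space N) p" for p
    by (simp add: tangent_bundle_def)
  show "vectorspace CC (fib (tangent_bundle (proj_space N)) (\<iota> x))" for x
    unfolding fib by (rule tangent_space_vectorspace)
  show "(\<lambda>x\<in>chart_domain l. chart_field l j x) \<in>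
      (\<Pi>\<^sub>E x\<in>chart_domain l. carrier (fib (tangent_bundle (proj_space N)) (\<iota> x)))"
    using chart_field_carrier[OF j] unfolding fib by simp
  fix x assume x: "x \<in> chart_domain l"
  let ?s = "\<lambda>p\<in>chart N l. dir_deriv N j (dehom l p)"
  have eq: "(\<lambda>x\<in>chart_domain l. chart_field l j x) y = ?s (\<iota> y)" if "y \<in> chart_domain l" for y
    using that by (simp add: chart_field_def chart_domain_def)
  have im: "\<iota> ` chart_domain l \<subseteq> chart N l" by (auto simp: chart_domain_def)
  show "\<exists>W. openin (tsp X) W \<and> x \<in> W \<and> W \<subseteq> chart_domain l \<and>
      (\<exists>g\<in>{\<lambda>x. s (\<iota> x) | s V. zariski_open N V \<and> \<iota> ` W \<subseteq> V \<and> s \<in> sect (tangent_bundle (proj_space N)) V}.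
        \<forall>y\<in>W. (\<lambda>x\<in>chart_domain l. chart_field l j x) y = g y)"
    by (intro exI[of _ "chart_domain l"] conjI bexI[of _ "\<lambda>x. ?s (\<iota> x)"] CollectI exI[of _ ?s]
        exI[of _ "chart N l"] ballI eq im x order_refl refl openin_chart_domain[OF l]
        openin_nonvanishing[OF hom_poly_var[OF l]] chart_field_section[OF l j])
qed

lemma restricted_tangent_not_ulrich:
  fixes k :: int
  assumes m: "m \<le> bundle_rank X T"
    and i: "1 \<le> k + int m" "enat (nat (k + int m)) \<le> dimension X"
  shows "\<not> ulrich X H (twist X H (wedge_bundle X m T) k)"
proof (rule twisted_wedge_not_ulrich[where d = chart_field])
  have "bundle_rank X T = N"
    by (rule bundle_rank_eq[OF pts_nonempty]) (simp add: restricted_tangent_bundle_fibre tangent_dim)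
  then show "m \<le> vectorspace.dim CC (fib T x)" if "x \<in> pts X" for x
    using m tangent_dim(2)[OF that] by (simp add: restricted_tangent_bundle_fibre)
  show "vectorspace CC (fib T x)" for x
    unfolding restricted_tangent_bundle_fibre by (rule tangent_space_vectorspace)
  show "chart_field l j x \<in> carrier (fib T x)" if "j \<le> N" "x \<in> chart_domain l" for l j x
    unfolding restricted_tangent_bundle_fibre by (rule chart_field_carrier[OF that])
  show "linear_span (fib T x) ((\<lambda>j. chart_field l j x) ` {..N}) = carrier (fib T x)"
    if "l \<le> N" "x \<in> chart_domain l" for l x
    unfolding restricted_tangent_bundle_fibre by (rule chart_field_span[OF that])
  show "chart_field l' j x = dehom l (\<iota> x) l' \<odot>\<^bsub>fib T x\<^esub> chart_field l j x"
    if "j \<le> N" "x \<in> chart_domain l" "x \<in> chart_domain l'" for l l' j x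
    unfolding restricted_tangent_bundle_fibre by (rule chart_field_change_domain[OF that])
  show "(\<lambda>x\<in>chart_domain l. chart_field l j x) \<in> sect T (chart_domain l)" if "l \<le> N" "j \<le> N" for l j
    by (rule chart_field_pullback_section[OF that])
qed (rule i)+

text \<open>The fibrewise projection from the restricted tangent bundle is linear and onto, so the
  classes of the chart fields inherit generation and scaling.\<close>

lemma normal_not_ulrich:
  fixes k :: int
  assumes smooth: "smooth X" "dimension X = enat n" and m: "m \<le> bundle_rank X NX"
    and i: "1 \<le> k + int m" "enat (nat (k + int m)) \<le> dimension X"
  shows "\<not> ulrich X H (twist X H (wedge_bundle X m NX) k)"
proof -
  let ?P = "\<lambda>x. ambient_tangent x"
  define d where "d l j x = TX x +>\<^bsub>?P x\<^esub> chart_field l j x" for l j x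
  have cdX: "x \<in> pts X" if "x \<in> chart_domain l" for x l using that by (simp add: chart_domain_def)
  note Q = quot_vs_hom[OF tangent_space_vectorspace tangent_image_submodule, folded normal_bundle_fibre]
  have carr: "d l j x \<in> carrier (fib NX x)" if "j \<le> N" "x \<in> chart_domain l" for l j x
    using Q(3)[OF cdX[OF that(2)]] chart_field_carrier[OF that] unfolding d_def by blast
  show ?thesis
  proof (rule twisted_wedge_not_ulrich[where d = d])
    have "bundle_rank X NX = N - n"
      by (rule bundle_rank_eq[OF pts_nonempty]) (simp add: normal_dim[OF _ smooth])
    then show "m \<le> vectorspace.dim CC (fib NX x)" if "x \<in> pts X" for x
      using m normal_dim(2)[OF that smooth] by simp
    show "vectorspace CC (fib NX x)" if "x \<in> pts X" for x by (rule Q(1)[OF that])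
    show "d l j x \<in> carrier (fib NX x)" if "j \<le> N" "x \<in> chart_domain l" for l j x by (rule carr[OF that])
    show "linear_span (fib NX x) ((\<lambda>j. d l j x) ` {..N}) = carrier (fib NX x)"
      if l: "l \<le> N" and x: "x \<in> chart_domain l" for l x
    proof -
      have "(\<lambda>j. chart_field l j x) ` {..N} \<subseteq> carrier (?P x)" using chart_field_carrier[OF _ x] by auto
      from linear_map_span_image[OF Q(2)[OF cdX[OF x]] this chart_field_span[OF l x] Q(3)[OF cdX[OF x]]]
      show ?thesis unfolding d_def image_image .
    qed
    show "d l' j x = dehom l (\<iota> x) l' \<odot>\<^bsub>fib NX x\<^esub> d l j x"
      if j: "j \<le> N" and x: "x \<in> chart_domain l" "x \<in> chart_domain l'" for l l' j x
    proof -
      interpret h: linear_map CC "?P x" "fib NX x" "\<lambda>v. TX x +>\<^bsub>?P x\<^esub> v" by (rule Q(2)[OF cdX[OF x(1)]])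
      show ?thesis
        unfolding d_def chart_field_change_domain[OF j x]
        by (rule h.f_smult) (use chart_field_carrier[OF j x(1)] in simp_all)
    qed
    show "(\<lambda>x\<in>chart_domain l. d l j x) \<in> sect NX (chart_domain l)" if l: "l \<le> N" and j: "j \<le> N" for l j
      unfolding normal_bundle_def quotient_bundle_def vbundle.simps
    proof (rule generated_sectionsI[OF reg_one])
      note fib = normal_bundle_fibre[unfolded restricted_tangent_bundle_fibre[symmetric], symmetric]
      show "vectorspace CC (quot_vs (fib T x) (TX x))" if "x \<in> chart_domain l" for x
        unfolding fib by (rule Q(1)[OF cdX[OF that]])
      show "(\<lambda>x\<in>chart_domain l. d l j x) \<in> (\<Pi>\<^sub>E x\<in>chart_domain l. carrier (quot_vs (fib T x) (TX x)))"
        unfolding fib using carr[OF j] by simp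
      fix x assume x: "x \<in> chart_domain l"
      let ?s = "\<lambda>x\<in>chart_domain l. chart_field l j x"
      have eq: "(\<lambda>x\<in>chart_domain l. d l j x) y = TX y +>\<^bsub>fib T y\<^esub> ?s y" if "y \<in> chart_domain l" for y
        using that by (simp add: d_def restricted_tangent_bundle_fibre)
      show "\<exists>W. openin (tsp X) W \<and> x \<in> W \<and> W \<subseteq> chart_domain l \<and>
          (\<exists>g\<in>{\<lambda>x. TX x +>\<^bsub>fib T x\<^esub> s x | s. s \<in> sect T W}. \<forall>y\<in>W. (\<lambda>x\<in>chart_domain l. d l j x) y = g y)"
        by (intro exI[of _ "chart_domain l"] conjI bexI[of _ "\<lambda>x. TX x +>\<^bsub>fib T x\<^esub> ?s x"] CollectI exI[of _ ?s]
            ballI eq x order_refl refl openin_chart_domain[OF l] chart_field_pullback_section[OF l j])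
    qed
  qed (use i in auto)
qed

end

section \<open>The embedding defined by a very ample divisor\<close>

text \<open>The basis condition in \<open>embedding_defined_by\<close> can be unfolded only for a
  proven vector space. All axioms hold fibrewise.\<close>

lemma section_space_vectorspace:
  assumes vs: "\<And>x. x \<in> U \<Longrightarrow> vectorspace CC (fib E x)"
    and carr: "sect E U \<subseteq> (\<Pi>\<^sub>E x\<in>U. carrier (fib E x))"
    and zero: "(\<lambda>x\<in>U. \<zero>\<^bsub>fib E x\<^esub>) \<in> sect E U"
    and add: "\<And>s t. s \<in> sect E U \<Longrightarrow> t \<in> sect E U \<Longrightarrow> (\<lambda>x\<in>U. s x \<oplus>\<^bsub>fib E x\<^esub> t x) \<in> sect E U"
    and smult: "\<And>c s. s \<in> sect E U \<Longrightarrow> (\<lambda>x\<in>U. c \<odot>\<^bsub>fib E x\<^esub> s x) \<in> sect E U"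
  shows "vectorspace CC (section_space E U)"
proof -
  have simps: "carrier (section_space E U) = sect E U" "\<zero>\<^bsub>section_space E U\<^esub> = (\<lambda>x\<in>U. \<zero>\<^bsub>fib E x\<^esub>)"
    "s \<oplus>\<^bsub>section_space E U\<^esub> t = (\<lambda>x\<in>U. s x \<oplus>\<^bsub>fib E x\<^esub> t x)"
    "c \<odot>\<^bsub>section_space E U\<^esub> s = (\<lambda>x\<in>U. c \<odot>\<^bsub>fib E x\<^esub> s x)" for s t c
    by (simp_all add: section_space_def)
  \<comment> \<open>Sections are \<open>undefined\<close> outside \<open>U\<close>, so equality on
    \<open>U\<close> is equality.\<close>
  have ext: "s = (\<lambda>x\<in>U. f x)" if "s \<in> sect E U" "\<And>x. x \<in> U \<Longrightarrow> s x = f x" for s f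
    using carr that by (intro ext) (auto simp: PiE_def extensional_def subset_iff)
  have val: "s x \<in> carrier (fib E x)" if "s \<in> sect E U" "x \<in> U" for s x
    using carr that by (auto simp: subset_iff)
  have F: "v \<oplus>\<^bsub>fib E x\<^esub> ((- 1) \<odot>\<^bsub>fib E x\<^esub> v) = \<zero>\<^bsub>fib E x\<^esub>" 
    "v \<oplus>\<^bsub>fib E x\<^esub> w = w \<oplus>\<^bsub>fib E x\<^esub> v"
    "v \<oplus>\<^bsub>fib E x\<^esub> w \<oplus>\<^bsub>fib E x\<^esub> u = v \<oplus>\<^bsub>fib E x\<^esub> (w \<oplus>\<^bsub>fib E x\<^esub> u)"
    "v \<oplus>\<^bsub>fib E x\<^esub> \<zero>\<^bsub>fib E x\<^esub> = v"
    "(a * b) \<odot>\<^bsub>fib E x\<^esub> v = a \<odot>\<^bsub>fib E x\<^esub> (b \<odot>\<^bsub>fib E x\<^esub> v)"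
    "1 \<odot>\<^bsub>fib E x\<^esub> v = v"
    "(a + b) \<odot>\<^bsub>fib E x\<^esub> v = a \<odot>\<^bsub>fib E x\<^esub> v \<oplus>\<^bsub>fib E x\<^esub> b \<odot>\<^bsub>fib E x\<^esub> v"
    "a \<odot>\<^bsub>fib E x\<^esub> (v \<oplus>\<^bsub>fib E x\<^esub> w) = a \<odot>\<^bsub>fib E x\<^esub> v \<oplus>\<^bsub>fib E x\<^esub> a \<odot>\<^bsub>fib E x\<^esub> w"
    if "x \<in> U" "v \<in> carrier (fib E x)" "w \<in> carrier (fib E x)" "u \<in> carrier (fib E x)" for x v w u a b
  proof -
    interpret V: vectorspace CC "fib E x" by (rule vs[OF that(1)])
    have "(- 1) \<odot>\<^bsub>fib E x\<^esub> v = \<ominus>\<^bsub>fib E x\<^esub> v"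
      using V.smult_minus_1[OF that(2)] by (simp only: class_ring_simps)
    then show "v \<oplus>\<^bsub>fib E x\<^esub> ((- 1) \<odot>\<^bsub>fib E x\<^esub> v) = \<zero>\<^bsub>fib E x\<^esub>"
      using V.M.r_neg[OF that(2)] by simp
    show "v \<oplus>\<^bsub>fib E x\<^esub> w = w \<oplus>\<^bsub>fib E x\<^esub> v" by (rule V.M.a_comm[OF that(2,3)])
    show "v \<oplus>\<^bsub>fib E x\<^esub> w \<oplus>\<^bsub>fib E x\<^esub> u = v \<oplus>\<^bsub>fib E x\<^esub> (w \<oplus>\<^bsub>fib E x\<^esub> u)"
      by (rule V.M.a_assoc[OF that(2,3,4)])
    show "v \<oplus>\<^bsub>fib E x\<^esub> \<zero>\<^bsub>fib E x\<^esub> = v" by (rule V.M.r_zero[OF that(2)])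
    show "(a * b) \<odot>\<^bsub>fib E x\<^esub> v = a \<odot>\<^bsub>fib E x\<^esub> (b \<odot>\<^bsub>fib E x\<^esub> v)"
      using V.smult_assoc1[of a b v] that(2) by simp
    show "1 \<odot>\<^bsub>fib E x\<^esub> v = v" using V.smult_one[OF that(2)] by simp
    show "(a + b) \<odot>\<^bsub>fib E x\<^esub> v = a \<odot>\<^bsub>fib E x\<^esub> v \<oplus>\<^bsub>fib E x\<^esub> b \<odot>\<^bsub>fib E x\<^esub> v"
      using V.smult_l_distr[of a b v] that(2) by simp
    show "a \<odot>\<^bsub>fib E x\<^esub> (v \<oplus>\<^bsub>fib E x\<^esub> w) = a \<odot>\<^bsub>fib E x\<^esub> v \<oplus>\<^bsub>fib E x\<^esub> a \<odot>\<^bsub>fib E x\<^esub> w"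
      using V.smult_r_distr[of a v w] that(2,3) by simp
  qed
  show ?thesis
  proof (rule vs_criteria, unfold simps, goal_cases)
    case 1 show ?case by (rule class_field)
  next
    case 2 show ?case by (rule zero)
  next
    case 3 show ?case using add by blast
  next
    case 4
    show ?case
    proof
      fix s assume s: "s \<in> sect E U"
      show "\<exists>t\<in>sect E U. (\<lambda>x\<in>U. s x \<oplus>\<^bsub>fib E x\<^esub> t x) = (\<lambda>x\<in>U. \<zero>\<^bsub>fib E x\<^esub>)"
        by (rule bexI[OF _ smult[OF s, of "- 1"]], intro restrict_ext)
          (use F(1)[OF _ val[OF s] val[OF s] val[OF s]] in simp)
    qed
  next
    case 5 show ?case using smult by blast
  next
    case 6
    show ?case
    proof (intro allI impI, elim conjE, intro restrict_ext)
      fix s t x assume "s \<in> sect E U" "t \<in> sect E U" "x \<in> U"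
      then show "s x \<oplus>\<^bsub>fib E x\<^esub> t x = t x \<oplus>\<^bsub>fib E x\<^esub> s x" using F(2) val by blast
    qed
  next
    case 7
    show ?case
    proof (intro allI impI, elim conjE, intro restrict_ext)
      fix s t r x assume "s \<in> sect E U" "t \<in> sect E U" "r \<in> sect E U" and x: "x \<in> U"
      then show "(\<lambda>x\<in>U. s x \<oplus>\<^bsub>fib E x\<^esub> t x) x \<oplus>\<^bsub>fib E x\<^esub> r x =
          s x \<oplus>\<^bsub>fib E x\<^esub> (\<lambda>x\<in>U. t x \<oplus>\<^bsub>fib E x\<^esub> r x) x"
        using F(3)[OF x val[OF _ x] val[OF _ x] val[OF _ x]] by simp
    qed
  next
    case 8
    show ?case
      using F(4)[OF _ val val val] ext by (intro ballI, subst eq_commute, intro ext) simp_all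
  next
    case 9
    show ?case
    proof (intro allI impI, elim conjE, intro restrict_ext)
      fix a b s x assume s: "s \<in> sect E U" and x: "x \<in> U"
      show "(a \<otimes>\<^bsub>CC\<^esub> b) \<odot>\<^bsub>fib E x\<^esub> s x = a \<odot>\<^bsub>fib E x\<^esub> (\<lambda>x\<in>U. b \<odot>\<^bsub>fib E x\<^esub> s x) x"
        using F(5)[OF x val[OF s x] val[OF s x] val[OF s x]] x by simp
    qed
  next
    case 10
    show ?case
      using F(6)[OF _ val val val] ext by (intro ballI, subst eq_commute, intro ext) simp_all
  next
    case 11
    show ?case
    proof (intro allI impI, elim conjE, intro restrict_ext)
      fix a b s x assume s: "s \<in> sect E U" and x: "x \<in> U"
      show "(a \<oplus>\<^bsub>CC\<^esub> b) \<odot>\<^bsub>fib E x\<^esub> s x =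
          (\<lambda>x\<in>U. a \<odot>\<^bsub>fib E x\<^esub> s x) x \<oplus>\<^bsub>fib E x\<^esub> (\<lambda>x\<in>U. b \<odot>\<^bsub>fib E x\<^esub> s x) x"
        using F(7)[OF x val[OF s x] val[OF s x] val[OF s x]] x by simp
    qed
  next
    case 12
    show ?case
    proof (intro allI impI, elim conjE, intro restrict_ext)
      fix a s t x assume s: "s \<in> sect E U" and t: "t \<in> sect E U" and x: "x \<in> U"
      show "a \<odot>\<^bsub>fib E x\<^esub> (\<lambda>x\<in>U. s x \<oplus>\<^bsub>fib E x\<^esub> t x) x =
          (\<lambda>x\<in>U. a \<odot>\<^bsub>fib E x\<^esub> s x) x \<oplus>\<^bsub>fib E x\<^esub> (\<lambda>x\<in>U. a \<odot>\<^bsub>fib E x\<^esub> t x) x"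
        using F(8)[OF x val[OF s x] val[OF t x] val[OF t x]] x by simp
    qed
  qed
qed

lemma (in embedded_variety) divisor_sections_vectorspace:
  assumes D: "\<And>e. e \<in> D \<Longrightarrow> openin (tsp X) (eq_dom e)"
  shows "vectorspace CC (section_space (divisor_bundle X D) (pts X))"
proof (rule section_space_vectorspace)
  let ?E = "divisor_bundle X D" and ?U = "pts X"
  have dom: "openin (tsp X) (?U \<inter> eq_dom e)" if "e \<in> D" for e using D[OF that] by blast
  show vs: "vectorspace CC (fib ?E x)" for x by (rule divisor_bundle_vectorspace)
  have PiE: "s \<in> (\<Pi>\<^sub>E x\<in>?U. carrier (fib ?E x))"
    and reg: "e \<in> D \<Longrightarrow> (\<lambda>x. s x e) \<in> reg X (?U \<inter> eq_dom e)"
    if "s \<in> sect ?E ?U" for s e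
    using that unfolding divisor_bundle_sections by simp_all
  show "sect ?E ?U \<subseteq> (\<Pi>\<^sub>E x\<in>?U. carrier (fib ?E x))" by (rule subsetI) (rule PiE)
  note val = PiE_mem[OF PiE]
  have z: "\<zero>\<^bsub>fib ?E x\<^esub> = (\<lambda>_. 0)" for x by (simp add: divisor_bundle_def fun_vs_simps)
  have zc: "\<zero>\<^bsub>fib ?E x\<^esub> \<in> carrier (fib ?E x)" for x
  proof -
    interpret V: vectorspace CC "fib ?E x" by (rule vs)
    show ?thesis by simp
  qed
  show "(\<lambda>x\<in>?U. \<zero>\<^bsub>fib ?E x\<^esub>) \<in> sect ?E ?U"
    unfolding divisor_bundle_sections
  proof (intro conjI ballI)
    show "(\<lambda>x\<in>?U. \<zero>\<^bsub>fib ?E x\<^esub>) \<in> (\<Pi>\<^sub>E x\<in>?U. carrier (fib ?E x))" using zc by auto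
    fix e assume "e \<in> D"
    show "(\<lambda>x. (\<lambda>x\<in>?U. \<zero>\<^bsub>fib ?E x\<^esub>) x e) \<in> reg X (?U \<inter> eq_dom e)"
      by (rule reg_cong[OF reg_const[of _ 0, OF dom[OF \<open>e \<in> D\<close>]] dom[OF \<open>e \<in> D\<close>]]) (simp add: z)
  qed
  fix s assume s: "s \<in> sect ?E ?U"
  show "(\<lambda>x\<in>?U. s x \<oplus>\<^bsub>fib ?E x\<^esub> t x) \<in> sect ?E ?U" if t: "t \<in> sect ?E ?U" for t
    unfolding divisor_bundle_sections
  proof (intro conjI ballI)
    have "s x \<oplus>\<^bsub>fib ?E x\<^esub> t x \<in> carrier (fib ?E x)" if "x \<in> ?U" for x
    proof -
      interpret V: vectorspace CC "fib ?E x" by (rule vs)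
      show ?thesis by (rule V.M.a_closed[OF val[OF s that] val[OF t that]])
    qed
    then show "(\<lambda>x\<in>?U. s x \<oplus>\<^bsub>fib ?E x\<^esub> t x) \<in> (\<Pi>\<^sub>E x\<in>?U. carrier (fib ?E x))" by auto
    fix e assume e: "e \<in> D"
    show "(\<lambda>x. (\<lambda>x\<in>?U. s x \<oplus>\<^bsub>fib ?E x\<^esub> t x) x e) \<in> reg X (?U \<inter> eq_dom e)"
      by (rule reg_cong[OF reg_add[OF dom[OF e] reg[OF s e] reg[OF t e]] dom[OF e]])
        (simp add: divisor_bundle_fibre(2))
  qed
  show "(\<lambda>x\<in>?U. c \<odot>\<^bsub>fib ?E x\<^esub> s x) \<in> sect ?E ?U" for c
    unfolding divisor_bundle_sections
  proof (intro conjI ballI)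
    have "c \<odot>\<^bsub>fib ?E x\<^esub> s x \<in> carrier (fib ?E x)" if "x \<in> ?U" for x
    proof -
      interpret V: vectorspace CC "fib ?E x" by (rule vs)
      show ?thesis by (rule V.smult_closed[OF _ val[OF s that]]) simp
    qed
    then show "(\<lambda>x\<in>?U. c \<odot>\<^bsub>fib ?E x\<^esub> s x) \<in> (\<Pi>\<^sub>E x\<in>?U. carrier (fib ?E x))" by auto
    fix e assume e: "e \<in> D"
    show "(\<lambda>x. (\<lambda>x\<in>?U. c \<odot>\<^bsub>fib ?E x\<^esub> s x) x e) \<in> reg X (?U \<inter> eq_dom e)"
      by (rule reg_cong[OF reg_mult[OF dom[OF e] reg_const[OF dom[OF e], of c] reg[OF s e]] dom[OF e]])
        (simp add: divisor_bundle_fibre(3))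
  qed
qed

text \<open>Membership in a basis makes each \<open>s j\<close> a global section, whose fibre values
  give the transition law and whose components give regularity; the coordinates are part of the
  definition of the embedding.\<close>

lemma polarized_varietyI:
  assumes X: "projective_variety X" and H: "very_ample X H" and \<iota>: "embedding_defined_by X H N \<iota>"
  shows "\<exists>s. polarized_variety X N \<iota> H s"
proof -
  obtain s where basis: "vectorspace.basis CC (section_space (divisor_bundle X H) (pts X)) (s ` {..N})"
    and coords: "\<forall>x\<in>pts X. \<forall>e\<in>H. x \<in> eq_dom e \<longrightarrow> (\<exists>j\<le>N. s j x e \<noteq> 0) \<and> \<iota> x = hline (\<lambda>j. if j \<le> N then s j x e else 0)"
    and emb: "closed_embedding X (proj_space N) \<iota>"
    using \<iota> unfolding embedding_defined_by_def by blast
  have cartier: "cartier_divisor X H" using H by (simp add: very_ample_def)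
  interpret embedded_variety X N \<iota>
    using X emb by unfold_locales (simp_all add: projective_variety_def)
  have H_open: "openin (tsp X) (eq_dom e)" if "e \<in> H" for e
    using cartier that by (simp add: cartier_divisor_def)
  \<comment> \<open>Global sections are regular on the intersection with all of X, whereas the
    locale speaks of the domain of the equation itself.\<close>
  then have H_pts: "pts X \<inter> eq_dom e = eq_dom e" if "e \<in> H" for e
    using openin_subset[OF H_open[OF that]] by blast
  have "s ` {..N} \<subseteq> sect (divisor_bundle X H) (pts X)"
    using basis vectorspace.basis_def[OF divisor_sections_vectorspace[OF H_open]]
    by (simp add: section_space_def)
  then have sec: "s j \<in> sect (divisor_bundle X H) (pts X)" if "j \<le> N" for j using that by auto
  have "polarized_variety X N \<iota> H s"
  proof
    show "cartier_divisor X H" by (rule cartier)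
    show "(\<lambda>x. s j x e) \<in> reg X (eq_dom e)" if "j \<le> N" "e \<in> H" for j e
      using sec[OF that(1)] that(2) H_pts[OF that(2)] unfolding divisor_bundle_sections by metis
    show "s j x e = g x * s j x e'"
      if "j \<le> N" "e \<in> H" "e' \<in> H" "x \<in> eq_dom e" "x \<in> eq_dom e'" "transition X e e' g" for j e e' x g
    proof -
      have "x \<in> pts X" using openin_subset[OF H_open[OF that(2)]] that(4) by blast
      then have "s j x \<in> carrier (fib (divisor_bundle X H) x)"
        using sec[OF that(1)] unfolding divisor_bundle_sections by auto
      then show ?thesis using that unfolding divisor_bundle_fibre(1) by blast
    qed
    show "\<iota> x = hline (\<lambda>j. if j \<le> N then s j x e else 0)" if "e \<in> H" "x \<in> eq_dom e" for e x
      using coords openin_subset[OF H_open[OF that(1)]] that by blast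
  qed
  then show ?thesis by blast
qed

theorem proposition6p3:
  fixes X :: "'x fspace"
    and H :: "'x local_eq set"
    and \<iota> :: "'x \<Rightarrow> (nat \<Rightarrow> complex) set"
    and n N m :: nat
    and k :: int
  assumes "projective_variety X"
    and "smooth X"
    and "dimension X = enat n"
    and "very_ample X H"
    and "embedding_defined_by X H N \<iota>"
    and "1 \<le> m"
    and "1 \<le> k + int m"
    and "k + int m \<le> int n"
  shows "(m \<le> bundle_rank X (restricted_tangent_bundle X (proj_space N) \<iota>) \<longrightarrow>
        \<not> ulrich X H (twist X H (wedge_bundle X m (restricted_tangent_bundle X (proj_space N) \<iota>)) k)) \<and>
      (m \<le> bundle_rank X (normal_bundle X (proj_space N) \<iota>) \<longrightarrow>
        \<not> ulrich X H (twist X H (wedge_bundle X m (normal_bundle X (proj_space N) \<iota>)) k))"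
proof -
  obtain s where "polarized_variety X N \<iota> H s"
    using polarized_varietyI[OF assms(1,4,5)] by blast
  then interpret polarized_variety X N \<iota> H s .
  have "enat (nat (k + int m)) \<le> dimension X" using assms(3,7,8) by simp
  then show ?thesis
    using restricted_tangent_not_ulrich[OF _ assms(7)] normal_not_ulrich[OF assms(2,3) _ assms(7)] by blast
qed

end
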